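(* Let $\mathcal Q$ be a collection of alternative distributions and let $\mathcal W$ be the class of all $\mathcal P$-$e$-processes. Suppose $W=(W_n)_{n=1}^\infty\in\mathcal W$ satisfies the portfolio regret bound $$\max_{\lambda\in\triangle_d}\sum_{i=1}^n\log(\lambda^\top\mathbf E_i)-\log(W_n)\le r_n\qquad\text{for all }n,$$ for some deterministic sublinear sequence $r_n=o(n)$. Then: (i) $W$ is $\mathcal Q$-uniformly and instance-log-optimal in $\mathcal W$: for any $W'\in\mathcal W$, $$\forall\varepsilon>0,\quad\lim_{m\to\infty}\sup_{Q\in\mathcal Q}Q\left(\sup_{k\ge m}\frac1k\log(W_k'/W_k)\ge\varepsilon\right)=0.$$ (ii) If $(a_n)$ is a nonnegative nondecreasing sequence diverging to infinity with $\sum_{k=1}^\infty\exp\{-a_k\varepsilon/2\}<\infty$ for every $\varepsilon>0$ and $a_n^{-1}r_n\to0$, then $W$ and $W(\lambda_Q)$, where $W_n(\lambda_Q):=\prod_{i=1}^n\lambda_Q^\top\mathbf E_i$, are $\mathcal Q$-uniformly asymptotically equivalent at a rate of $a_n/n$: $$\forall\varepsilon>0,\quad\lim_{m\to\infty}\sup_{Q\in\mathcal Q}Q\left(\sup_{k\ge m}a_k^{-1}\left|\log(W_k)-\log(W_k(\lambda_Q))\right|\ge\varepsilon\right)=0.$$ (iii) Let $\mathcal Q^\circ\subseteq\mathcal Q$ be such that $L_Q^\star:=\log(\lambda_Q^\top\mathbf E_1)$ has a $\mathcal Q^\circ$-uniformly integrable $p$-th moment for some $p\in[1,2)$: $$\lim_{m\to\infty}\sup_{Q\in\mathcal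 Q^\circ}\mathbb E_Q\left[|L_Q^\star-\ell_Q^\star|^p\,\mathbf 1\{|L_Q^\star-\ell_Q^\star|^p\ge m\}\right]=0.$$ If additionally $r_n=o(n^{1/p})$, then $$\forall\varepsilon>0,\quad\lim_{m\to\infty}\sup_{Q\in\mathcal Q^\circ}Q\left(\sup_{k\ge m}k^{1-1/p}\left|\frac1k\log W_k-\ell_Q^\star\right|\ge\varepsilon\right)=0.$$
   Context: Fix $d\in\mathbb N$ and let $\triangle_d=\{\lambda\in[0,1]^{d+1}:\sum_{j=0}^d\lambda^{(j)}=1\}$. Let $(\mathbf E_n)_{n=1}^\infty$, $\mathbf E_n=(E_n^{(0)},\dots,E_n^{(d)})$, be random vectors with values in $[0,\infty)^{d+1}$ such that $E_n^{(0)}=1$ deterministically; the coordinates of $\mathbf E_n$ may be arbitrarily dependent. Let $\mathcal F_n=\sigma(\mathbf E_1,\dots,\mathbf E_n)$, with $\mathcal F_0$ trivial. Under every distribution considered, $(\mathbf E_n)$ is i.i.d. Null hypothesis: $\mathcal P$ is the set of all distributions $P$ (making $(\mathbf E_n)$ i.i.d.) with $\mathbb E_P[E_1^{(j)}]\le 1$ for each $j\in\{1,\dots,d\}$. An alternative distribution is a distribution $Q$ under which $(\mathbf E_n)$ is i.i.d. A test $P$-supermartingale is a nonnegative adapted process $(M_n)$ with $\mathbb E_P[M_n\mid\mathcal F_{n-1}]\le M_{n-1}$ $P$-a.s. for $n\ge2$ and $\mathbb E_P[M_1]\le1$. A $\mathcal P$-$e$-process is a nonnegative adapted process $(W_n)$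 such that for each $P\in\mathcal P$ there is a test $P$-supermartingale $(M_n^{(P)})$ with $W_n\le M_n^{(P)}$ for all $n$, $P$-a.s. For an alternative $Q$: $\lambda_Q\in\arg\max_{\lambda\in\triangle_d}\mathbb E_Q[\log(\lambda^\top\mathbf E_1)]$ and $\ell_Q^\star=\mathbb E_Q[\log(\lambda_Q^\top\mathbf E_1)]$, understood to be well defined and finite. Convention: $\log0=-\infty$. The regret bound holds for every outcome. *)

theory Defs
  imports "HOL-Probability.Probability" "HOL-Library.Landau_Symbols"
begin

text \<open>
  Vectors with coordinates 0, ..., d are rendered as \<open>real ^ 'j\<close> with \<open>CARD('j) = d + 1\<close>; the
  distinguished index \<open>z :: 'j\<close> plays the role of coordinate 0.  All processes are indexed by
  \<open>n \<ge> 1\<close>; their values at 0 are irrelevant.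
\<close>

definition evectors :: "'j::finite \<Rightarrow> (real ^ 'j) set" where
  "evectors z = {x. x $ z = 1 \<and> (\<forall>j. 0 \<le> x $ j)}"

definition weights :: "(real ^ 'j::finite) set" where
  "weights = {l. (\<forall>j. l $ j \<in> {0..1}) \<and> (\<Sum>j\<in>UNIV. l $ j) = 1}"

text \<open>Only meant for nonnegative arguments; the convention is \<open>log 0 = -\<infinity>\<close>.\<close>

definition elog :: "real \<Rightarrow> ereal" where
  "elog x = (if x \<le> 0 then -\<infinity> else ereal (ln x))"

definition iid_dist :: "'w measure \<Rightarrow> (nat \<Rightarrow> 'w \<Rightarrow> real ^ 'j::finite) \<Rightarrow> 'w measure \<Rightarrow> bool" where
  "iid_dist M E P \<longleftrightarrow>
     prob_space P \<and> sets P = sets M \<and>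
     prob_space.indep_vars P (\<lambda>_. borel) E {1..} \<and>
     (\<forall>n\<ge>1. distr P borel (E n) = distr P borel (E 1))"

text \<open>
  The underlying measurable space (\<open>M\<close> is only used through \<open>space M\<close> and \<open>sets M\<close>).  The last
  conjunct makes ``the set of all distributions under which the sequence is i.i.d.'' literal: every
  law on the range of the vectors is the marginal law of some probability measure on the space.
  Without it, the null hypothesis could be too small (even empty) for accidental reasons, e.g. if
  the vectors were constant functions.  The coordinate process on sequence space
  is an instance, see \<open>coordinate_process_evidence_space\<close> below.
\<close>

definition evidence_space :: "'j::finite \<Rightarrow> 'w measure \<Rightarrow> (nat \<Rightarrow> 'w \<Rightarrow> real ^ 'j) \<Rightarrow> bool" where
  "evidence_space z M E \<longleftrightarrow>
     (\<forall>n\<ge>1. E n \<in> borel_measurable M \<and> (\<forall>\<omega>\<in>space M. E n \<omega> \<in> evectors z)) \<and>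
     (\<forall>\<mu>. prob_space \<mu> \<and> sets \<mu> = sets borel \<and> (AE x in \<mu>. x \<in> evectors z) \<longrightarrow>
        (\<exists>P. iid_dist M E P \<and> distr P borel (E 1) = \<mu>))"

lemma evectors_borel: "evectors z \<in> sets borel"
proof -
  have "evectors z = {x. x $ z = 1} \<inter> (\<Inter>j. {x. 0 \<le> x $ j})"
    by (auto simp: evectors_def)
  moreover have "closed ({x :: real ^ 'a. x $ z = 1} \<inter> (\<Inter>j. {x. 0 \<le> x $ j}))"
    by (intro closed_Int closed_INT ballI closed_Collect_eq closed_Collect_le continuous_intros)
  ultimately show ?thesis by (simp add: borel_closed)
qed

lemma coordinate_process_evidence_space:
  "evidence_space z (PiM UNIV (\<lambda>_. restrict_space borel (evectors z))) (\<lambda>n \<omega>. \<omega> n)"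
proof -
  define S where "S = restrict_space borel (evectors z)"
  define \<Omega> where "\<Omega> = PiM (UNIV :: nat set) (\<lambda>_. S)"
  have spS: "space S = evectors z" by (simp add: S_def space_restrict_space)
  have idS: "(\<lambda>x. x) \<in> measurable S borel"
    unfolding S_def by (rule measurable_restrict_space1) simp
  have coord: "(\<lambda>\<omega>. \<omega> n) \<in> measurable \<Omega> S" for n
    unfolding \<Omega>_def by (rule measurable_component_singleton) simp
  have 1: "(\<lambda>\<omega>. \<omega> n) \<in> borel_measurable \<Omega>" for n
    using measurable_compose[OF coord idS] .
  have 2: "\<omega> n \<in> evectors z" if "\<omega> \<in> space \<Omega>" for \<omega> n
    using that by (auto simp: \<Omega>_def space_PiM spS)
  have 3: "\<exists>P. iid_dist \<Omega> (\<lambda>n \<omega>. \<omega> n) P \<and> distr P borel (\<lambda>\<omega>. \<omega> 1) = \<mu>"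
    if \<mu>: "prob_space \<mu>" "sets \<mu> = sets borel" "AE x in \<mu>. x \<in> evectors z" for \<mu>
  proof -
    interpret \<mu>: prob_space \<mu> by fact
    define \<nu> where "\<nu> = restrict_space \<mu> (evectors z)"
    have ev: "evectors z \<in> sets \<mu>" using evectors_borel \<mu>(2) by simp
    have one: "emeasure \<mu> (evectors z) = 1"
      using \<mu>(3) ev by (subst \<mu>.emeasure_eq_1_AE) auto
    have sets\<nu>: "sets \<nu> = sets S"
      unfolding \<nu>_def S_def using \<mu>(2) by (rule sets_restrict_space_cong)
    have p\<nu>: "prob_space \<nu>"
      unfolding \<nu>_def by (rule prob_space_restrict_space) (use ev one in auto)
    define P where "P = PiM (UNIV :: nat set) (\<lambda>_. \<nu>)"
    interpret P: prob_space P unfolding P_def by (rule prob_space_PiM) (rule p\<nu>)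
    have setsP: "sets P = sets \<Omega>"
      unfolding P_def \<Omega>_def by (intro sets_PiM_cong refl sets\<nu>)
    have id\<nu>: "(\<lambda>x. x) \<in> measurable \<nu> borel"
      using idS by (simp add: measurable_cong_sets[OF sets\<nu> refl])
    have d\<nu>: "distr \<nu> borel (\<lambda>x. x) = \<mu>"
    proof (rule measure_eqI)
      fix A assume A: "A \<in> sets (distr \<nu> borel (\<lambda>x. x))"
      have "emeasure (distr \<nu> borel (\<lambda>x. x)) A = emeasure \<nu> (A \<inter> evectors z)"
        using A ev by (subst emeasure_distr[OF id\<nu>]) (auto simp: \<nu>_def space_restrict_space \<mu>(2))
      also have "\<dots> = emeasure \<mu> (A \<inter> evectors z)"
        unfolding \<nu>_def using ev by (intro emeasure_restrict_space) auto
      also have "\<dots> = emeasure \<mu> A"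
        by (intro emeasure_eq_AE) (use \<mu>(3) A ev in \<open>auto simp: \<mu>(2)\<close>)
      finally show "emeasure (distr \<nu> borel (\<lambda>x. x)) A = emeasure \<mu> A" .
    qed (simp add: \<mu>(2))
    have c\<nu>: "(\<lambda>\<omega>. \<omega> n) \<in> measurable P \<nu>" for n
      unfolding P_def by (rule measurable_component_singleton) simp
    have cd: "distr P \<nu> (\<lambda>\<omega>. \<omega> n) = \<nu>" for n
      unfolding P_def by (rule distr_PiM_component) (auto intro: p\<nu>)
    have d: "distr P borel (\<lambda>\<omega>. \<omega> n) = \<mu>" for n
      using distr_distr[OF id\<nu> c\<nu>, of n] by (simp add: cd d\<nu> comp_def)
    have "P.indep_vars (\<lambda>_. \<nu>) (\<lambda>n \<omega>. \<omega> n) UNIV"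
      by (subst P.indep_vars_iff_distr_eq_PiM)
        (use c\<nu> in \<open>auto simp: cd P_def[symmetric] restrict_UNIV distr_id2\<close>)
    then have "P.indep_vars (\<lambda>_. \<nu>) (\<lambda>n \<omega>. \<omega> n) {1..}"
      by (rule P.indep_vars_subset) simp
    from P.indep_vars_compose2[OF this id\<nu>]
    have "P.indep_vars (\<lambda>_. borel) (\<lambda>n \<omega>. \<omega> n) {1..}" .
    then show ?thesis
      using P.prob_space_axioms setsP d by (intro exI[of _ P]) (auto simp: iid_dist_def)
  qed
  show ?thesis
    unfolding evidence_space_def using 1 2 3 by (fold S_def, fold \<Omega>_def) blast
qed

definition null_hyp :: "'j::finite \<Rightarrow> 'w measure \<Rightarrow> (nat \<Rightarrow> 'w \<Rightarrow> real ^ 'j) \<Rightarrow> 'w measure set" where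
  "null_hyp z M E =
     {P. iid_dist M E P \<and> (\<forall>j. j \<noteq> z \<longrightarrow> (\<integral>\<^sup>+ \<omega>. ennreal (E 1 \<omega> $ j) \<partial>P) \<le> 1)}"

text \<open>The sigma-algebra generated by the first \<open>n\<close> vectors; trivial for \<open>n = 0\<close>.\<close>

definition nat_filt :: "'w measure \<Rightarrow> (nat \<Rightarrow> 'w \<Rightarrow> real ^ 'j::finite) \<Rightarrow> nat \<Rightarrow> 'w measure" where
  "nat_filt M E n = sigma (space M) (\<Union>i\<in>{1..n}. {E i -` A \<inter> space M | A. A \<in> sets borel})"

definition nonneg_adapted ::
    "'w measure \<Rightarrow> (nat \<Rightarrow> 'w \<Rightarrow> real ^ 'j::finite) \<Rightarrow> (nat \<Rightarrow> 'w \<Rightarrow> real) \<Rightarrow> bool" where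
  "nonneg_adapted M E X \<longleftrightarrow>
     (\<forall>n\<ge>1. X n \<in> borel_measurable (nat_filt M E n) \<and> (\<forall>\<omega>\<in>space M. 0 \<le> X n \<omega>))"

definition test_supermartingale ::
    "'w measure \<Rightarrow> (nat \<Rightarrow> 'w \<Rightarrow> real ^ 'j::finite) \<Rightarrow> 'w measure \<Rightarrow> (nat \<Rightarrow> 'w \<Rightarrow> real) \<Rightarrow> bool" where
  "test_supermartingale M E P X \<longleftrightarrow>
     nonneg_adapted M E X \<and>
     (\<forall>n\<ge>2. AE \<omega> in P.
        nn_cond_exp P (nat_filt M E (n - 1)) (\<lambda>\<omega>. ennreal (X n \<omega>)) \<omega> \<le> ennreal (X (n - 1) \<omega>)) \<and>
     (\<integral>\<^sup>+ \<omega>. ennreal (X 1 \<omega>) \<partial>P) \<le> 1"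

definition e_processes ::
    "'j::finite \<Rightarrow> 'w measure \<Rightarrow> (nat \<Rightarrow> 'w \<Rightarrow> real ^ 'j) \<Rightarrow> (nat \<Rightarrow> 'w \<Rightarrow> real) set" where
  "e_processes z M E =
     {W. nonneg_adapted M E W \<and>
         (\<forall>P\<in>null_hyp z M E. \<exists>X. test_supermartingale M E P X \<and>
            (AE \<omega> in P. \<forall>n\<ge>1. W n \<omega> \<le> X n \<omega>))}"

definition wealth :: "(nat \<Rightarrow> 'w \<Rightarrow> real ^ 'j::finite) \<Rightarrow> real ^ 'j \<Rightarrow> nat \<Rightarrow> 'w \<Rightarrow> real" where
  "wealth E l n \<omega> = (\<Prod>i=1..n. l \<bullet> E i \<omega>)"

text \<open>
  Expectation of an extended-real random variable as positive part minus negative part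
  (\<^const>\<open>e2ennreal\<close> truncates negative numbers to 0).  The undefined case
  \<open>\<infinity> - \<infinity>\<close> evaluates to \<open>\<infinity>\<close> in \<^typ>\<open>ereal\<close>, so a value different from
  \<open>\<infinity>\<close> means that the expectation is well defined.
\<close>

definition eexpectation :: "'w measure \<Rightarrow> ('w \<Rightarrow> ereal) \<Rightarrow> ereal" where
  "eexpectation P X =
     enn2ereal (\<integral>\<^sup>+ \<omega>. e2ennreal (X \<omega>) \<partial>P) - enn2ereal (\<integral>\<^sup>+ \<omega>. e2ennreal (- X \<omega>) \<partial>P)"

definition growth :: "(nat \<Rightarrow> 'w \<Rightarrow> real ^ 'j::finite) \<Rightarrow> 'w measure \<Rightarrow> real ^ 'j \<Rightarrow> ereal" where
  "growth E Q l = eexpectation Q (\<lambda>\<omega>. elog (l \<bullet> E 1 \<omega>))"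

text \<open>
  \<open>l\<close> maximises the growth rate over the simplex and the maximum is finite.  In particular no
  competitor has growth \<open>\<infinity>\<close>, so all the expectations compared are well defined.
\<close>

definition log_optimal :: "(nat \<Rightarrow> 'w \<Rightarrow> real ^ 'j::finite) \<Rightarrow> 'w measure \<Rightarrow> real ^ 'j \<Rightarrow> bool" where
  "log_optimal E Q l \<longleftrightarrow> is_arg_max (growth E Q) (\<lambda>l. l \<in> weights) l \<and> \<bar>growth E Q l\<bar> \<noteq> \<infinity>"

text \<open>
  \<open>\<bar>log (l\<^sup>T E\<^sub>1) - \<ell>\<bar>\<^sup>p\<close> for \<open>\<ell>\<close> the (finite) growth rate of \<open>l\<close>.  Finiteness of
  \<open>\<ell>\<close> entails \<open>l\<^sup>T E\<^sub>1 > 0\<close> almost surely under \<open>Q\<close>, so the real logarithm may be used.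
\<close>

definition centred_moment ::
    "(nat \<Rightarrow> 'w \<Rightarrow> real ^ 'j::finite) \<Rightarrow> 'w measure \<Rightarrow> real ^ 'j \<Rightarrow> real \<Rightarrow> 'w \<Rightarrow> real" where
  "centred_moment E Q l p \<omega> = \<bar>ln (l \<bullet> E 1 \<omega>) - real_of_ereal (growth E Q l)\<bar> powr p"

text \<open>
  The maximum over the simplex is written as a supremum in \<^typ>\<open>ereal\<close>; it is attained because
  the simplex is compact and the map is continuous into \<open>[-\<infinity>, \<infinity>)\<close>.
\<close>

definition portfolio_regret_bound ::
    "'w measure \<Rightarrow> (nat \<Rightarrow> 'w \<Rightarrow> real ^ 'j::finite) \<Rightarrow> (nat \<Rightarrow> 'w \<Rightarrow> real) \<Rightarrow> (nat \<Rightarrow> real) \<Rightarrow> bool" where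
  "portfolio_regret_bound M E W r \<longleftrightarrow>
     (\<forall>n\<ge>1. \<forall>\<omega>\<in>space M.
        (SUP l\<in>weights. \<Sum>i=1..n. elog (l \<bullet> E i \<omega>)) - elog (W n \<omega>) \<le> ereal (r n))"

definition unif_tail_vanishes ::
    "'w measure set \<Rightarrow> ('w measure \<Rightarrow> nat \<Rightarrow> 'w \<Rightarrow> ereal) \<Rightarrow> bool" where
  "unif_tail_vanishes QQ Y \<longleftrightarrow>
     (\<forall>\<epsilon>::real. \<epsilon> > 0 \<longrightarrow>
        (\<lambda>m::nat. SUP Q\<in>QQ. emeasure Q {\<omega>\<in>space Q. (SUP k\<in>{m..}. Y Q k \<omega>) \<ge> ereal \<epsilon>})
          \<longlonglongrightarrow> 0)"

end

theory Submission
  imports Defs "HOL-Real_Asymp.Real_Asymp"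
begin

text \<open>
  Write \<open>V\<^sub>n = wealth E \<lambda>\<^sub>Q n\<close> for the wealth of the log-optimal portfolio of an alternative \<open>Q\<close>.
  The regret bound says \<open>W\<^sub>n \<ge> exp (- r\<^sub>n) V\<^sub>n\<close> on every outcome, so \<open>W\<close> is never much smaller
  than \<open>V\<close>. The probabilistic half of the theorem is that no e-process is ever much larger:
  for each \<open>W' \<in> e_processes z M E\<close> and each \<open>n\<close> the ratio \<open>W'\<^sub>n / V\<^sub>n\<close> has \<open>Q\<close>-expectation at
  most 1 (lemma \<open>e_process_wealth_ratio_le\<close>). Markov's inequality and a union bound then give
  \<open>W'\<^sub>k \<le> exp (a\<^sub>k) V\<^sub>k\<close> for all \<open>k \<ge> m\<close> outside an event of probability at most
  \<open>\<Sum>k\<ge>m. exp (- a\<^sub>k)\<close>. This bound does not mention \<open>Q\<close>, and that is the source of all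
  uniformity in the first two parts: the first uses it with \<open>a\<^sub>k\<close> proportional to \<open>k\<close>, the second
  with \<open>W' = W\<close> and the given sequence.

  The ratio has expectation at most 1 for the following reason. Optimality of \<open>\<lambda>\<^sub>Q\<close> is a first-order
  condition, the numeraire property \<open>\<integral> (\<kappa>\<^sup>T E\<^sub>1) / (\<lambda>\<^sub>Q\<^sup>T E\<^sub>1) dQ \<le> 1\<close> for all weights \<open>\<kappa>\<close>
  (lemma \<open>log_optimal_numeraire\<close>). For \<open>\<kappa>\<close> the distinguished vertex it says that reweighting the law
  of \<open>E\<^sub>1\<close> by \<open>1 / \<lambda>\<^sub>Q\<^sup>T E\<^sub>1\<close> leaves total mass at most 1; for the other vertices it says that all
  coordinates keep mean at most 1. Putting the missing mass on the vector \<open>(1, 0, ..., 0)\<close> gives a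
  genuine law that satisfies the null constraints, and it is the marginal of some i.i.d. law \<open>P\<close> in
  the null hypothesis. Under \<open>P\<close> an e-process has expectation at most 1 at each time, and the
  \<open>n\<close>-fold product of the reweighted law of \<open>E\<^sub>1\<close> has \<open>Q\<close>-density \<open>1 / V\<^sub>n\<close> and lies below the law
  of \<open>(E\<^sub>1, ..., E\<^sub>n)\<close> under \<open>P\<close>.

  The third part compares \<open>ln V\<^sub>n = \<Sum>i\<le>n. ln (\<lambda>\<^sub>Q\<^sup>T E\<^sub>i)\<close> with \<open>n\<close> times its mean, so it needs a strong law
  of Marcinkiewicz--Zygmund type with an explicit, \<open>Q\<close>-free failure probability. Each summand is split at
  a fixed level. The bounded part has uniformly bounded variance, and the Hajek--Renyi inequality
  controls it from a late time \<open>m\<close> on (lemma \<open>bounded_partial_sums_tail\<close>). The unbounded part has a small \<open>p\<close>-th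
  moment \<open>\<eta>\<close> by uniform integrability, and a weak-type maximal inequality bounds the
  probability that it is ever large by a multiple of \<open>\<eta>\<close>, over all times at once
  (lemma \<open>marcinkiewicz_zygmund_maximal\<close>).
\<close>

(* Time starts at 1, and sums over {1..n} should keep that form in the simplifier. *)
declare One_nat_def [simp del]

section \<open>A weighted maximal inequality for sums of independent variables\<close>

text \<open>
  The sums form a martingale, so the cross term vanishes even after multiplication by a
  factor \<open>\<phi>\<close> that depends on the first \<open>n\<close> variables only. In the maximal inequality below, \<open>\<phi>\<close>
  is the indicator of the event that the level has not been crossed yet.
\<close>

lemma (in prob_space) partial_sum_second_moment_step:
  fixes V :: "nat \<Rightarrow> 'a \<Rightarrow> real"
  assumes indep: "indep_vars (\<lambda>_. borel) V {1..}"
    and sq: "\<And>i. 1 \<le> i \<Longrightarrow> integrable M (\<lambda>\<omega>. (V i \<omega>)\<^sup>2)"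
    and mean: "\<And>i. 1 \<le> i \<Longrightarrow> expectation (V i) = 0"
    and \<phi>: "\<phi> \<in> borel_measurable (PiM {1..n} (\<lambda>_. borel))" "\<And>x. 0 \<le> \<phi> x \<and> \<phi> x \<le> (1::real)"
    and Tn: "integrable M (\<lambda>\<omega>. (\<Sum>i=1..n. V i \<omega>)\<^sup>2)"
  shows "integrable M (\<lambda>\<omega>. (\<Sum>i=1..Suc n. V i \<omega>)\<^sup>2)"
    and "(\<integral>\<omega>. (\<Sum>i=1..Suc n. V i \<omega>)\<^sup>2 * \<phi> (\<lambda>i\<in>{1..n}. V i \<omega>) \<partial>M)
      \<le> (\<integral>\<omega>. (\<Sum>i=1..n. V i \<omega>)\<^sup>2 * \<phi> (\<lambda>i\<in>{1..n}. V i \<omega>) \<partial>M) + expectation (\<lambda>\<omega>. (V (Suc n) \<omega>)\<^sup>2)"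
proof -
  let ?T = "\<lambda>\<omega>. \<Sum>i=1..n. V i \<omega>"
  let ?v = "V (Suc n)"
  let ?Z = "\<lambda>\<omega>. \<lambda>i\<in>{1..n}. V i \<omega>"
  have rv: "V i \<in> borel_measurable M" if "1 \<le> i" for i
    using indep that by (auto simp: indep_vars_def)
  have [measurable]: "?v \<in> borel_measurable M" by (simp add: rv)
  have Tm[measurable]: "?T \<in> borel_measurable M" by (auto intro!: borel_measurable_sum rv)
  have Z: "?Z \<in> measurable M (PiM {1..n} (\<lambda>_. borel))"
    by (intro measurable_restrict rv) auto
  have [measurable]: "(\<lambda>\<omega>. \<phi> (?Z \<omega>)) \<in> borel_measurable M"
    using measurable_compose[OF Z \<phi>(1)] .
  have v2: "integrable M (\<lambda>\<omega>. (?v \<omega>)\<^sup>2)" by (simp add: sq)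
  have v1: "integrable M ?v" by (rule square_integrable_imp_integrable) (auto simp: v2)
  have T1: "integrable M ?T" by (rule square_integrable_imp_integrable[OF Tm Tn])
  have vT: "integrable M (\<lambda>\<omega>. ?T \<omega> * ?v \<omega>)"
  proof (rule Bochner_Integration.integrable_bound[OF Bochner_Integration.integrable_add[OF Tn v2]])
    have "\<bar>t * u\<bar> \<le> t\<^sup>2 + u\<^sup>2" for t u :: real
      using sum_squares_bound[of "\<bar>t\<bar>" "\<bar>u\<bar>"] mult_nonneg_nonneg[OF abs_ge_zero[of t] abs_ge_zero[of u]]
      unfolding abs_mult power2_abs by linarith
    then show "AE x in M. norm (?T x * ?v x) \<le> norm ((?T x)\<^sup>2 + (?v x)\<^sup>2)" by auto
  qed measurable
  have sqeq: "(\<Sum>i=1..Suc n. V i \<omega>)\<^sup>2 = (?T \<omega>)\<^sup>2 + 2 * (?T \<omega> * ?v \<omega>) + (?v \<omega>)\<^sup>2" for \<omega>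
    by (simp add: power2_eq_square algebra_simps)
  show "integrable M (\<lambda>\<omega>. (\<Sum>i=1..Suc n. V i \<omega>)\<^sup>2)"
    unfolding sqeq using Tn v2 vT by simp
  have bd: "integrable M (\<lambda>\<omega>. f \<omega> * \<phi> (?Z \<omega>))" if "integrable M f" for f
  proof (rule Bochner_Integration.integrable_bound[OF that])
    show "AE x in M. norm (f x * \<phi> (?Z x)) \<le> norm (f x)"
      using \<phi>(2) by (auto simp: abs_mult intro!: mult_right_le_one_le)
  qed (use that in auto)
  have i1: "indep_var (PiM {1..n} (\<lambda>_. borel)) ?Z (PiM {Suc n} (\<lambda>_. borel)) (\<lambda>\<omega>. \<lambda>i\<in>{Suc n}. V i \<omega>)"
    by (rule indep_var_restrict[OF indep]) auto
  have i2: "indep_var borel ((\<lambda>x. (\<Sum>i=1..n. x i) * \<phi> x) \<circ> ?Z) borel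
      ((\<lambda>x. x (Suc n)) \<circ> (\<lambda>\<omega>. \<lambda>i\<in>{Suc n}. V i \<omega>))"
    by (rule indep_var_compose[OF i1])
      (auto intro!: borel_measurable_times borel_measurable_sum \<phi>(1) measurable_component_singleton)
  have e1: "(\<lambda>x. (\<Sum>i=1..n. x i) * \<phi> x) \<circ> ?Z = (\<lambda>\<omega>. ?T \<omega> * \<phi> (?Z \<omega>))" by (auto simp: fun_eq_iff)
  have e2: "(\<lambda>x. x (Suc n)) \<circ> (\<lambda>\<omega>. \<lambda>i\<in>{Suc n}. V i \<omega>) = ?v" by (auto simp: fun_eq_iff)
  have "expectation (\<lambda>\<omega>. ?T \<omega> * \<phi> (?Z \<omega>) * ?v \<omega>) = expectation (\<lambda>\<omega>. ?T \<omega> * \<phi> (?Z \<omega>)) * expectation ?v"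
    using indep_var_lebesgue_integral[OF i2[unfolded e1 e2] bd[OF T1] v1] by simp
  then have z: "expectation (\<lambda>\<omega>. ?T \<omega> * ?v \<omega> * \<phi> (?Z \<omega>)) = 0" by (simp add: mean mult_ac)
  have "(\<integral>\<omega>. (\<Sum>i=1..Suc n. V i \<omega>)\<^sup>2 * \<phi> (?Z \<omega>) \<partial>M)
      = (\<integral>\<omega>. (?T \<omega>)\<^sup>2 * \<phi> (?Z \<omega>) + 2 * (?T \<omega> * ?v \<omega> * \<phi> (?Z \<omega>)) + (?v \<omega>)\<^sup>2 * \<phi> (?Z \<omega>) \<partial>M)"
    unfolding sqeq by (simp add: algebra_simps)
  also have "\<dots> = expectation (\<lambda>\<omega>. (?T \<omega>)\<^sup>2 * \<phi> (?Z \<omega>)) + expectation (\<lambda>\<omega>. (?v \<omega>)\<^sup>2 * \<phi> (?Z \<omega>))"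
    using bd[OF Tn] bd[OF vT] bd[OF v2] z by simp
  also have "expectation (\<lambda>\<omega>. (?v \<omega>)\<^sup>2 * \<phi> (?Z \<omega>)) \<le> expectation (\<lambda>\<omega>. (?v \<omega>)\<^sup>2)"
    using bd[OF v2] v2 \<phi>(2) by (intro integral_mono) (auto intro!: mult_right_le_one_le)
  finally show "(\<integral>\<omega>. (\<Sum>i=1..Suc n. V i \<omega>)\<^sup>2 * \<phi> (?Z \<omega>) \<partial>M)
      \<le> (\<integral>\<omega>. (?T \<omega>)\<^sup>2 * \<phi> (?Z \<omega>) \<partial>M) + expectation (\<lambda>\<omega>. (?v \<omega>)\<^sup>2)"
    by (simp only: add_left_mono)
qed

text \<open>
  The Hajek--Renyi inequality. The induction on \<open>n\<close> carries the sharper bound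
  \<open>e P(A\<^sub>n) + c\<^sub>n E[T\<^sub>n\<^sup>2; A\<^sub>n\<^sup>c] \<le> \<Sum>i\<le>n. c\<^sub>i E[V\<^sub>i\<^sup>2]\<close>, where \<open>T\<^sub>n\<close> is the partial sum and \<open>A\<^sub>n\<close> the event that
  the level has been crossed by time \<open>n\<close>: the second moment on the surviving event pays for
  the next crossing, and it only decreases when the weight \<open>c\<close> does.
\<close>

lemma (in prob_space) hajek_renyi_finite:
  fixes V :: "nat \<Rightarrow> 'a \<Rightarrow> real" and c :: "nat \<Rightarrow> real"
  assumes indep: "indep_vars (\<lambda>_. borel) V {1..}"
    and sq: "\<And>i. 1 \<le> i \<Longrightarrow> integrable M (\<lambda>\<omega>. (V i \<omega>)\<^sup>2)"
    and mean: "\<And>i. 1 \<le> i \<Longrightarrow> expectation (V i) = 0"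
    and c: "\<And>i. 1 \<le> i \<Longrightarrow> 0 \<le> c i" "\<And>i. 1 \<le> i \<Longrightarrow> c (Suc i) \<le> c i"
    and e: "0 \<le> e"
  shows "e * prob {\<omega>\<in>space M. \<exists>k\<in>{1..n}. e \<le> c k * (\<Sum>i=1..k. V i \<omega>)\<^sup>2}
      \<le> (\<Sum>i=1..n. c i * expectation (\<lambda>\<omega>. (V i \<omega>)\<^sup>2))"
proof -
  let ?T = "\<lambda>n \<omega>. \<Sum>i=1..n. V i \<omega>"
  define A where "A n = {\<omega>\<in>space M. \<exists>k\<in>{1..n}. e \<le> c k * (?T k \<omega>)\<^sup>2}" for n
  define \<phi> :: "nat \<Rightarrow> (nat \<Rightarrow> real) \<Rightarrow> real" where
    "\<phi> n x = (if \<exists>k\<in>{1..n}. e \<le> c k * (\<Sum>i=1..k. x i)\<^sup>2 then 0 else 1)" for n x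
  let ?Z = "\<lambda>n \<omega>. \<lambda>i\<in>{1..n}. V i \<omega>"
  have rv: "V i \<in> borel_measurable M" if "1 \<le> i" for i
    using indep that by (auto simp: indep_vars_def)
  have T[measurable]: "?T n \<in> borel_measurable M" for n by (auto intro!: borel_measurable_sum rv)
  have [measurable]: "A n \<in> events" for n unfolding A_def by measurable
  have \<phi>m: "\<phi> n \<in> borel_measurable (PiM {1..n} (\<lambda>_. borel))" for n
  proof -
    have "(\<lambda>x. \<Sum>i=1..k. x i) \<in> borel_measurable (PiM {1..n} (\<lambda>_. borel :: real measure))"
      if "k \<in> {1..n}" for k
      using that by (intro borel_measurable_sum measurable_component_singleton) auto
    then show ?thesis unfolding \<phi>_def by measurable
  qed
  have \<phi>b: "0 \<le> \<phi> n x \<and> \<phi> n x \<le> 1" for n x by (auto simp: \<phi>_def)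
  have \<phi>Z: "\<phi> n (?Z n \<omega>) = indicator (space M - A n) \<omega>" if "\<omega> \<in> space M" for n \<omega>
    using that by (auto simp: \<phi>_def A_def indicator_def)
  have int: "integrable M (\<lambda>\<omega>. (?T n \<omega>)\<^sup>2)" for n
  proof (induction n)
    case (Suc n)
    show ?case
      by (rule partial_sum_second_moment_step(1)[OF indep sq mean \<phi>m[of n] \<phi>b Suc])
  qed simp
  let ?f = "\<lambda>n. \<integral>\<omega>. (?T n \<omega>)\<^sup>2 * indicator (space M - A n) \<omega> \<partial>M"
  have bound: "e * prob (A n) + c n * ?f n \<le> (\<Sum>i=1..n. c i * expectation (\<lambda>\<omega>. (V i \<omega>)\<^sup>2))" for n
  proof (induction n)
    case 0
    then show ?case by (simp add: A_def)
  next
    case (Suc n)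
    let ?g = "\<integral>\<omega>. (?T (Suc n) \<omega>)\<^sup>2 * indicator (space M - A n) \<omega> \<partial>M"
    have AS: "A n \<subseteq> A (Suc n)" by (force simp: A_def)
    have intg: "integrable M (\<lambda>\<omega>. (?T m \<omega>)\<^sup>2 * indicator B \<omega>)" if "B \<in> events" for m B
      using int[of m] that by (intro integrable_real_mult_indicator)
    have "e * prob (A (Suc n)) + c (Suc n) * ?f (Suc n) \<le> e * prob (A n) + c (Suc n) * ?g"
    proof -
      \<comment> \<open>On the new part of the event the level is crossed for the first time at \<open>Suc n\<close>.\<close>
      have "e * prob (A (Suc n)) - e * prob (A n) = (\<integral>\<omega>. e * indicator (A (Suc n) - A n) \<omega> \<partial>M)"
        using finite_measure_Diff[of "A (Suc n)" "A n"] AS by (simp add: right_diff_distrib)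
      also have "\<dots> \<le> (\<integral>\<omega>. c (Suc n) * ((?T (Suc n) \<omega>)\<^sup>2 * indicator (A (Suc n) - A n) \<omega>) \<partial>M)"
      proof (intro integral_mono)
        show "integrable M (\<lambda>\<omega>. e * indicator (A (Suc n) - A n) \<omega>)"
          by (intro integrable_mult_right) (simp add: less_top[symmetric])
        have D: "A (Suc n) - A n \<in> events" by simp
        show "integrable M (\<lambda>\<omega>. c (Suc n) * ((?T (Suc n) \<omega>)\<^sup>2 * indicator (A (Suc n) - A n) \<omega>))"
          by (rule integrable_mult_right[OF intg[OF D, of "Suc n"]])
        fix \<omega> assume "\<omega> \<in> space M"
        have "e \<le> c (Suc n) * (?T (Suc n) \<omega>)\<^sup>2" if "\<omega> \<in> A (Suc n) - A n"
          using that by (auto simp: A_def le_Suc_eq)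
        then show "e * indicator (A (Suc n) - A n) \<omega>
            \<le> c (Suc n) * ((?T (Suc n) \<omega>)\<^sup>2 * indicator (A (Suc n) - A n) \<omega>)"
          by (auto simp: indicator_def)
      qed
      also have "\<dots> = c (Suc n) * (?g - ?f (Suc n))"
      proof -
        have "?g - ?f (Suc n) = (\<integral>\<omega>. (?T (Suc n) \<omega>)\<^sup>2 * indicator (space M - A n) \<omega>
            - (?T (Suc n) \<omega>)\<^sup>2 * indicator (space M - A (Suc n)) \<omega> \<partial>M)"
          by (intro Bochner_Integration.integral_diff[symmetric] intg) auto
        also have "\<dots> = (\<integral>\<omega>. (?T (Suc n) \<omega>)\<^sup>2 * indicator (A (Suc n) - A n) \<omega> \<partial>M)"
          using AS by (intro Bochner_Integration.integral_cong) (auto simp: indicator_def)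
        finally show ?thesis by simp
      qed
      finally show ?thesis by (simp add: algebra_simps)
    qed
    also have "\<dots> \<le> e * prob (A n) + c (Suc n) * (?f n + expectation (\<lambda>\<omega>. (V (Suc n) \<omega>)\<^sup>2))"
    proof -
      have eq: "(\<integral>\<omega>. (?T m \<omega>)\<^sup>2 * \<phi> n (?Z n \<omega>) \<partial>M)
          = (\<integral>\<omega>. (?T m \<omega>)\<^sup>2 * indicator (space M - A n) \<omega> \<partial>M)" for m
        by (intro Bochner_Integration.integral_cong) (simp_all only: \<phi>Z)
      have "?g \<le> ?f n + expectation (\<lambda>\<omega>. (V (Suc n) \<omega>)\<^sup>2)"
        using partial_sum_second_moment_step(2)[OF indep sq mean \<phi>m[of n] \<phi>b int[of n]]
        unfolding eq by simp
      then show ?thesis using c(1)[of "Suc n"] by (intro add_left_mono mult_left_mono) auto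
    qed
    also have "\<dots> \<le> (e * prob (A n) + c n * ?f n) + c (Suc n) * expectation (\<lambda>\<omega>. (V (Suc n) \<omega>)\<^sup>2)"
      \<comment> \<open>Monotonicity of \<open>c\<close> starts at index 1; at \<open>n = 0\<close> the partial sum is 0 anyway.\<close>
    proof (cases "n = 0")
      case False
      then have "c (Suc n) * ?f n \<le> c n * ?f n"
        using c(2)[of n] by (intro mult_right_mono integral_nonneg_AE) auto
      then show ?thesis by (simp add: algebra_simps)
    qed (simp add: algebra_simps)
    also have "\<dots> \<le> (\<Sum>i=1..Suc n. c i * expectation (\<lambda>\<omega>. (V i \<omega>)\<^sup>2))"
      using Suc by simp
    finally show ?case .
  qed
  have "0 \<le> c n * ?f n"
    by (cases "n = 0") (auto intro!: mult_nonneg_nonneg c integral_nonneg_AE)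
  with bound[of n] have "e * prob (A n) \<le> (\<Sum>i=1..n. c i * expectation (\<lambda>\<omega>. (V i \<omega>)\<^sup>2))"
    by linarith
  then show ?thesis unfolding A_def .
qed

lemma (in prob_space) prob_Ex_le:
  assumes "\<And>k. 1 \<le> k \<Longrightarrow> Measurable.pred M (P k)"
    and "\<And>n::nat. prob {\<omega>\<in>space M. \<exists>k\<in>{1..n}. P k \<omega>} \<le> S"
  shows "prob {\<omega>\<in>space M. \<exists>k\<ge>1. P k \<omega>} \<le> S"
proof -
  let ?A = "\<lambda>n::nat. {\<omega>\<in>space M. \<exists>k\<in>{1..n}. P k \<omega>}"
  have "(\<lambda>n. prob (?A n)) \<longlonglongrightarrow> prob (\<Union>n. ?A n)"
  proof (rule finite_Lim_measure_incseq)
    show "range ?A \<subseteq> events" using assms(1)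
      by (intro image_subsetI sets.sets_Collect_finite_Ex) (auto simp: pred_def)
    show "incseq ?A" by (force simp: incseq_def)
  qed
  moreover have "(\<Union>n. ?A n) = {\<omega>\<in>space M. \<exists>k\<ge>1. P k \<omega>}"
    by (intro set_eqI) (simp only: UN_iff mem_Collect_eq Bex_def atLeastAtMost_iff UNIV_I, blast)
  ultimately show ?thesis
    using LIMSEQ_le_const2[of "\<lambda>n. prob (?A n)" _ S] assms(2) by simp
qed

lemma (in prob_space) hajek_renyi:
  fixes V :: "nat \<Rightarrow> 'a \<Rightarrow> real" and c :: "nat \<Rightarrow> real"
  assumes indep: "indep_vars (\<lambda>_. borel) V {1..}"
    and sq: "\<And>i. 1 \<le> i \<Longrightarrow> integrable M (\<lambda>\<omega>. (V i \<omega>)\<^sup>2)"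
    and mean: "\<And>i. 1 \<le> i \<Longrightarrow> expectation (V i) = 0"
    and c: "\<And>i. 1 \<le> i \<Longrightarrow> 0 \<le> c i" "\<And>i. 1 \<le> i \<Longrightarrow> c (Suc i) \<le> c i"
    and e: "0 < e"
    and S: "\<And>n. (\<Sum>i=1..n. c i * expectation (\<lambda>\<omega>. (V i \<omega>)\<^sup>2)) \<le> S"
  shows "prob {\<omega>\<in>space M. \<exists>k\<ge>1. e \<le> c k * (\<Sum>i=1..k. V i \<omega>)\<^sup>2} \<le> S / e"
proof (rule prob_Ex_le)
  have rv: "V i \<in> borel_measurable M" if "1 \<le> i" for i
    using indep that by (auto simp: indep_vars_def)
  have [measurable]: "(\<lambda>\<omega>. \<Sum>i=1..n. V i \<omega>) \<in> borel_measurable M" for n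
    by (auto intro!: borel_measurable_sum rv)
  show "Measurable.pred M (\<lambda>\<omega>. e \<le> c k * (\<Sum>i=1..k. V i \<omega>)\<^sup>2)" for k
    by measurable
  show "prob {\<omega>\<in>space M. \<exists>k\<in>{1..n}. e \<le> c k * (\<Sum>i=1..k. V i \<omega>)\<^sup>2} \<le> S / e" for n
    using hajek_renyi_finite[where V=V and c=c and e=e and n=n, OF indep sq mean c] e S[of n]
    by (simp add: pos_le_divide_eq mult.commute)
qed

section \<open>Sums of powers\<close>

lemma sum_powr_le:
  assumes p: "1 \<le> p"
  shows "(\<Sum>i=1..k. real i powr (1 / p - 1)) \<le> p * real k powr (1 / p)"
proof (induction k)
  case (Suc k)
  have "real (Suc k) powr (1 / p - 1) \<le> p * (real (Suc k) powr (1 / p) - real k powr (1 / p))"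
  proof (cases "k = 0")
    case False
    have "\<exists>x>real k. x < real (Suc k) \<and> real (Suc k) powr (1 / p) - real k powr (1 / p)
        = (real (Suc k) - real k) * ((1 / p) * x powr (1 / p - 1))"
      using False by (intro MVT2) (auto intro!: derivative_eq_intros)
    then obtain x where x: "real k < x" "x < real (Suc k)"
      "real (Suc k) powr (1 / p) - real k powr (1 / p) = (1 / p) * x powr (1 / p - 1)" by auto
    have "real (Suc k) powr (1 / p - 1) \<le> x powr (1 / p - 1)"
      using x False p by (intro powr_mono2') auto
    then show ?thesis unfolding x(3) using p by simp
  qed (use p in simp)
  then show ?case using Suc by (simp add: algebra_simps)
qed simp

text \<open>
  By the mean value theorem the difference on the right is \<open>(s - 1) x powr (- s)\<close> for some \<open>x\<close> below \<open>2 i\<close>;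
  this is where the constant \<open>2 powr s / (s - 1)\<close> comes from.
\<close>

lemma powr_minus_le_telescope:
  assumes s: "1 < s" and i: "1 \<le> (i::nat)"
  shows "real i powr (- s) \<le> 2 powr s / (s - 1) * (real i powr (1 - s) - real (Suc i) powr (1 - s))"
proof -
  have "\<exists>x>real i. x < real (Suc i) \<and> real (Suc i) powr (1 - s) - real i powr (1 - s)
      = (real (Suc i) - real i) * ((1 - s) * x powr (1 - s - 1))"
    using i by (intro MVT2) (auto intro!: derivative_eq_intros)
  then obtain x where x: "real i < x" "x < real (Suc i)"
    "real (Suc i) powr (1 - s) - real i powr (1 - s) = (1 - s) * x powr (- s)" by auto
  have "(2 * real i) powr (- s) \<le> x powr (- s)"
    using x i s by (intro powr_mono2') auto
  also have "(2 * real i) powr (- s) = real i powr (- s) / 2 powr s"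
    by (simp add: powr_mult powr_minus field_simps)
  finally have "real i powr (- s) \<le> 2 powr s * x powr (- s)"
    by (simp add: field_simps)
  also have "\<dots> = 2 powr s / (s - 1) * (- ((1 - s) * x powr (- s)))"
    using s by (simp add: field_simps)
  also have "- ((1 - s) * x powr (- s)) = real i powr (1 - s) - real (Suc i) powr (1 - s)"
    using x(3) by linarith
  finally show ?thesis .
qed

text \<open>
  The cut-off is a real number, because it will be the \<open>p\<close>-th power of a random variable.
  The induction keeps the telescoped remainder; before the cut-off is reached, the remainder is
  evaluated at \<open>y\<close> itself.
\<close>

lemma sum_powr_tail_le:
  assumes s: "1 < s" and y: "0 < y"
  shows "(\<Sum>i=1..n. real i powr (- s) * of_bool (y \<le> real i)) \<le> 2 powr s / (s - 1) * y powr (1 - s)"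
proof -
  define K where "K = 2 powr s / (s - 1)"
  have K: "0 \<le> K" using s by (simp add: K_def)
  have "(\<Sum>i=1..n. real i powr (- s) * of_bool (y \<le> real i))
      \<le> K * y powr (1 - s) - K * max y (real (Suc n)) powr (1 - s)" for n
  proof (induction n)
    case 0
    have "max y 1 powr (1 - s) \<le> y powr (1 - s)" using s y by (intro powr_mono2') auto
    then have "K * max y 1 powr (1 - s) \<le> K * y powr (1 - s)" by (rule mult_left_mono[OF _ K])
    then show ?case by simp
  next
    case (Suc n)
    show ?case
    proof (cases "y \<le> real (Suc n)")
      case True
      then have "max y (real (Suc n)) = real (Suc n)" "max y (real (Suc (Suc n))) = real (Suc (Suc n))"
        by auto
      moreover have "real (Suc n) powr (- s)
          \<le> K * real (Suc n) powr (1 - s) - K * real (Suc (Suc n)) powr (1 - s)"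
        using powr_minus_le_telescope[OF s, of "Suc n"] by (simp only: K_def right_diff_distrib)
      moreover have "(\<Sum>i=1..Suc n. real i powr (- s) * of_bool (y \<le> real i))
          = (\<Sum>i=1..n. real i powr (- s) * of_bool (y \<le> real i)) + real (Suc n) powr (- s)"
        using True by simp
      ultimately show ?thesis using Suc by linarith
    next
      case False
      have "max y (real (Suc (Suc n))) powr (1 - s) \<le> max y (real (Suc n)) powr (1 - s)"
        using s y by (intro powr_mono2') auto
      then have "K * max y (real (Suc (Suc n))) powr (1 - s) \<le> K * max y (real (Suc n)) powr (1 - s)"
        by (rule mult_left_mono[OF _ K])
      moreover have "(\<Sum>i=1..Suc n. real i powr (- s) * of_bool (y \<le> real i))
          = (\<Sum>i=1..n. real i powr (- s) * of_bool (y \<le> real i))"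
        using False by simp
      ultimately show ?thesis using Suc by linarith
    qed
  qed
  also have "K * y powr (1 - s) - K * max y (real (Suc n)) powr (1 - s) \<le> K * y powr (1 - s)"
    using K by simp
  finally show ?thesis unfolding K_def .
qed

lemma sum_of_bool_less_le:
  assumes "0 \<le> y"
  shows "(\<Sum>i=1..n. of_bool (real i < y)) \<le> (y::real)"
proof -
  have "(\<Sum>i=1..n. of_bool (real i < y)) = real (card ({1..n} \<inter> {i. real i < y}))"
    by simp
  also have "\<dots> \<le> real (card {1..nat \<lfloor>y\<rfloor>})"
    by (intro of_nat_mono card_mono) (auto simp: le_nat_floor)
  also have "\<dots> \<le> y" using assms by simp
  finally show ?thesis .
qed

section \<open>A Marcinkiewicz--Zygmund strong law with explicit failure probability\<close>

lemma (in prob_space) identically_distributed_integral: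
  fixes f :: "real \<Rightarrow> real"
  assumes "X \<in> borel_measurable M" "Y \<in> borel_measurable M" "distr M borel X = distr M borel Y"
    and f: "f \<in> borel_measurable borel"
  shows "expectation (\<lambda>\<omega>. f (X \<omega>)) = expectation (\<lambda>\<omega>. f (Y \<omega>))"
  using integral_distr[OF assms(1) f] integral_distr[OF assms(2) f] assms(3) by simp

lemma (in prob_space) integrable_of_powr_integrable:
  fixes X :: "'a \<Rightarrow> real"
  assumes p: "1 \<le> p" and X: "X \<in> borel_measurable M" and int: "integrable M (\<lambda>\<omega>. \<bar>X \<omega>\<bar> powr p)"
  shows "integrable M X"
proof (rule Bochner_Integration.integrable_bound)
  show "integrable M (\<lambda>\<omega>. 1 + \<bar>X \<omega>\<bar> powr p)" using int by simp
  have "\<bar>x\<bar> \<le> 1 + \<bar>x\<bar> powr p" for x :: real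
  proof (cases "\<bar>x\<bar> \<le> 1")
    case False
    then show ?thesis using powr_mono[OF p, of "\<bar>x\<bar>"] by simp
  qed (simp add: add_increasing2)
  then show "AE \<omega> in M. norm (X \<omega>) \<le> norm (1 + \<bar>X \<omega>\<bar> powr p)"
    by (auto simp: abs_of_nonneg add_nonneg_nonneg)
qed (fact X)

text \<open>
  A weak-type bound over all times: if the \<open>p\<close>-th moment is at most \<open>\<eta>\<close>, then the failure probability is
  of order \<open>\<eta>\<close>. The \<open>i\<close>-th variable is truncated at \<open>i powr (1 / p)\<close>, and three errors arise. The
  truncation is ever active with probability at most \<open>\<Sum>i. P(\<bar>U\<bar>\<^sup>p > i) \<le> \<eta>\<close>. It shifts the
  mean of the \<open>i\<close>-th variable by at most \<open>i powr (1 / p - 1) * \<eta>\<close>, up to time \<open>k\<close> in total by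
  \<open>p * \<eta> * k powr (1 / p)\<close>, and this is at most half of the allowed deviation since \<open>2 * p * \<eta> \<le> \<epsilon>\<close>. The truncated and centred variables have
  weighted variances that sum up to a multiple of \<open>\<eta>\<close>, so that the Hajek--Renyi inequality
  applies to the other half.
\<close>

lemma (in prob_space) marcinkiewicz_zygmund_maximal:
  fixes U :: "nat \<Rightarrow> 'a \<Rightarrow> real"
  assumes p: "1 \<le> p" "p < 2"
    and indep: "indep_vars (\<lambda>_. borel) U {1..}"
    and id: "\<And>i. 1 \<le> i \<Longrightarrow> distr M borel (U i) = distr M borel (U 1)"
    and int: "integrable M (\<lambda>\<omega>. \<bar>U 1 \<omega>\<bar> powr p)"
    and \<eta>: "expectation (\<lambda>\<omega>. \<bar>U 1 \<omega>\<bar> powr p) \<le> \<eta>"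
    and \<epsilon>: "0 < \<epsilon>" "2 * p * \<eta> \<le> \<epsilon>"
  shows "prob {\<omega>\<in>space M. \<exists>k\<ge>1. \<epsilon> * real k powr (1 / p) \<le> \<bar>\<Sum>i=1..k. U i \<omega> - expectation (U 1)\<bar>}
      \<le> \<eta> + 2 powr (2 / p) / (2 / p - 1) * \<eta> / (\<epsilon> / 2)\<^sup>2"
proof -
  define s where "s = 2 / p"
  have s: "1 < s" using p by (simp add: s_def)
  define K where "K = 2 powr s / (s - 1)"
  have K: "0 \<le> K" using s by (simp add: K_def)
  define g :: "nat \<Rightarrow> real \<Rightarrow> real" where "g i u = (if \<bar>u\<bar> powr p \<le> real i then u else 0)" for i u
  have gm[measurable]: "g i \<in> borel_measurable borel" for i unfolding g_def by measurable
  have rv[measurable (raw)]: "U i \<in> borel_measurable M" if "1 \<le> i" for i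
    using indep that by (auto simp: indep_vars_def)
  have U1[measurable]: "U 1 \<in> borel_measurable M" by (simp add: rv)
  have int1: "integrable M (U 1)" by (rule integrable_of_powr_integrable[OF p(1) U1 int])
  have E0: "0 \<le> expectation (\<lambda>\<omega>. \<bar>U 1 \<omega>\<bar> powr p)" by simp
  have \<eta>0: "0 \<le> \<eta>" using E0 \<eta> by linarith
  have gb: "\<bar>g i u\<bar> \<le> real i powr (1 / p)" for i u
  proof (cases "\<bar>u\<bar> powr p \<le> real i")
    case True
    have "\<bar>u\<bar> = (\<bar>u\<bar> powr p) powr (1 / p)" using p by (simp add: powr_powr)
    also have "\<dots> \<le> real i powr (1 / p)" using True p by (intro powr_mono2) auto
    finally show ?thesis using True by (simp add: g_def)
  qed (simp add: g_def)
  have gi: "integrable M (\<lambda>\<omega>. g i (U j \<omega>))" if "1 \<le> j" for i j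
    using gb[of i] that by (intro integrable_const_bound[where B="real i powr (1 / p)"]) auto
  have g2i: "integrable M (\<lambda>\<omega>. (g i (U j \<omega>))\<^sup>2)" if "1 \<le> j" for i j
  proof (rule integrable_const_bound[where B="(real i powr (1 / p))\<^sup>2"])
    show "AE \<omega> in M. norm ((g i (U j \<omega>))\<^sup>2) \<le> (real i powr (1 / p))\<^sup>2"
      using gb[of i] by (auto simp: abs_le_square_iff[symmetric])
  qed (use that in measurable)
  define \<mu> where "\<mu> i = expectation (\<lambda>\<omega>. g i (U 1 \<omega>))" for i
  have \<mu>: "expectation (\<lambda>\<omega>. g i (U i \<omega>)) = \<mu> i" if "1 \<le> i" for i
    unfolding \<mu>_def by (rule identically_distributed_integral[OF rv[OF that] U1 id[OF that] gm])
  define V where "V i \<omega> = g i (U i \<omega>) - \<mu> i" for i \<omega>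
  have Vindep: "indep_vars (\<lambda>_. borel) V {1..}"
    unfolding V_def
    by (rule indep_vars_compose2[OF indep, where Y="\<lambda>i u. g i u - \<mu> i"]) measurable
  have V2: "integrable M (\<lambda>\<omega>. (V i \<omega>)\<^sup>2)" if "1 \<le> i" for i
    unfolding V_def power2_diff using gi[OF that, of i] g2i[OF that, of i]
    by (intro Bochner_Integration.integrable_add Bochner_Integration.integrable_diff) (auto simp: mult_ac)
  have V0: "expectation (V i) = 0" if "1 \<le> i" for i
    unfolding V_def using gi[OF that, of i] \<mu>[OF that] by (simp add: prob_space)
  have Vvar: "expectation (\<lambda>\<omega>. (V i \<omega>)\<^sup>2) \<le> expectation (\<lambda>\<omega>. (g i (U 1 \<omega>))\<^sup>2)" if "1 \<le> i" for i
  proof -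
    have "expectation (\<lambda>\<omega>. (V i \<omega>)\<^sup>2) = expectation (\<lambda>\<omega>. (g i (U i \<omega>))\<^sup>2 + (\<mu> i)\<^sup>2 - 2 * \<mu> i * g i (U i \<omega>))"
      unfolding V_def power2_diff by (simp add: mult_ac)
    also have "\<dots> = expectation (\<lambda>\<omega>. (g i (U i \<omega>))\<^sup>2) - (\<mu> i)\<^sup>2"
      using gi[OF that, of i] g2i[OF that, of i] \<mu>[OF that] by (simp add: prob_space power2_eq_square)
    also have "expectation (\<lambda>\<omega>. (g i (U i \<omega>))\<^sup>2) = expectation (\<lambda>\<omega>. (g i (U 1 \<omega>))\<^sup>2)"
      by (rule identically_distributed_integral[OF rv[OF that] U1 id[OF that]]) measurable
    finally show ?thesis by simp
  qed
  let ?c = "\<lambda>i. real i powr (- s)"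
  have var_sum: "(\<Sum>i=1..n. ?c i * expectation (\<lambda>\<omega>. (V i \<omega>)\<^sup>2)) \<le> K * \<eta>" for n
  proof -
    have "(\<Sum>i=1..n. ?c i * expectation (\<lambda>\<omega>. (V i \<omega>)\<^sup>2))
        \<le> (\<Sum>i=1..n. ?c i * expectation (\<lambda>\<omega>. (g i (U 1 \<omega>))\<^sup>2))"
      by (intro sum_mono mult_left_mono Vvar) auto
    also have "\<dots> = expectation (\<lambda>\<omega>. \<Sum>i=1..n. ?c i * (g i (U 1 \<omega>))\<^sup>2)"
      using g2i[of 1] by (subst Bochner_Integration.integral_sum) auto
    also have "\<dots> \<le> expectation (\<lambda>\<omega>. K * \<bar>U 1 \<omega>\<bar> powr p)"
    proof (intro integral_mono)
      fix \<omega>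
      define u where "u = U 1 \<omega>"
      have "(\<Sum>i=1..n. ?c i * (g i u)\<^sup>2) \<le> K * \<bar>u\<bar> powr p"
      proof (cases "u = 0")
        case False
        have "(\<Sum>i=1..n. ?c i * (g i u)\<^sup>2) = u\<^sup>2 * (\<Sum>i=1..n. ?c i * of_bool (\<bar>u\<bar> powr p \<le> real i))"
          unfolding sum_distrib_left by (intro sum.cong) (auto simp: g_def)
        \<comment> \<open>Truncation leaves the indices \<open>i \<ge> \<bar>u\<bar>\<^sup>p\<close>, whose weights sum to a power of \<open>\<bar>u\<bar>\<close> that
            turns the square into a \<open>p\<close>-th power.\<close>
        also have "\<dots> \<le> u\<^sup>2 * (K * (\<bar>u\<bar> powr p) powr (1 - s))"
          unfolding K_def using False by (intro mult_left_mono sum_powr_tail_le s) auto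
        also have "u\<^sup>2 = \<bar>u\<bar> powr 2" using False by simp
        also have "\<bar>u\<bar> powr 2 * (K * (\<bar>u\<bar> powr p) powr (1 - s)) = K * (\<bar>u\<bar> powr (2 + p * (1 - s)))"
          unfolding powr_powr powr_add by (simp add: mult_ac)
        also have "2 + p * (1 - s) = p" using p by (simp add: s_def field_simps)
        finally show ?thesis .
      qed (simp add: g_def)
      then show "(\<Sum>i=1..n. ?c i * (g i (U 1 \<omega>))\<^sup>2) \<le> K * \<bar>U 1 \<omega>\<bar> powr p" by (simp add: u_def)
    qed (use g2i[of 1] int in auto)
    also have "\<dots> \<le> K * \<eta>" using \<eta> K by (simp add: mult_left_mono)
    finally show ?thesis .
  qed
  have HR: "prob {\<omega>\<in>space M. \<exists>k\<ge>1. (\<epsilon> / 2)\<^sup>2 \<le> ?c k * (\<Sum>i=1..k. V i \<omega>)\<^sup>2} \<le> K * \<eta> / (\<epsilon> / 2)\<^sup>2"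
  proof (rule hajek_renyi[OF Vindep V2 V0 _ _ _ var_sum])
    show "real (Suc i) powr (- s) \<le> real i powr (- s)" if "1 \<le> i" for i
      using that s by (intro powr_mono2') auto
  qed (use \<epsilon> in auto)
  have trunc: "prob {\<omega>\<in>space M. \<exists>i\<ge>1. real i < \<bar>U i \<omega>\<bar> powr p} \<le> \<eta>"
  proof (rule prob_Ex_le)
    show "Measurable.pred M (\<lambda>\<omega>. real i < \<bar>U i \<omega>\<bar> powr p)" if "1 \<le> i" for i
      using rv[OF that] by measurable
    fix n :: nat
    have "{\<omega>\<in>space M. \<exists>k\<in>{1..n}. real k < \<bar>U k \<omega>\<bar> powr p} = (\<Union>k\<in>{1..n}. {\<omega>\<in>space M. real k < \<bar>U k \<omega>\<bar> powr p})"
      by auto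
    then have "prob {\<omega>\<in>space M. \<exists>k\<in>{1..n}. real k < \<bar>U k \<omega>\<bar> powr p}
        \<le> (\<Sum>k=1..n. prob {\<omega>\<in>space M. real k < \<bar>U k \<omega>\<bar> powr p})"
      using rv by (simp only:) (intro finite_measure_subadditive_finite; auto)
    also have "\<dots> = (\<Sum>k=1..n. expectation (\<lambda>\<omega>. of_bool (real k < \<bar>U 1 \<omega>\<bar> powr p)))"
    proof (intro sum.cong refl)
      fix k assume "k \<in> {1..n}"
      then have k: "1 \<le> k" by simp
      have [measurable]: "U k \<in> borel_measurable M" by (rule rv[OF k])
      have "prob {\<omega>\<in>space M. real k < \<bar>U k \<omega>\<bar> powr p}
          = expectation (indicator {\<omega>\<in>space M. real k < \<bar>U k \<omega>\<bar> powr p})" by simp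
      also have "\<dots> = expectation (\<lambda>\<omega>. of_bool (real k < \<bar>U k \<omega>\<bar> powr p))"
        by (intro Bochner_Integration.integral_cong) (auto simp: indicator_def)
      also have "\<dots> = expectation (\<lambda>\<omega>. of_bool (real k < \<bar>U 1 \<omega>\<bar> powr p))"
        by (rule identically_distributed_integral[OF rv[OF k] U1 id[OF k],
            of "\<lambda>u. of_bool (real k < \<bar>u\<bar> powr p)"]) measurable
      finally show "prob {\<omega>\<in>space M. real k < \<bar>U k \<omega>\<bar> powr p} = \<dots>" .
    qed
    also have "\<dots> = expectation (\<lambda>\<omega>. \<Sum>k=1..n. of_bool (real k < \<bar>U 1 \<omega>\<bar> powr p))"
      by (subst Bochner_Integration.integral_sum) (auto intro!: integrable_const_bound[where B=1])
    also have "\<dots> \<le> expectation (\<lambda>\<omega>. \<bar>U 1 \<omega>\<bar> powr p)"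
    proof (intro integral_mono)
      show "integrable M (\<lambda>\<omega>. \<Sum>k=1..n. of_bool (real k < \<bar>U 1 \<omega>\<bar> powr p) :: real)"
        by (intro Bochner_Integration.integrable_sum integrable_const_bound[where B=1]) auto
      show "(\<Sum>k=1..n. of_bool (real k < \<bar>U 1 \<omega>\<bar> powr p)) \<le> \<bar>U 1 \<omega>\<bar> powr p" for \<omega>
        by (rule sum_of_bool_less_le) simp
    qed (fact int)
    also note \<eta>
    finally show "prob {\<omega>\<in>space M. \<exists>k\<in>{1..n}. real k < \<bar>U k \<omega>\<bar> powr p} \<le> \<eta>" .
  qed
  have bias: "\<bar>\<mu> i - expectation (U 1)\<bar> \<le> real i powr (1 / p - 1) * \<eta>" if i: "1 \<le> i" for i
  proof -
    have "\<bar>\<mu> i - expectation (U 1)\<bar> = \<bar>expectation (\<lambda>\<omega>. g i (U 1 \<omega>) - U 1 \<omega>)\<bar>"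
      unfolding \<mu>_def using gi[of 1 i] int1 by simp
    also have "\<dots> \<le> expectation (\<lambda>\<omega>. \<bar>g i (U 1 \<omega>) - U 1 \<omega>\<bar>)"
      by (rule integral_abs_bound)
    also have "\<dots> \<le> expectation (\<lambda>\<omega>. real i powr (1 / p - 1) * \<bar>U 1 \<omega>\<bar> powr p)"
    proof (intro integral_mono)
      fix \<omega>
      define u where "u = U 1 \<omega>"
      have "\<bar>g i u - u\<bar> \<le> real i powr (1 / p - 1) * \<bar>u\<bar> powr p"
      proof (cases "\<bar>u\<bar> powr p \<le> real i")
        case False
        then have u: "u \<noteq> 0" by auto
        have "\<bar>g i u - u\<bar> = \<bar>u\<bar> powr (p * (1 / p - 1) + p)"
          using False p by (simp add: g_def right_diff_distrib)
        also have "\<dots> = (\<bar>u\<bar> powr p) powr (1 / p - 1) * \<bar>u\<bar> powr p"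
          unfolding powr_powr powr_add by simp
        also have "\<dots> \<le> real i powr (1 / p - 1) * \<bar>u\<bar> powr p"
          using False p i by (intro mult_right_mono powr_mono2') auto
        finally show ?thesis .
      qed (simp add: g_def)
      then show "\<bar>g i (U 1 \<omega>) - U 1 \<omega>\<bar> \<le> real i powr (1 / p - 1) * \<bar>U 1 \<omega>\<bar> powr p" by (simp add: u_def)
    qed (use gi[of 1 i] int1 int in auto)
    also have "\<dots> \<le> real i powr (1 / p - 1) * \<eta>" using \<eta> by (simp add: mult_left_mono)
    finally show ?thesis .
  qed
  have "prob {\<omega>\<in>space M. \<exists>k\<ge>1. \<epsilon> * real k powr (1 / p) \<le> \<bar>\<Sum>i=1..k. U i \<omega> - expectation (U 1)\<bar>}
      \<le> prob ({\<omega>\<in>space M. \<exists>i\<ge>1. real i < \<bar>U i \<omega>\<bar> powr p}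
          \<union> {\<omega>\<in>space M. \<exists>k\<ge>1. (\<epsilon> / 2)\<^sup>2 \<le> ?c k * (\<Sum>i=1..k. V i \<omega>)\<^sup>2})"
  proof (intro finite_measure_mono subsetI)
    fix \<omega> assume "\<omega> \<in> {\<omega>\<in>space M. \<exists>k\<ge>1. \<epsilon> * real k powr (1 / p) \<le> \<bar>\<Sum>i=1..k. U i \<omega> - expectation (U 1)\<bar>}"
    then obtain k where \<omega>: "\<omega> \<in> space M" and k: "1 \<le> k"
      "\<epsilon> * real k powr (1 / p) \<le> \<bar>\<Sum>i=1..k. U i \<omega> - expectation (U 1)\<bar>" by auto
    show "\<omega> \<in> {\<omega>\<in>space M. \<exists>i\<ge>1. real i < \<bar>U i \<omega>\<bar> powr p}
          \<union> {\<omega>\<in>space M. \<exists>k\<ge>1. (\<epsilon> / 2)\<^sup>2 \<le> ?c k * (\<Sum>i=1..k. V i \<omega>)\<^sup>2}"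
    proof (cases "\<exists>i\<ge>1. real i < \<bar>U i \<omega>\<bar> powr p")
      case False
      then have gU: "g i (U i \<omega>) = U i \<omega>" if "1 \<le> i" for i using that by (auto simp: g_def not_less)
      have "(\<Sum>i=1..k. U i \<omega> - expectation (U 1)) = (\<Sum>i=1..k. V i \<omega> + (\<mu> i - expectation (U 1)))"
        by (intro sum.cong) (auto simp: V_def gU)
      then have split: "(\<Sum>i=1..k. U i \<omega> - expectation (U 1)) = (\<Sum>i=1..k. V i \<omega>) + (\<Sum>i=1..k. \<mu> i - expectation (U 1))"
        by (simp only: sum.distrib)
      have "\<bar>\<Sum>i=1..k. \<mu> i - expectation (U 1)\<bar> \<le> (\<Sum>i=1..k. \<bar>\<mu> i - expectation (U 1)\<bar>)" by (rule sum_abs)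
      also have "\<dots> \<le> (\<Sum>i=1..k. real i powr (1 / p - 1) * \<eta>)"
        by (intro sum_mono bias) auto
      also have "\<dots> = (\<Sum>i=1..k. real i powr (1 / p - 1)) * \<eta>" by (simp only: sum_distrib_right)
      also have "\<dots> \<le> p * real k powr (1 / p) * \<eta>"
        by (intro mult_right_mono sum_powr_le p \<eta>0)
      also have "\<dots> = p * \<eta> * real k powr (1 / p)" by simp
      also have "\<dots> \<le> \<epsilon> / 2 * real k powr (1 / p)"
        using \<epsilon>(2) by (intro mult_right_mono) auto
      finally have "\<epsilon> / 2 * real k powr (1 / p) \<le> \<bar>\<Sum>i=1..k. V i \<omega>\<bar>"
        using k(2) split by linarith
      then have "(\<epsilon> / 2 * real k powr (1 / p))\<^sup>2 \<le> (\<Sum>i=1..k. V i \<omega>)\<^sup>2"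
        using \<epsilon>(1) by (intro abs_le_square_iff[THEN iffD1]) (simp add: abs_mult)
      then have "?c k * (\<epsilon> / 2 * real k powr (1 / p))\<^sup>2 \<le> ?c k * (\<Sum>i=1..k. V i \<omega>)\<^sup>2"
        by (intro mult_left_mono) auto
      moreover have "?c k * (\<epsilon> / 2 * real k powr (1 / p))\<^sup>2 = (\<epsilon> / 2)\<^sup>2 * (?c k * (real k powr (1 / p))\<^sup>2)"
        unfolding power_mult_distrib by (simp only: mult_ac)
      moreover have "?c k * (real k powr (1 / p))\<^sup>2 = 1"
        using k(1) by (simp add: power2_eq_square powr_add[symmetric] s_def)
      ultimately have "(\<epsilon> / 2)\<^sup>2 \<le> ?c k * (\<Sum>i=1..k. V i \<omega>)\<^sup>2" by (simp only: mult_1_right)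
      then show ?thesis using \<omega> k(1) by blast
    qed (use \<omega> in auto)
  qed (use rv in \<open>auto simp: V_def\<close>)
  also have "\<dots> \<le> \<eta> + K * \<eta> / (\<epsilon> / 2)\<^sup>2"
  proof (rule order_trans[OF measure_Un_le add_mono[OF trunc HR]])
  qed (use rv in \<open>auto simp: V_def\<close>)
  finally show ?thesis by (simp add: K_def s_def)
qed

text \<open>
  The Hajek--Renyi inequality also covers the times from \<open>m\<close> on: the weights are taken constant up
  to \<open>m\<close> and equal to \<open>i powr (- 2 / p)\<close> afterwards. Both portions of the weighted variance are of order
  \<open>m powr (1 - 2 / p)\<close>, which tends to 0 because \<open>p < 2\<close>.
\<close>

lemma (in prob_space) bounded_partial_sums_tail:
  fixes Y :: "nat \<Rightarrow> 'a \<Rightarrow> real"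
  assumes p: "1 \<le> p" "p < 2"
    and indep: "indep_vars (\<lambda>_. borel) Y {1..}"
    and mean: "\<And>i. 1 \<le> i \<Longrightarrow> expectation (Y i) = \<mu>"
    and bound: "\<And>i \<omega>. \<bar>Y i \<omega>\<bar> \<le> b"
    and m: "1 \<le> (m::nat)" and \<epsilon>: "0 < \<epsilon>"
  shows "prob {\<omega>\<in>space M. \<exists>k\<ge>m. \<epsilon> * real k powr (1 / p) \<le> \<bar>\<Sum>i=1..k. Y i \<omega> - \<mu>\<bar>}
      \<le> b\<^sup>2 * (1 + 2 powr (2 / p) / (2 / p - 1)) * real m powr (1 - 2 / p) / \<epsilon>\<^sup>2"
proof -
  define s where "s = 2 / p"
  have s: "1 < s" using p by (simp add: s_def)
  define K where "K = 2 powr s / (s - 1)"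
  have rv: "Y i \<in> borel_measurable M" if "1 \<le> i" for i
    using indep that by (auto simp: indep_vars_def)
  have Yi: "integrable M (Y i)" if "1 \<le> i" for i
    using that bound by (intro integrable_const_bound[where B=b]) (auto simp: rv)
  have Y2i: "integrable M (\<lambda>\<omega>. (Y i \<omega>)\<^sup>2)" if "1 \<le> i" for i
  proof (rule integrable_const_bound[where B="b\<^sup>2"])
    show "AE \<omega> in M. norm ((Y i \<omega>)\<^sup>2) \<le> b\<^sup>2"
      using bound[of i] by (auto intro!: power2_le_iff_abs_le[THEN iffD2] intro: order_trans[OF abs_ge_zero])
  qed (use rv[OF that] in measurable)
  define V where "V i \<omega> = Y i \<omega> - \<mu>" for i \<omega>
  have Vindep: "indep_vars (\<lambda>_. borel) V {1..}"
    unfolding V_def by (rule indep_vars_compose2[OF indep, where Y="\<lambda>i u. u - \<mu>"]) measurable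
  have V2: "integrable M (\<lambda>\<omega>. (V i \<omega>)\<^sup>2)" if "1 \<le> i" for i
    unfolding V_def power2_diff using Yi[OF that] Y2i[OF that]
    by (intro Bochner_Integration.integrable_add Bochner_Integration.integrable_diff) (auto simp: mult_ac)
  have V0: "expectation (V i) = 0" if "1 \<le> i" for i
    unfolding V_def using Yi[OF that] mean[OF that] by (simp add: prob_space)
  have Vvar: "expectation (\<lambda>\<omega>. (V i \<omega>)\<^sup>2) \<le> b\<^sup>2" if "1 \<le> i" for i
  proof -
    have "expectation (\<lambda>\<omega>. (V i \<omega>)\<^sup>2) = expectation (\<lambda>\<omega>. (Y i \<omega>)\<^sup>2 + \<mu>\<^sup>2 - 2 * \<mu> * Y i \<omega>)"
      unfolding V_def power2_diff by (simp add: mult_ac)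
    also have "\<dots> = expectation (\<lambda>\<omega>. (Y i \<omega>)\<^sup>2) - \<mu>\<^sup>2"
      using Yi[OF that] Y2i[OF that] mean[OF that] by (simp add: prob_space power2_eq_square)
    also have "\<dots> \<le> expectation (\<lambda>\<omega>. (Y i \<omega>)\<^sup>2)" by simp
    also have "\<dots> \<le> expectation (\<lambda>_. b\<^sup>2)"
      using bound[of i] Y2i[OF that]
      by (intro integral_mono) (auto intro!: power2_le_iff_abs_le[THEN iffD2] intro: order_trans[OF abs_ge_zero])
    finally show ?thesis by (simp add: prob_space)
  qed
  let ?c = "\<lambda>i. real (max i m) powr (- s)"
  have c_sum: "(\<Sum>i=1..n. ?c i) \<le> (1 + K) * real m powr (1 - s)" for n
  proof -
    have m0: "0 < real m" using m by simp
    have "(\<Sum>i=1..n. ?c i)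
        \<le> (\<Sum>i=1..n. real m powr (- s) * of_bool (real i < real m) + real i powr (- s) * of_bool (real m \<le> real i))"
      by (intro sum_mono) (auto simp: max_def)
    also have "\<dots> = real m powr (- s) * (\<Sum>i=1..n. of_bool (real i < real m))
        + (\<Sum>i=1..n. real i powr (- s) * of_bool (real m \<le> real i))"
      unfolding sum.distrib sum_distrib_left ..
    also have "\<dots> \<le> real m powr (- s) * real m + K * real m powr (1 - s)"
      unfolding K_def by (intro add_mono mult_left_mono sum_powr_tail_le sum_of_bool_less_le s m0) auto
    also have "real m powr (- s) * real m = real m powr (1 - s)"
      using m0 by (simp add: powr_diff powr_minus field_simps)
    finally show ?thesis by (simp add: algebra_simps)
  qed
  have var_sum: "(\<Sum>i=1..n. ?c i * expectation (\<lambda>\<omega>. (V i \<omega>)\<^sup>2)) \<le> b\<^sup>2 * (1 + K) * real m powr (1 - s)" for n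
  proof -
    have "(\<Sum>i=1..n. ?c i * expectation (\<lambda>\<omega>. (V i \<omega>)\<^sup>2)) \<le> (\<Sum>i=1..n. ?c i * b\<^sup>2)"
      by (intro sum_mono mult_left_mono Vvar) auto
    also have "\<dots> = b\<^sup>2 * (\<Sum>i=1..n. ?c i)" by (simp only: sum_distrib_left mult.commute)
    also have "\<dots> \<le> b\<^sup>2 * ((1 + K) * real m powr (1 - s))" by (intro mult_left_mono c_sum) auto
    finally show ?thesis by (simp only: mult_ac)
  qed
  have HR: "prob {\<omega>\<in>space M. \<exists>k\<ge>1. \<epsilon>\<^sup>2 \<le> ?c k * (\<Sum>i=1..k. V i \<omega>)\<^sup>2}
      \<le> b\<^sup>2 * (1 + K) * real m powr (1 - s) / \<epsilon>\<^sup>2"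
  proof (rule hajek_renyi[OF Vindep V2 V0 _ _ _ var_sum])
    show "real (max (Suc i) m) powr (- s) \<le> real (max i m) powr (- s)" if "1 \<le> i" for i
      using that s by (intro powr_mono2') (auto simp: max_def)
  qed (use \<epsilon> in auto)
  have "prob {\<omega>\<in>space M. \<exists>k\<ge>m. \<epsilon> * real k powr (1 / p) \<le> \<bar>\<Sum>i=1..k. V i \<omega>\<bar>}
      \<le> prob {\<omega>\<in>space M. \<exists>k\<ge>1. \<epsilon>\<^sup>2 \<le> ?c k * (\<Sum>i=1..k. V i \<omega>)\<^sup>2}"
  proof (intro finite_measure_mono subsetI)
    fix \<omega> assume "\<omega> \<in> {\<omega>\<in>space M. \<exists>k\<ge>m. \<epsilon> * real k powr (1 / p) \<le> \<bar>\<Sum>i=1..k. V i \<omega>\<bar>}"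
    then obtain k where \<omega>: "\<omega> \<in> space M" and k: "m \<le> k"
      "\<epsilon> * real k powr (1 / p) \<le> \<bar>\<Sum>i=1..k. V i \<omega>\<bar>" by auto
    have k1: "1 \<le> k" using k m by simp
    have "(\<epsilon> * real k powr (1 / p))\<^sup>2 \<le> (\<Sum>i=1..k. V i \<omega>)\<^sup>2"
      using \<epsilon> k(2) by (intro abs_le_square_iff[THEN iffD1]) (simp add: abs_mult)
    then have "real k powr (- s) * (\<epsilon> * real k powr (1 / p))\<^sup>2 \<le> real k powr (- s) * (\<Sum>i=1..k. V i \<omega>)\<^sup>2"
      by (intro mult_left_mono) auto
    moreover have "real k powr (- s) * (\<epsilon> * real k powr (1 / p))\<^sup>2 = \<epsilon>\<^sup>2 * (real k powr (- s) * (real k powr (1 / p))\<^sup>2)"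
      unfolding power_mult_distrib by (simp only: mult_ac)
    moreover have "real k powr (- s) * (real k powr (1 / p))\<^sup>2 = 1"
      using k1 by (simp add: power2_eq_square powr_add[symmetric] s_def)
    ultimately have "\<epsilon>\<^sup>2 \<le> real k powr (- s) * (\<Sum>i=1..k. V i \<omega>)\<^sup>2" by (simp only: mult_1_right)
    also have "real k = real (max k m)" using k by simp
    finally show "\<omega> \<in> {\<omega>\<in>space M. \<exists>k\<ge>1. \<epsilon>\<^sup>2 \<le> ?c k * (\<Sum>i=1..k. V i \<omega>)\<^sup>2}" using \<omega> k1 by blast
  qed (use rv in \<open>auto simp: V_def\<close>)
  also note HR
  finally show ?thesis by (simp add: K_def s_def V_def)
qed

text \<open>
  Splitting at \<open>\<bar>X\<bar>\<^sup>p = B\<close>: the large part is handled for all times at once, the bounded part from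
  time \<open>m\<close> on. The first two summands of the bound are small with \<open>\<eta>\<close>, which a large \<open>B\<close> permits to
  choose small, whatever \<open>m\<close> is; for fixed \<open>B\<close> the last one vanishes as \<open>m\<close> grows.
\<close>

lemma (in prob_space) marcinkiewicz_zygmund_tail:
  fixes X :: "nat \<Rightarrow> 'a \<Rightarrow> real"
  assumes p: "1 \<le> p" "p < 2"
    and indep: "indep_vars (\<lambda>_. borel) X {1..}"
    and id: "\<And>i. 1 \<le> i \<Longrightarrow> distr M borel (X i) = distr M borel (X 1)"
    and int: "integrable M (\<lambda>\<omega>. \<bar>X 1 \<omega>\<bar> powr p)"
    and B: "0 \<le> B" and \<eta>: "expectation (\<lambda>\<omega>. \<bar>X 1 \<omega>\<bar> powr p * of_bool (B \<le> \<bar>X 1 \<omega>\<bar> powr p)) \<le> \<eta>"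
    and m: "1 \<le> (m::nat)" and \<epsilon>: "0 < \<epsilon>" "2 * p * \<eta> \<le> \<epsilon>"
  shows "prob {\<omega>\<in>space M. \<exists>k\<ge>m. 2 * \<epsilon> * real k powr (1 / p) \<le> \<bar>\<Sum>i=1..k. X i \<omega> - expectation (X 1)\<bar>}
      \<le> \<eta> + 2 powr (2 / p) / (2 / p - 1) * \<eta> / (\<epsilon> / 2)\<^sup>2
        + (B powr (1 / p))\<^sup>2 * (1 + 2 powr (2 / p) / (2 / p - 1)) * real m powr (1 - 2 / p) / \<epsilon>\<^sup>2"
proof -
  define h where "h u = (if B \<le> \<bar>u\<bar> powr p then u else 0)" for u :: real
  have hm[measurable]: "h \<in> borel_measurable borel" unfolding h_def by measurable
  have rv: "X i \<in> borel_measurable M" if "1 \<le> i" for i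
    using indep that by (auto simp: indep_vars_def)
  have X1[measurable]: "X 1 \<in> borel_measurable M" by (simp add: rv)
  have int1: "integrable M (X 1)" by (rule integrable_of_powr_integrable[OF p(1) X1 int])
  let ?U = "\<lambda>i \<omega>. h (X i \<omega>)" and ?Y = "\<lambda>i \<omega>. X i \<omega> - h (X i \<omega>)"
  have hX1: "integrable M (?U 1)"
    by (rule Bochner_Integration.integrable_bound[OF int1]) (auto simp: h_def)
  have Up: "\<bar>?U 1 \<omega>\<bar> powr p = \<bar>X 1 \<omega>\<bar> powr p * of_bool (B \<le> \<bar>X 1 \<omega>\<bar> powr p)" for \<omega>
    by (simp add: h_def)
  have Uid: "distr M borel (?U i) = distr M borel (?U 1)" if "1 \<le> i" for i
    using distr_distr[OF hm rv[OF that]] distr_distr[OF hm X1] id[OF that] by (simp add: comp_def)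
  have Uint: "integrable M (\<lambda>\<omega>. \<bar>?U 1 \<omega>\<bar> powr p)"
    unfolding Up by (rule Bochner_Integration.integrable_bound[OF int]) auto
  have U: "prob {\<omega>\<in>space M. \<exists>k\<ge>1. \<epsilon> * real k powr (1 / p) \<le> \<bar>\<Sum>i=1..k. ?U i \<omega> - expectation (?U 1)\<bar>}
      \<le> \<eta> + 2 powr (2 / p) / (2 / p - 1) * \<eta> / (\<epsilon> / 2)\<^sup>2"
    by (rule marcinkiewicz_zygmund_maximal[where U="?U", OF p _ Uid Uint _ \<epsilon>])
      (use \<eta> in \<open>auto simp: Up intro!: indep_vars_compose2[OF indep]\<close>)
  have Yb: "\<bar>?Y i \<omega>\<bar> \<le> B powr (1 / p)" for i \<omega>
  proof (cases "B \<le> \<bar>X i \<omega>\<bar> powr p")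
    case False
    have "\<bar>X i \<omega>\<bar> = (\<bar>X i \<omega>\<bar> powr p) powr (1 / p)" using p by (simp add: powr_powr)
    also have "\<dots> \<le> B powr (1 / p)" using False p by (intro powr_mono2) auto
    finally show ?thesis using False by (simp add: h_def)
  qed (simp add: h_def)
  have Ymean: "expectation (?Y i) = expectation (X 1) - expectation (?U 1)" if "1 \<le> i" for i
  proof -
    have "expectation (?Y i) = expectation (?Y 1)"
      by (rule identically_distributed_integral[OF rv[OF that] X1 id[OF that], of "\<lambda>u. u - h u"]) measurable
    then show ?thesis using int1 hX1 by simp
  qed
  have Y: "prob {\<omega>\<in>space M. \<exists>k\<ge>m. \<epsilon> * real k powr (1 / p)
        \<le> \<bar>\<Sum>i=1..k. ?Y i \<omega> - (expectation (X 1) - expectation (?U 1))\<bar>}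
      \<le> (B powr (1 / p))\<^sup>2 * (1 + 2 powr (2 / p) / (2 / p - 1)) * real m powr (1 - 2 / p) / \<epsilon>\<^sup>2"
    by (rule bounded_partial_sums_tail[where Y="?Y", OF p _ Ymean Yb m \<epsilon>(1)])
      (auto intro!: indep_vars_compose2[OF indep, where Y="\<lambda>i u. u - h u"])
  have "prob {\<omega>\<in>space M. \<exists>k\<ge>m. 2 * \<epsilon> * real k powr (1 / p) \<le> \<bar>\<Sum>i=1..k. X i \<omega> - expectation (X 1)\<bar>}
     \<le> prob ({\<omega>\<in>space M. \<exists>k\<ge>1. \<epsilon> * real k powr (1 / p) \<le> \<bar>\<Sum>i=1..k. ?U i \<omega> - expectation (?U 1)\<bar>}
        \<union> {\<omega>\<in>space M. \<exists>k\<ge>m. \<epsilon> * real k powr (1 / p)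
            \<le> \<bar>\<Sum>i=1..k. ?Y i \<omega> - (expectation (X 1) - expectation (?U 1))\<bar>})"
  proof (intro finite_measure_mono subsetI)
    fix \<omega> assume "\<omega> \<in> {\<omega>\<in>space M. \<exists>k\<ge>m. 2 * \<epsilon> * real k powr (1 / p) \<le> \<bar>\<Sum>i=1..k. X i \<omega> - expectation (X 1)\<bar>}"
    then obtain k where \<omega>: "\<omega> \<in> space M" and k: "m \<le> k"
      "2 * \<epsilon> * real k powr (1 / p) \<le> \<bar>\<Sum>i=1..k. X i \<omega> - expectation (X 1)\<bar>" by auto
    have k1: "1 \<le> k" using k m by simp
    have split: "(\<Sum>i=1..k. X i \<omega> - expectation (X 1)) = (\<Sum>i=1..k. ?U i \<omega> - expectation (?U 1))
        + (\<Sum>i=1..k. ?Y i \<omega> - (expectation (X 1) - expectation (?U 1)))"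
      unfolding sum.distrib[symmetric] by (intro sum.cong) auto
    have "\<epsilon> * real k powr (1 / p) \<le> \<bar>\<Sum>i=1..k. ?U i \<omega> - expectation (?U 1)\<bar>
        \<or> \<epsilon> * real k powr (1 / p) \<le> \<bar>\<Sum>i=1..k. ?Y i \<omega> - (expectation (X 1) - expectation (?U 1))\<bar>"
      using k(2) unfolding split by linarith
    then show "\<omega> \<in> {\<omega>\<in>space M. \<exists>k\<ge>1. \<epsilon> * real k powr (1 / p) \<le> \<bar>\<Sum>i=1..k. ?U i \<omega> - expectation (?U 1)\<bar>}
        \<union> {\<omega>\<in>space M. \<exists>k\<ge>m. \<epsilon> * real k powr (1 / p)
            \<le> \<bar>\<Sum>i=1..k. ?Y i \<omega> - (expectation (X 1) - expectation (?U 1))\<bar>}"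
      using \<omega> k(1) k1 by blast
  qed (use rv in auto)
  also have "\<dots> \<le> \<eta> + 2 powr (2 / p) / (2 / p - 1) * \<eta> / (\<epsilon> / 2)\<^sup>2
        + (B powr (1 / p))\<^sup>2 * (1 + 2 powr (2 / p) / (2 / p - 1)) * real m powr (1 - 2 / p) / \<epsilon>\<^sup>2"
  proof (rule order_trans[OF measure_Un_le add_mono[OF U Y]])
  qed (use rv in measurable)
  finally show ?thesis .
qed

text \<open>
  The order of the quantifiers is what makes the law uniform: the admissible tail moment \<open>\<eta>\<close> is fixed first,
  uniform integrability then supplies \<open>B\<close>, and the time \<open>m0\<close> is chosen before the measure.
\<close>

lemma marcinkiewicz_zygmund_uniform:
  fixes p \<epsilon> \<delta> :: real
  assumes p: "1 \<le> p" "p < 2" and \<epsilon>: "0 < \<epsilon>" and \<delta>: "0 < \<delta>"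
  shows "\<exists>\<eta>>0. \<forall>B\<ge>0. \<exists>m0\<ge>1. \<forall>(Q :: 'a measure) (X :: nat \<Rightarrow> 'a \<Rightarrow> real). prob_space Q \<longrightarrow> prob_space.indep_vars Q (\<lambda>_. borel) X {1..} \<longrightarrow>
      (\<forall>i\<ge>1. distr Q borel (X i) = distr Q borel (X 1)) \<longrightarrow> integrable Q (\<lambda>\<omega>. \<bar>X 1 \<omega>\<bar> powr p) \<longrightarrow>
      (\<integral>\<omega>. \<bar>X 1 \<omega>\<bar> powr p * of_bool (B \<le> \<bar>X 1 \<omega>\<bar> powr p) \<partial>Q) \<le> \<eta> \<longrightarrow>
      measure Q {\<omega>\<in>space Q. \<exists>k\<ge>m0. \<epsilon> * real k powr (1 / p) \<le> \<bar>\<Sum>i=1..k. X i \<omega> - (\<integral>\<omega>. X 1 \<omega> \<partial>Q)\<bar>} \<le> \<delta>"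
proof -
  define \<epsilon>' where "\<epsilon>' = \<epsilon> / 2"
  define K where "K = 2 powr (2 / p) / (2 / p - 1)"
  have \<epsilon>': "0 < \<epsilon>'" using \<epsilon> by (simp add: \<epsilon>'_def)
  have K: "0 \<le> K" using p by (simp add: K_def)
  define c where "c = 1 + K / (\<epsilon>' / 2)\<^sup>2"
  have c: "0 < c" unfolding c_def using K by (intro add_pos_nonneg) auto
  \<comment> \<open>The first bound is the hypothesis of the maximal inequality, the second makes its failure
      probability \<open>\<eta> * c\<close> at most \<open>\<delta> / 2\<close>.\<close>
  define \<eta> where "\<eta> = min (\<epsilon>' / (2 * p)) (\<delta> / 2 / c)"
  have \<eta>0: "0 < \<eta>" using \<epsilon>' \<delta> c p by (simp add: \<eta>_def)
  have "\<eta> \<le> \<epsilon>' / (2 * p)" by (simp add: \<eta>_def)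
  then have \<eta>p: "2 * p * \<eta> \<le> \<epsilon>'" using p by (simp add: pos_le_divide_eq mult.commute)
  have "\<eta> \<le> \<delta> / 2 / c" by (simp add: \<eta>_def)
  then have "\<eta> * c \<le> \<delta> / 2" using c by (simp add: pos_le_divide_eq)
  then have \<eta>c: "\<eta> + K * \<eta> / (\<epsilon>' / 2)\<^sup>2 \<le> \<delta> / 2"
    by (simp add: c_def distrib_left mult.commute)
  have "\<exists>m0\<ge>1. \<forall>(Q :: 'a measure) (X :: nat \<Rightarrow> 'a \<Rightarrow> real). prob_space Q \<longrightarrow> prob_space.indep_vars Q (\<lambda>_. borel) X {1..} \<longrightarrow>
      (\<forall>i\<ge>1. distr Q borel (X i) = distr Q borel (X 1)) \<longrightarrow> integrable Q (\<lambda>\<omega>. \<bar>X 1 \<omega>\<bar> powr p) \<longrightarrow>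
      (\<integral>\<omega>. \<bar>X 1 \<omega>\<bar> powr p * of_bool (B \<le> \<bar>X 1 \<omega>\<bar> powr p) \<partial>Q) \<le> \<eta> \<longrightarrow>
      measure Q {\<omega>\<in>space Q. \<exists>k\<ge>m0. \<epsilon> * real k powr (1 / p) \<le> \<bar>\<Sum>i=1..k. X i \<omega> - (\<integral>\<omega>. X 1 \<omega> \<partial>Q)\<bar>} \<le> \<delta>"
    if B: "0 \<le> B" for B
  proof -
    define b where "b = (B powr (1 / p))\<^sup>2 * (1 + K)"
    have "(\<lambda>m. real m powr (1 - 2 / p)) \<longlonglongrightarrow> 0"
      using p by (intro tendsto_neg_powr filterlim_real_sequentially) simp
    then have "(\<lambda>m. b * real m powr (1 - 2 / p) / \<epsilon>'\<^sup>2) \<longlonglongrightarrow> b * 0 / \<epsilon>'\<^sup>2"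
      by (intro tendsto_intros) (use \<epsilon>' in auto)
    then have "eventually (\<lambda>m. b * real m powr (1 - 2 / p) / \<epsilon>'\<^sup>2 < \<delta> / 2) sequentially"
      using \<delta> by (intro order_tendstoD(2)) auto
    then obtain N where N: "\<And>m. N \<le> m \<Longrightarrow> b * real m powr (1 - 2 / p) / \<epsilon>'\<^sup>2 < \<delta> / 2"
      unfolding eventually_sequentially by blast
    define m0 where "m0 = max 1 N"
    have m0: "1 \<le> m0" "N \<le> m0" by (auto simp: m0_def)
    show ?thesis
    proof (intro exI[of _ m0] conjI m0(1) allI impI)
      fix Q :: "'a measure" and X :: "nat \<Rightarrow> 'a \<Rightarrow> real"
      assume Q: "prob_space Q" and indep: "prob_space.indep_vars Q (\<lambda>_. borel) X {1..}"
        and id: "\<forall>i\<ge>1. distr Q borel (X i) = distr Q borel (X 1)"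
        and int: "integrable Q (\<lambda>\<omega>. \<bar>X 1 \<omega>\<bar> powr p)"
        and tail: "(\<integral>\<omega>. \<bar>X 1 \<omega>\<bar> powr p * of_bool (B \<le> \<bar>X 1 \<omega>\<bar> powr p) \<partial>Q) \<le> \<eta>"
      have "measure Q {\<omega>\<in>space Q. \<exists>k\<ge>m0. 2 * \<epsilon>' * real k powr (1 / p) \<le> \<bar>\<Sum>i=1..k. X i \<omega> - (\<integral>\<omega>. X 1 \<omega> \<partial>Q)\<bar>}
          \<le> \<eta> + K * \<eta> / (\<epsilon>' / 2)\<^sup>2 + b * real m0 powr (1 - 2 / p) / \<epsilon>'\<^sup>2"
        unfolding K_def b_def
        by (rule prob_space.marcinkiewicz_zygmund_tail[OF Q p indep id[rule_format] int B tail m0(1) \<epsilon>' \<eta>p])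
      also have "\<dots> \<le> \<delta>" using \<eta>c N[OF m0(2)] by linarith
      finally show "measure Q {\<omega>\<in>space Q. \<exists>k\<ge>m0. \<epsilon> * real k powr (1 / p) \<le> \<bar>\<Sum>i=1..k. X i \<omega> - (\<integral>\<omega>. X 1 \<omega> \<partial>Q)\<bar>} \<le> \<delta>"
        by (simp add: \<epsilon>'_def)
    qed
  qed
  with \<eta>0 show ?thesis by blast
qed

section \<open>Functions of the first vectors\<close>

lemma nat_filt_le_vimage_algebra:
  "space (nat_filt M E n) = space M"
  "sets (nat_filt M E n) \<subseteq> sets (vimage_algebra (space M) (\<lambda>\<omega>. \<lambda>i\<in>{1..n}. E i \<omega>) (PiM {1..n} (\<lambda>_. borel)))"
proof -
  let ?Z = "\<lambda>\<omega>. \<lambda>i\<in>{1..n}. E i \<omega>"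
  let ?V = "vimage_algebra (space M) ?Z (PiM {1..n} (\<lambda>_. borel))"
  let ?G = "\<Union>i\<in>{1..n}. {E i -` A \<inter> space M | A. A \<in> sets borel}"
  have G: "?G \<subseteq> Pow (space M)" by auto
  show "space (nat_filt M E n) = space M" by (simp add: nat_filt_def space_measure_of_conv)
  have "?G \<subseteq> sets ?V"
  proof safe
    fix i and A :: "(real ^ 'b) set" assume i: "i \<in> {1..n}" and A: "A \<in> sets borel"
    have "(\<lambda>x. x i) \<in> measurable (PiM {1..n} (\<lambda>_. borel :: (real ^ 'b) measure)) borel"
      by (rule measurable_component_singleton[OF i])
    from measurable_sets[OF this A]
    have "?Z -` ((\<lambda>x. x i) -` A \<inter> space (PiM {1..n} (\<lambda>_. borel))) \<inter> space M \<in> sets ?V"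
      by (rule in_vimage_algebra)
    also have "?Z -` ((\<lambda>x. x i) -` A \<inter> space (PiM {1..n} (\<lambda>_. borel))) \<inter> space M = E i -` A \<inter> space M"
      using i by (auto simp: space_PiM)
    finally show "E i -` A \<inter> space M \<in> sets ?V" .
  qed
  then have "sigma_sets (space ?V) ?G \<subseteq> sets ?V" by (rule sets.sigma_sets_subset)
  then show "sets (nat_filt M E n) \<subseteq> sets ?V"
    using G by (simp add: nat_filt_def sets_measure_of_conv)
qed

text \<open>
  The Doob--Dynkin factorisation for extended nonnegative functions, by induction along
  their approximation by simple functions.
\<close>

lemma vimage_algebra_measurable_factor:
  fixes f :: "'a \<Rightarrow> ennreal"
  assumes Z: "Z \<in> X \<rightarrow> space N" and f: "f \<in> borel_measurable (vimage_algebra X Z N)"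
  shows "\<exists>g\<in>borel_measurable N. \<forall>x\<in>X. f x = g (Z x)"
  using f
proof (induction rule: borel_measurable_induct)
  case (cong f g)
  then show ?case by auto
next
  case (set A)
  then obtain B where "B \<in> sets N" "A = Z -` B \<inter> X"
    using sets_vimage_algebra2[OF Z] by auto
  then show ?case by (intro bexI[of _ "indicator B"]) (auto simp: indicator_def)
next
  case (mult u c)
  from mult.IH obtain g where "g \<in> borel_measurable N" "\<forall>x\<in>X. u x = g (Z x)" by blast
  then show ?case by (intro bexI[of _ "\<lambda>x. c * g x"]) simp_all
next
  case (add u v)
  from add.IH(1) obtain g where "g \<in> borel_measurable N" "\<forall>x\<in>X. u x = g (Z x)" by blast
  moreover from add.IH(2) obtain h where "h \<in> borel_measurable N" "\<forall>x\<in>X. v x = h (Z x)" by blast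
  ultimately show ?case by (intro bexI[of _ "\<lambda>x. h x + g x"]) simp_all
next
  case (seq U)
  have "\<exists>g. g \<in> borel_measurable N \<and> (\<forall>x\<in>X. U i x = g (Z x))" for i
    using seq.IH[of i] by blast
  then obtain g where g: "\<And>i. g i \<in> borel_measurable N" "\<And>i x. x \<in> X \<Longrightarrow> U i x = g i (Z x)"
    using choice[of "\<lambda>i g. g \<in> borel_measurable N \<and> (\<forall>x\<in>X. U i x = g (Z x))"] by blast
  show ?case
  proof (intro bexI[of _ "\<lambda>x. SUP i. g i x"] ballI)
    show "(SUP i. U i) x = (SUP i. g i (Z x))" if "x \<in> X" for x
      using g(2)[OF that] by (simp add: image_comp)
  qed (use g(1) in measurable)
qed

lemma nat_filt_measurable_factor:
  fixes E :: "nat \<Rightarrow> 'w \<Rightarrow> real ^ 'j::finite" and f :: "'w \<Rightarrow> ennreal"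
  assumes "f \<in> borel_measurable (nat_filt M E n)"
  shows "\<exists>g\<in>borel_measurable (PiM {1..n} (\<lambda>_. borel)). \<forall>\<omega>\<in>space M. f \<omega> = g (\<lambda>i\<in>{1..n}. E i \<omega>)"
proof -
  let ?V = "vimage_algebra (space M) (\<lambda>\<omega>. \<lambda>i\<in>{1..n}. E i \<omega>) (PiM {1..n} (\<lambda>_. borel))"
  have sub: "sets (nat_filt M E n) \<subseteq> sets ?V" and sp: "space (nat_filt M E n) = space ?V"
    using nat_filt_le_vimage_algebra[where M=M and E=E and n=n] by simp_all
  have f: "f \<in> borel_measurable ?V"
    using assms sub unfolding measurable_def sp by blast
  have Z: "(\<lambda>\<omega>. \<lambda>i\<in>{1..n}. E i \<omega>) \<in> space M \<rightarrow> space (PiM {1..n} (\<lambda>_. borel))"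
    by (simp add: space_PiM)
  show ?thesis by (rule vimage_algebra_measurable_factor[OF Z f])
qed

lemma subalgebra_nat_filt:
  fixes E :: "nat \<Rightarrow> 'w \<Rightarrow> real ^ 'j::finite"
  assumes E: "\<And>i. 1 \<le> i \<Longrightarrow> E i \<in> borel_measurable M" and P: "sets P = sets M"
  shows "subalgebra P (nat_filt M E n)"
proof -
  let ?G = "\<Union>i\<in>{1..n}. {E i -` A \<inter> space M | A. A \<in> sets borel}"
  have "{E i -` A \<inter> space M | A. A \<in> sets borel} \<subseteq> sets M" if "i \<in> {1..n}" for i
    using measurable_sets[OF E[of i]] that by auto
  then have "?G \<subseteq> sets M" by (rule UN_least)
  then have "sigma_sets (space M) ?G \<subseteq> sets M" by (rule sets.sigma_sets_subset)
  moreover have "?G \<subseteq> Pow (space M)" by blast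
  ultimately have "sets (nat_filt M E n) \<subseteq> sets M"
    unfolding nat_filt_def by (subst sets_measure_of) simp_all
  moreover have "space (nat_filt M E n) = space P"
    unfolding sets_eq_imp_space_eq[OF P] by (rule nat_filt_le_vimage_algebra(1))
  ultimately show ?thesis unfolding subalgebra_def P by simp
qed

text \<open>
  If reweighting \<open>\<nu>\<close> by \<open>w\<close> gives a measure below \<open>\<mu>\<close>, the same holds for finite powers, one coordinate at
  a time by Fubini's theorem.
\<close>

lemma nn_integral_PiM_weighted_le:
  fixes \<mu> \<nu> :: "'b measure" and f :: "('i \<Rightarrow> 'b) \<Rightarrow> ennreal"
  assumes sf: "sigma_finite_measure \<mu>" "sigma_finite_measure \<nu>"
    and sets: "sets \<mu> = sets N" "sets \<nu> = sets N"
    and w: "w \<in> borel_measurable N"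
    and le: "\<And>g. g \<in> borel_measurable N \<Longrightarrow> (\<integral>\<^sup>+ x. g x * w x \<partial>\<nu>) \<le> (\<integral>\<^sup>+ x. g x \<partial>\<mu>)"
    and I: "finite I" and f: "f \<in> borel_measurable (PiM I (\<lambda>_. N))"
  shows "(\<integral>\<^sup>+ x. f x * (\<Prod>i\<in>I. w (x i)) \<partial>PiM I (\<lambda>_. \<nu>)) \<le> (\<integral>\<^sup>+ x. f x \<partial>PiM I (\<lambda>_. \<mu>))"
proof -
  have scaled: "(\<integral>\<^sup>+ y. g y * (w y * c) \<partial>\<nu>) \<le> (\<integral>\<^sup>+ y. g y \<partial>\<mu>) * c" if g: "g \<in> borel_measurable N" for g c
  proof -
    have gw: "(\<lambda>y. g y * w y) \<in> borel_measurable \<nu>"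
      unfolding measurable_cong_sets[OF sets(2) refl] by (rule borel_measurable_times_ennreal[OF g w])
    have "(\<integral>\<^sup>+ y. g y * (w y * c) \<partial>\<nu>) = (\<integral>\<^sup>+ y. g y * w y \<partial>\<nu>) * c"
      unfolding mult.assoc[symmetric] by (rule nn_integral_multc[OF gw])
    also have "\<dots> \<le> (\<integral>\<^sup>+ y. g y \<partial>\<mu>) * c" by (rule mult_right_mono[OF le[OF g] zero_le])
    finally show ?thesis .
  qed
  from I f show ?thesis
  proof (induction I arbitrary: f rule: finite_induct)
    case empty
    then show ?case by (simp add: PiM_empty nn_integral_count_space_finite)
  next
    case (insert i I)
    interpret \<mu>: product_sigma_finite "\<lambda>_. \<mu>" by (rule product_sigma_finite.intro) (rule sf)
    interpret \<nu>: product_sigma_finite "\<lambda>_. \<nu>" by (rule product_sigma_finite.intro) (rule sf)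
    have Pm: "sets (PiM J (\<lambda>_. \<mu>)) = sets (PiM J (\<lambda>_. N))" "sets (PiM J (\<lambda>_. \<nu>)) = sets (PiM J (\<lambda>_. N))" for J :: "'i set"
      by (auto intro!: sets_PiM_cong simp: sets)
    note cong = measurable_cong_sets[OF Pm(1) refl] measurable_cong_sets[OF Pm(2) refl]
      measurable_cong_sets[OF sets(1) refl] measurable_cong_sets[OF sets(2) refl]
    have wm: "(\<lambda>x. \<Prod>j\<in>J. w (x j)) \<in> borel_measurable (PiM J (\<lambda>_. N))" for J :: "'i set"
      by (intro borel_measurable_prod_ennreal measurable_compose[OF measurable_component_singleton[of _ J "\<lambda>_. N"] w])
    have fm: "f \<in> borel_measurable (PiM (insert i I) (\<lambda>_. N))" by fact
    have f\<mu>: "f \<in> borel_measurable (PiM (insert i I) (\<lambda>_. \<mu>))" unfolding cong by (rule fm)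
    have f\<nu>: "(\<lambda>x. f x * (\<Prod>j\<in>insert i I. w (x j))) \<in> borel_measurable (PiM (insert i I) (\<lambda>_. \<nu>))"
      unfolding cong by (intro borel_measurable_times_ennreal fm wm)
    define h where "h x = (\<integral>\<^sup>+ y. f (x(i := y)) \<partial>\<mu>)" for x
    have hm: "h \<in> borel_measurable (PiM I (\<lambda>_. N))"
    proof -
      have "(\<lambda>z. f ((\<lambda>(x, y). x(i := y)) z)) \<in> borel_measurable (PiM I (\<lambda>_. \<mu>) \<Otimes>\<^sub>M \<mu>)"
        by (rule measurable_compose[OF measurable_add_dim[where M="\<lambda>_. \<mu>" and I=I and i=i] f\<mu>])
      from sigma_finite_measure.borel_measurable_nn_integral_fst[OF sf(1) this]
      have "h \<in> borel_measurable (PiM I (\<lambda>_. \<mu>))" by (simp only: h_def[abs_def] prod.case)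
      then show ?thesis unfolding cong .
    qed
    have "(\<integral>\<^sup>+ x. f x * (\<Prod>j\<in>insert i I. w (x j)) \<partial>PiM (insert i I) (\<lambda>_. \<nu>))
        = (\<integral>\<^sup>+ x. \<integral>\<^sup>+ y. f (x(i := y)) * (\<Prod>j\<in>insert i I. w ((x(i := y)) j)) \<partial>\<nu> \<partial>PiM I (\<lambda>_. \<nu>))"
      by (rule \<nu>.product_nn_integral_insert[OF insert(1,2) f\<nu>])
    also have "\<dots> \<le> (\<integral>\<^sup>+ x. h x * (\<Prod>j\<in>I. w (x j)) \<partial>PiM I (\<lambda>_. \<nu>))"
    proof (intro nn_integral_mono)
      fix x assume "x \<in> space (PiM I (\<lambda>_. \<nu>))"
      then have x: "x \<in> space (PiM I (\<lambda>_. N))" using sets_eq_imp_space_eq[OF Pm(2)] by simp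
      have fx: "(\<lambda>y. f (x(i := y))) \<in> borel_measurable N"
        by (rule measurable_compose[OF measurable_component_update[where M="\<lambda>_. N", OF x insert(2)] fm])
      have prod: "(\<Prod>j\<in>insert i I. w ((x(i := y)) j)) = w y * (\<Prod>j\<in>I. w (x j))" for y
      proof -
        have "(\<Prod>j\<in>insert i I. w ((x(i := y)) j)) = w ((x(i := y)) i) * (\<Prod>j\<in>I. w ((x(i := y)) j))"
          by (rule prod.insert[OF insert(1,2)])
        also have "(\<Prod>j\<in>I. w ((x(i := y)) j)) = (\<Prod>j\<in>I. w (x j))"
          using insert(2) by (intro prod.cong) auto
        finally show ?thesis by (simp only: fun_upd_same)
      qed
      show "(\<integral>\<^sup>+ y. f (x(i := y)) * (\<Prod>j\<in>insert i I. w ((x(i := y)) j)) \<partial>\<nu>) \<le> h x * (\<Prod>j\<in>I. w (x j))"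
        unfolding prod h_def by (rule scaled[OF fx])
    qed
    also have "\<dots> \<le> (\<integral>\<^sup>+ x. h x \<partial>PiM I (\<lambda>_. \<mu>))" by (rule insert.IH[OF hm])
    also have "\<dots> = (\<integral>\<^sup>+ x. f x \<partial>PiM (insert i I) (\<lambda>_. \<mu>))"
      unfolding h_def by (rule \<mu>.product_nn_integral_insert[OF insert(1,2) f\<mu>, symmetric])
    finally show ?case .
  qed
qed

text \<open>
  A subprobability density is completed to a probability measure by a point mass at \<open>a\<close>. The mixture is
  realised as an image measure: a Boolean label tells whether a point is kept, with weight \<open>w\<close>,
  or moved to \<open>a\<close>, with the missing mass as its weight.
\<close>

lemma completed_density_distribution:
  fixes \<nu> :: "'b measure" and w :: "'b \<Rightarrow> ennreal"
  assumes "prob_space \<nu>" and w: "w \<in> borel_measurable \<nu>" "(\<integral>\<^sup>+ x. w x \<partial>\<nu>) \<le> 1" and a: "a \<in> space \<nu>"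
  obtains \<mu> where "prob_space \<mu>" "sets \<mu> = sets \<nu>"
    "\<And>g. g \<in> borel_measurable \<nu> \<Longrightarrow>
      (\<integral>\<^sup>+ x. g x \<partial>\<mu>) = (\<integral>\<^sup>+ x. g x * w x \<partial>\<nu>) + g a * (1 - (\<integral>\<^sup>+ x. w x \<partial>\<nu>))"
proof -
  interpret prob_space \<nu> by fact
  let ?C = "count_space (UNIV :: bool set)"
  interpret C: sigma_finite_measure ?C by (rule sigma_finite_measure_count_space_finite) simp
  define c where "c = 1 - (\<integral>\<^sup>+ x. w x \<partial>\<nu>)"
  note w(1)[measurable]
  define d where "d = (\<lambda>(x, b). if b then w x else c)"
  define F where "F = (\<lambda>(x, b). if b then x else a)"
  have [measurable]: "d \<in> borel_measurable (\<nu> \<Otimes>\<^sub>M ?C)" unfolding d_def by measurable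
  have Fm: "F \<in> measurable (\<nu> \<Otimes>\<^sub>M ?C) \<nu>" unfolding F_def using a by measurable
  define \<mu> where "\<mu> = distr (density (\<nu> \<Otimes>\<^sub>M ?C) d) \<nu> F"
  have Fm': "F \<in> measurable (density (\<nu> \<Otimes>\<^sub>M ?C) d) \<nu>" using Fm by simp
  have sets: "sets \<mu> = sets \<nu>" by (simp add: \<mu>_def)
  have int: "(\<integral>\<^sup>+ x. g x \<partial>\<mu>) = (\<integral>\<^sup>+ x. g x * w x \<partial>\<nu>) + g a * c" if g[measurable]: "g \<in> borel_measurable \<nu>" for g
  proof -
    have gF[measurable]: "(\<lambda>y. g (F y)) \<in> borel_measurable (\<nu> \<Otimes>\<^sub>M ?C)"
      by (rule measurable_compose[OF Fm g])
    have "(\<integral>\<^sup>+ x. g x \<partial>\<mu>) = (\<integral>\<^sup>+ y. g (F y) \<partial>density (\<nu> \<Otimes>\<^sub>M ?C) d)"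
      unfolding \<mu>_def using g by (intro nn_integral_distr[OF Fm']) simp
    also have "\<dots> = (\<integral>\<^sup>+ y. d y * g (F y) \<partial>(\<nu> \<Otimes>\<^sub>M ?C))"
      by (rule nn_integral_density) measurable
    also have "\<dots> = (\<integral>\<^sup>+ x. \<integral>\<^sup>+ b. d (x, b) * g (F (x, b)) \<partial>?C \<partial>\<nu>)"
      by (subst C.nn_integral_fst[symmetric]) auto
    also have "\<dots> = (\<integral>\<^sup>+ x. g x * w x + g a * c \<partial>\<nu>)"
      by (intro nn_integral_cong)
        (simp add: nn_integral_count_space_finite UNIV_bool d_def F_def mult.commute add.commute)
    also have "\<dots> = (\<integral>\<^sup>+ x. g x * w x \<partial>\<nu>) + g a * c"
      by (subst nn_integral_add) (auto simp: emeasure_space_1)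
    finally show ?thesis .
  qed
  have "emeasure \<mu> (space \<mu>) = (\<integral>\<^sup>+ x. 1 \<partial>\<mu>)" by simp
  also have "\<dots> = (\<integral>\<^sup>+ x. w x \<partial>\<nu>) + c" by (subst int) auto
  also have "\<dots> = 1" unfolding c_def using w(2) by (simp add: add.commute diff_add_cancel_ennreal)
  finally have "prob_space \<mu>" by (rule prob_spaceI)
  then show ?thesis using that sets int by (simp add: c_def)
qed

section \<open>The numeraire property of the log-optimal portfolio\<close>

text \<open>
  As \<open>\<infinity> - \<infinity> = \<infinity>\<close> in \<^typ>\<open>ereal\<close>, a finite value forces both parts to be finite, and a finite negative
  part excludes the value \<open>log 0\<close>.
\<close>

lemma eexpectation_elog_finite:
  assumes X: "X \<in> borel_measurable Q" and fin: "\<bar>eexpectation Q (\<lambda>\<omega>. elog (X \<omega>))\<bar> \<noteq> \<infinity>"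
  shows "AE \<omega> in Q. 0 < X \<omega>" "integrable Q (\<lambda>\<omega>. ln (X \<omega>))"
    "eexpectation Q (\<lambda>\<omega>. elog (X \<omega>)) = ereal (\<integral>\<omega>. ln (X \<omega>) \<partial>Q)"
proof -
  note X[measurable]
  have elog_m[measurable]: "(\<lambda>\<omega>. elog (X \<omega>)) \<in> borel_measurable Q" unfolding elog_def by measurable
  let ?a = "\<integral>\<^sup>+ \<omega>. e2ennreal (elog (X \<omega>)) \<partial>Q" and ?b = "\<integral>\<^sup>+ \<omega>. e2ennreal (- elog (X \<omega>)) \<partial>Q"
  have ab: "?a \<noteq> \<infinity>" "?b \<noteq> \<infinity>"
    using fin by (auto simp: eexpectation_def) (cases "enn2ereal ?a"; auto)
  show pos: "AE \<omega> in Q. 0 < X \<omega>"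
    using nn_integral_PInf_AE[OF _ ab(2)] by (auto simp: elog_def e2ennreal_infty split: if_splits)
  have a: "?a = (\<integral>\<^sup>+ \<omega>. ennreal (ln (X \<omega>)) \<partial>Q)" and b: "?b = (\<integral>\<^sup>+ \<omega>. ennreal (- ln (X \<omega>)) \<partial>Q)"
    using pos by (auto intro!: nn_integral_cong_AE simp: elog_def)
  show int: "integrable Q (\<lambda>\<omega>. ln (X \<omega>))"
    using ab unfolding a b by (simp add: real_integrable_def)
  have "(\<integral>\<omega>. ln (X \<omega>) \<partial>Q) = enn2real ?a - enn2real ?b"
    unfolding a b by (rule real_lebesgue_integral_def[OF int])
  moreover have "enn2ereal t = ereal (enn2real t)" if "t \<noteq> \<infinity>" for t
    using that by (cases t) (auto simp: enn2ereal_ennreal)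
  from this[OF ab(1)] this[OF ab(2)]
  have "enn2ereal ?a = ereal (enn2real ?a)" "enn2ereal ?b = ereal (enn2real ?b)" .
  ultimately show "eexpectation Q (\<lambda>\<omega>. elog (X \<omega>)) = ereal (\<integral>\<omega>. ln (X \<omega>) \<partial>Q)"
    by (simp add: eexpectation_def)
qed

text \<open>
  For the competitors of an optimal portfolio only an upper bound on the growth rate is known; with an integrable
  negative part it already implies integrability.
\<close>

lemma eexpectation_elog_le:
  assumes X: "X \<in> borel_measurable Q" and pos: "AE \<omega> in Q. 0 < X \<omega>"
    and neg: "(\<integral>\<^sup>+ \<omega>. ennreal (- ln (X \<omega>)) \<partial>Q) < \<infinity>"
    and le: "eexpectation Q (\<lambda>\<omega>. elog (X \<omega>)) \<le> ereal c"
  shows "integrable Q (\<lambda>\<omega>. ln (X \<omega>))" "(\<integral>\<omega>. ln (X \<omega>) \<partial>Q) \<le> c"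
proof -
  have "(\<integral>\<^sup>+ \<omega>. e2ennreal (- elog (X \<omega>)) \<partial>Q) = (\<integral>\<^sup>+ \<omega>. ennreal (- ln (X \<omega>)) \<partial>Q)"
    using pos by (auto intro!: nn_integral_cong_AE simp: elog_def)
  with neg have "(\<integral>\<^sup>+ \<omega>. e2ennreal (- elog (X \<omega>)) \<partial>Q) < \<infinity>" by simp
  then have "enn2ereal (\<integral>\<^sup>+ \<omega>. e2ennreal (- elog (X \<omega>)) \<partial>Q) \<noteq> \<infinity>" by (auto simp: enn2ereal_eq_top_iff)
  moreover have "0 \<le> enn2ereal (\<integral>\<^sup>+ \<omega>. e2ennreal (elog (X \<omega>)) \<partial>Q)"
    "0 \<le> enn2ereal (\<integral>\<^sup>+ \<omega>. e2ennreal (- elog (X \<omega>)) \<partial>Q)" by simp_all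
  ultimately have fin: "\<bar>eexpectation Q (\<lambda>\<omega>. elog (X \<omega>))\<bar> \<noteq> \<infinity>"
    using le unfolding eexpectation_def
    by (cases "enn2ereal (\<integral>\<^sup>+ \<omega>. e2ennreal (elog (X \<omega>)) \<partial>Q)";
        cases "enn2ereal (\<integral>\<^sup>+ \<omega>. e2ennreal (- elog (X \<omega>)) \<partial>Q)") auto
  show "integrable Q (\<lambda>\<omega>. ln (X \<omega>))" by (rule eexpectation_elog_finite(2)[OF X fin])
  show "(\<integral>\<omega>. ln (X \<omega>) \<partial>Q) \<le> c" using le eexpectation_elog_finite(3)[OF X fin] by simp
qed

lemma log_optimal_growth:
  assumes "E 1 \<in> borel_measurable Q" "log_optimal E Q l"
  shows "l \<in> weights" "AE \<omega> in Q. 0 < l \<bullet> E 1 \<omega>" "integrable Q (\<lambda>\<omega>. ln (l \<bullet> E 1 \<omega>))"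
    "growth E Q l = ereal (\<integral>\<omega>. ln (l \<bullet> E 1 \<omega>) \<partial>Q)"
proof -
  have m: "(\<lambda>\<omega>. l \<bullet> E 1 \<omega>) \<in> borel_measurable Q" using assms(1) by measurable
  have fin: "\<bar>eexpectation Q (\<lambda>\<omega>. elog (l \<bullet> E 1 \<omega>))\<bar> \<noteq> \<infinity>"
    using assms(2) by (simp add: log_optimal_def growth_def)
  show "l \<in> weights" using assms(2) by (simp add: log_optimal_def is_arg_max_def)
  show "AE \<omega> in Q. 0 < l \<bullet> E 1 \<omega>" "integrable Q (\<lambda>\<omega>. ln (l \<bullet> E 1 \<omega>))"
    "growth E Q l = ereal (\<integral>\<omega>. ln (l \<bullet> E 1 \<omega>) \<partial>Q)"
    using eexpectation_elog_finite[OF m fin] by (simp_all add: growth_def)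
qed

lemma weights_inner_nonneg: "l \<in> weights \<Longrightarrow> x \<in> evectors z \<Longrightarrow> 0 \<le> l \<bullet> x"
  by (auto simp: weights_def evectors_def inner_vec_def intro!: sum_nonneg)

lemma weights_convex:
  fixes k l :: "real ^ 'j::finite"
  assumes "l \<in> weights" "k \<in> weights" "0 \<le> t" "t \<le> 1"
  shows "(1 - t) *\<^sub>R l + t *\<^sub>R k \<in> weights"
proof -
  have "(1 - t) * l $ j + t * k $ j \<in> {0..1}" for j
    using assms convex_bound_le[of "l $ j" 1 "k $ j" "1 - t" t]
    by (auto simp: weights_def intro!: add_nonneg_nonneg)
  moreover have "(\<Sum>j\<in>UNIV. (1 - t) * l $ j + t * k $ j) = 1"
    using assms(1,2) by (simp add: weights_def sum.distrib sum_distrib_left[symmetric])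
  ultimately show ?thesis by (simp add: weights_def)
qed

lemma axis_weights: "axis j 1 \<in> weights"
  by (auto simp: weights_def axis_def)

text \<open>
  Put \<open>x = l\<^sup>T E\<^sub>1\<close>, \<open>y = k\<^sup>T E\<^sub>1\<close>, and perturb \<open>l\<close> in the direction of \<open>k\<close>, so that the payoff becomes
  \<open>v\<^sub>t = (1 - t) x + t y\<close>. Optimality and \<open>ln u \<ge> 1 - 1 / u\<close> give
  \<open>0 \<ge> E[ln (v\<^sub>t / x)] \<ge> 1 - E[x / v\<^sub>t]\<close>. Since \<open>(1 - t) x / v\<^sub>t + t y / v\<^sub>t = 1\<close>, this says
  \<open>E[y / v\<^sub>t] \<le> 1\<close>, and Fatou's lemma lets \<open>t\<close> tend to 0.
\<close>

lemma log_optimal_numeraire: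
  assumes "prob_space Q" and E: "E 1 \<in> borel_measurable Q" "\<And>\<omega>. \<omega> \<in> space Q \<Longrightarrow> E 1 \<omega> \<in> evectors z"
    and opt: "log_optimal E Q l" and k: "k \<in> weights"
  shows "(\<integral>\<^sup>+ \<omega>. ennreal ((k \<bullet> E 1 \<omega>) / (l \<bullet> E 1 \<omega>)) \<partial>Q) \<le> 1"
proof -
  interpret prob_space Q by fact
  note E(1)[measurable]
  define x y where "x \<omega> = l \<bullet> E 1 \<omega>" and "y \<omega> = k \<bullet> E 1 \<omega>" for \<omega>
  have [measurable]: "x \<in> borel_measurable Q" "y \<in> borel_measurable Q" unfolding x_def y_def by measurable
  note g = log_optimal_growth[OF E(1) opt]
  have pos: "AE \<omega> in Q. 0 < x \<omega> \<and> 0 \<le> y \<omega>"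
    using g(2) by (auto simp: x_def y_def intro: weights_inner_nonneg[OF k E(2)])
  define v where "v t \<omega> = (1 - t) * x \<omega> + t * y \<omega>" for t \<omega>
  have [measurable]: "v t \<in> borel_measurable Q" for t unfolding v_def by measurable
  have step: "(\<integral>\<^sup>+ \<omega>. ennreal (y \<omega> / v t \<omega>) \<partial>Q) \<le> 1" if t: "0 < t" "t < 1" for t
  proof -
    have vpos: "AE \<omega> in Q. 0 < v t \<omega>"
      using pos t by (auto simp: v_def intro!: add_pos_nonneg)
    have inner: "((1 - t) *\<^sub>R l + t *\<^sub>R k) \<bullet> E 1 \<omega> = v t \<omega>" for \<omega>
      by (simp add: v_def x_def y_def inner_add_left)
    have "\<not> growth E Q l < growth E Q ((1 - t) *\<^sub>R l + t *\<^sub>R k)"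
      using opt weights_convex[OF g(1) k, of t] t by (simp add: log_optimal_def is_arg_max_def)
    then have le: "eexpectation Q (\<lambda>\<omega>. elog (v t \<omega>)) \<le> ereal (\<integral>\<omega>. ln (x \<omega>) \<partial>Q)"
      using g(4) by (simp add: growth_def inner x_def not_less)
    have intx: "integrable Q (\<lambda>\<omega>. ln (x \<omega>))" using g(3) by (simp add: x_def)
    have "integrable Q (\<lambda>\<omega>. \<bar>ln (1 - t)\<bar> + \<bar>ln (x \<omega>)\<bar>)" using intx by simp
    then have "(\<integral>\<^sup>+ \<omega>. ennreal (\<bar>ln (1 - t)\<bar> + \<bar>ln (x \<omega>)\<bar>) \<partial>Q)
        = ennreal (\<integral>\<omega>. \<bar>ln (1 - t)\<bar> + \<bar>ln (x \<omega>)\<bar> \<partial>Q)"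
      by (rule nn_integral_eq_integral) simp
    also have "\<dots> < \<infinity>" by simp
    finally have fin: "(\<integral>\<^sup>+ \<omega>. ennreal (\<bar>ln (1 - t)\<bar> + \<bar>ln (x \<omega>)\<bar>) \<partial>Q) < \<infinity>" .
    \<comment> \<open>The perturbed payoff is at least \<open>(1 - t) x\<close>, so its logarithm has an integrable lower bound.\<close>
    have "(\<integral>\<^sup>+ \<omega>. ennreal (- ln (v t \<omega>)) \<partial>Q) \<le> (\<integral>\<^sup>+ \<omega>. ennreal (\<bar>ln (1 - t)\<bar> + \<bar>ln (x \<omega>)\<bar>) \<partial>Q)"
    proof (intro nn_integral_mono_AE)
      show "AE \<omega> in Q. ennreal (- ln (v t \<omega>)) \<le> ennreal (\<bar>ln (1 - t)\<bar> + \<bar>ln (x \<omega>)\<bar>)"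
        using pos
      proof eventually_elim
        case (elim \<omega>)
        have "ln (1 - t) + ln (x \<omega>) = ln ((1 - t) * x \<omega>)" using elim t by (simp add: ln_mult)
        also have "\<dots> \<le> ln (v t \<omega>)"
          using elim t by (intro ln_mono) (auto simp: v_def)
        finally show ?case by (intro ennreal_leI) linarith
      qed
    qed
    then have neg: "(\<integral>\<^sup>+ \<omega>. ennreal (- ln (v t \<omega>)) \<partial>Q) < \<infinity>" using fin by (rule le_less_trans)
    note v = eexpectation_elog_le[OF _ vpos neg le]
    have vx: "AE \<omega> in Q. norm (x \<omega> / v t \<omega>) \<le> 1 / (1 - t)"
      using pos vpos
    proof eventually_elim
      case (elim \<omega>)
      have "(1 - t) * x \<omega> \<le> v t \<omega>" using elim t by (simp add: v_def)
      then have "x \<omega> \<le> v t \<omega> / (1 - t)" using t by (simp add: pos_le_divide_eq mult.commute)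
      then have "x \<omega> / v t \<omega> \<le> 1 / (1 - t)" using elim by (simp add: pos_divide_le_eq)
      then show ?case using elim by (simp add: abs_of_pos)
    qed
    have intxv: "integrable Q (\<lambda>\<omega>. x \<omega> / v t \<omega>)"
      by (rule integrable_const_bound[OF vx]) measurable
    have "1 - (\<integral>\<omega>. x \<omega> / v t \<omega> \<partial>Q) = (\<integral>\<omega>. 1 - x \<omega> / v t \<omega> \<partial>Q)"
      using intxv by (simp add: prob_space)
    also have "\<dots> \<le> (\<integral>\<omega>. ln (v t \<omega>) - ln (x \<omega>) \<partial>Q)"
    proof (rule integral_mono_AE)
      show "AE \<omega> in Q. 1 - x \<omega> / v t \<omega> \<le> ln (v t \<omega>) - ln (x \<omega>)"
        using pos vpos
      proof eventually_elim
        case (elim \<omega>)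
        have "ln (x \<omega> / v t \<omega>) \<le> x \<omega> / v t \<omega> - 1" using elim by (intro ln_le_minus_one) auto
        then show ?case using elim by (simp add: ln_div)
      qed
    qed (use intxv v(1) intx in auto)
    also have "\<dots> \<le> 0" using v intx by simp
    finally have xv: "1 \<le> (\<integral>\<omega>. x \<omega> / v t \<omega> \<partial>Q)" by simp
    have yv: "AE \<omega> in Q. y \<omega> / v t \<omega> = (1 - (1 - t) * (x \<omega> / v t \<omega>)) / t"
      using vpos
    proof eventually_elim
      case (elim \<omega>)
      have "(1 - t) * (x \<omega> / v t \<omega>) + t * (y \<omega> / v t \<omega>) = v t \<omega> / v t \<omega>"
        unfolding v_def add_divide_distrib by simp
      also have "\<dots> = 1" using elim by simp
      finally have "t * (y \<omega> / v t \<omega>) = 1 - (1 - t) * (x \<omega> / v t \<omega>)" by linarith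
      then show ?case using t by (simp add: nonzero_eq_divide_eq mult.commute)
    qed
    have yn: "AE \<omega> in Q. 0 \<le> (1 - (1 - t) * (x \<omega> / v t \<omega>)) / t"
      using yv pos vpos
    proof eventually_elim
      case (elim \<omega>)
      then have "0 \<le> y \<omega> / v t \<omega>" by (intro divide_nonneg_pos) auto
      then show ?case unfolding elim(1) .
    qed
    have "(\<integral>\<^sup>+ \<omega>. ennreal (y \<omega> / v t \<omega>) \<partial>Q) = (\<integral>\<^sup>+ \<omega>. ennreal ((1 - (1 - t) * (x \<omega> / v t \<omega>)) / t) \<partial>Q)"
      using yv by (intro nn_integral_cong_AE) auto
    also have "\<dots> = ennreal (\<integral>\<omega>. (1 - (1 - t) * (x \<omega> / v t \<omega>)) / t \<partial>Q)"
    proof (rule nn_integral_eq_integral[OF _ yn])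
      show "integrable Q (\<lambda>\<omega>. (1 - (1 - t) * (x \<omega> / v t \<omega>)) / t)"
        by (intro integrable_divide_zero Bochner_Integration.integrable_diff integrable_mult_right intxv) auto
    qed
    also have "(\<integral>\<omega>. (1 - (1 - t) * (x \<omega> / v t \<omega>)) / t \<partial>Q) = (1 - (1 - t) * (\<integral>\<omega>. x \<omega> / v t \<omega> \<partial>Q)) / t"
      using Bochner_Integration.integral_diff[OF integrable_const[of 1] integrable_mult_right[OF intxv, of "1 - t"]]
      by (simp only: integral_divide_zero integral_mult_right_zero lebesgue_integral_const prob_space scaleR_one)
    also have "ennreal \<dots> \<le> 1"
    proof -
      define c where "c = (1 - t) * (\<integral>\<omega>. x \<omega> / v t \<omega> \<partial>Q)"
      have "(1 - t) * 1 \<le> c" unfolding c_def using xv t by (intro mult_left_mono) auto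
      then have "(1 - c) / t \<le> 1" using t by (simp add: pos_divide_le_eq)
      then show ?thesis by (simp only: c_def ennreal_le_1)
    qed
    finally show ?thesis .
  qed
  define \<tau> where "\<tau> n = inverse (real (n + 2))" for n
  have \<tau>: "0 < \<tau> n" "\<tau> n < 1" for n by (auto simp: \<tau>_def field_simps)
  have \<tau>0: "\<tau> \<longlonglongrightarrow> 0"
    unfolding \<tau>_def using LIMSEQ_ignore_initial_segment[OF LIMSEQ_inverse_real_of_nat, of 1] by simp
  have "(\<integral>\<^sup>+ \<omega>. ennreal (y \<omega> / x \<omega>) \<partial>Q) = (\<integral>\<^sup>+ \<omega>. liminf (\<lambda>n. ennreal (y \<omega> / v (\<tau> n) \<omega>)) \<partial>Q)"
  proof (intro nn_integral_cong_AE)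
    show "AE \<omega> in Q. ennreal (y \<omega> / x \<omega>) = liminf (\<lambda>n. ennreal (y \<omega> / v (\<tau> n) \<omega>))"
      using pos
    proof eventually_elim
      case (elim \<omega>)
      have "(\<lambda>n. (1 - \<tau> n) * x \<omega> + \<tau> n * y \<omega>) \<longlonglongrightarrow> (1 - 0) * x \<omega> + 0 * y \<omega>"
        by (intro tendsto_intros \<tau>0)
      then have "(\<lambda>n. y \<omega> / v (\<tau> n) \<omega>) \<longlonglongrightarrow> y \<omega> / x \<omega>"
        unfolding v_def using elim by (intro tendsto_divide tendsto_const) auto
      then have "(\<lambda>n. ennreal (y \<omega> / v (\<tau> n) \<omega>)) \<longlonglongrightarrow> ennreal (y \<omega> / x \<omega>)" by (rule tendsto_ennrealI)
      then show ?case by (intro lim_imp_Liminf[symmetric]) auto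
    qed
  qed
  also have "\<dots> \<le> liminf (\<lambda>n. \<integral>\<^sup>+ \<omega>. ennreal (y \<omega> / v (\<tau> n) \<omega>) \<partial>Q)"
    by (rule nn_integral_liminf) measurable
  also have "\<dots> \<le> liminf (\<lambda>n. 1 :: ennreal)"
    by (intro Liminf_mono always_eventually allI step \<tau>)
  also have "\<dots> = 1" by (simp add: Liminf_const)
  finally show ?thesis by (simp add: x_def y_def)
qed

section \<open>Domination of e-processes by the log-optimal wealth\<close>

lemma iid_nn_integral:
  fixes E :: "nat \<Rightarrow> 'w \<Rightarrow> real ^ 'j::finite"
  assumes iid: "iid_dist M E P" and n: "1 \<le> n" and g: "g \<in> borel_measurable (PiM {1..n} (\<lambda>_. borel))"
  shows "(\<integral>\<^sup>+ \<omega>. g (\<lambda>i\<in>{1..n}. E i \<omega>) \<partial>P) = (\<integral>\<^sup>+ x. g x \<partial>PiM {1..n} (\<lambda>_. distr P borel (E 1)))"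
proof -
  interpret prob_space P using iid unfolding iid_dist_def by blast
  let ?Z = "\<lambda>\<omega>. \<lambda>i\<in>{1..n}. E i \<omega>"
  have indep: "indep_vars (\<lambda>_. borel) E {1..}" and id: "\<And>i. 1 \<le> i \<Longrightarrow> distr P borel (E i) = distr P borel (E 1)"
    using iid unfolding iid_dist_def by blast+
  have rv: "E i \<in> borel_measurable P" if "1 \<le> i" for i
    using indep that by (auto simp: indep_vars_def)
  have indep_n: "indep_vars (\<lambda>_. borel) E {1..n}" by (rule indep_vars_subset[OF indep]) auto
  have ne: "{1..n} \<noteq> {}" using n by simp
  have rv_n: "E i \<in> borel_measurable P" if "i \<in> {1..n}" for i using rv that by simp
  have "distr P (PiM {1..n} (\<lambda>_. borel)) ?Z = PiM {1..n} (\<lambda>i. distr P borel (E i))"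
    by (rule indep_vars_iff_distr_eq_PiM'[where I="{1..n}" and X=E and M'="\<lambda>_. borel", OF ne rv_n, THEN iffD1, OF _ indep_n])
  also have "\<dots> = PiM {1..n} (\<lambda>_. distr P borel (E 1))"
    by (rule PiM_cong[OF refl id]) simp
  finally have d: "distr P (PiM {1..n} (\<lambda>_. borel)) ?Z = PiM {1..n} (\<lambda>_. distr P borel (E 1))" .
  have Z: "?Z \<in> measurable P (PiM {1..n} (\<lambda>_. borel))"
    by (intro measurable_restrict rv_n)
  have gd: "g \<in> borel_measurable (distr P (PiM {1..n} (\<lambda>_. borel)) ?Z)"
    unfolding measurable_distr_eq1 by (rule g)
  show ?thesis unfolding d[symmetric] by (rule nn_integral_distr[OF Z gd, symmetric])
qed

lemma test_supermartingale_expectation_le: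
  fixes E :: "nat \<Rightarrow> 'w \<Rightarrow> real ^ 'j::finite"
  assumes E: "\<And>i. 1 \<le> i \<Longrightarrow> E i \<in> borel_measurable M" and P: "prob_space P" "sets P = sets M"
    and X: "test_supermartingale M E P X" and n: "1 \<le> n"
  shows "(\<integral>\<^sup>+ \<omega>. ennreal (X n \<omega>) \<partial>P) \<le> 1"
  using n
proof (induction n rule: dec_induct)
  case base
  then show ?case using X by (simp add: test_supermartingale_def)
next
  case (step n)
  have sub: "subalgebra P (nat_filt M E m)" for m by (rule subalgebra_nat_filt[OF E P(2)])
  interpret prob_space P by (rule P(1))
  interpret sigma_finite_subalgebra P "nat_filt M E n"
    by (rule finite_measure_subalgebra_is_sigma_finite)
      (simp add: finite_measure_subalgebra_def finite_measure_subalgebra_axioms_def sub finite_measure_axioms)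
  have "X (Suc n) \<in> borel_measurable (nat_filt M E (Suc n))"
    using X by (simp add: test_supermartingale_def nonneg_adapted_def)
  from measurable_compose[OF measurable_from_subalg[OF sub this] measurable_ennreal]
  have Xm: "(\<lambda>\<omega>. ennreal (X (Suc n) \<omega>)) \<in> borel_measurable P" .
  have "(\<integral>\<^sup>+ \<omega>. ennreal (X (Suc n) \<omega>) \<partial>P)
      = (\<integral>\<^sup>+ \<omega>. nn_cond_exp P (nat_filt M E n) (\<lambda>\<omega>. ennreal (X (Suc n) \<omega>)) \<omega> \<partial>P)"
    using nn_cond_exp_intg[OF _ Xm, of "\<lambda>_. 1"] by simp
  also have "\<dots> \<le> (\<integral>\<^sup>+ \<omega>. ennreal (X n \<omega>) \<partial>P)"
  proof (rule nn_integral_mono_AE)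
    have "\<forall>m\<ge>2. AE \<omega> in P. nn_cond_exp P (nat_filt M E (m - 1)) (\<lambda>\<omega>. ennreal (X m \<omega>)) \<omega> \<le> ennreal (X (m - 1) \<omega>)"
      using X by (simp add: test_supermartingale_def)
    from this[rule_format, of "Suc n"]
    show "AE \<omega> in P. nn_cond_exp P (nat_filt M E n) (\<lambda>\<omega>. ennreal (X (Suc n) \<omega>)) \<omega> \<le> ennreal (X n \<omega>)"
      using step(1) by simp
  qed
  also note step.IH
  finally show ?case .
qed

lemma e_process_null_expectation_le:
  fixes E :: "nat \<Rightarrow> 'w \<Rightarrow> real ^ 'j::finite"
  assumes E: "\<And>i. 1 \<le> i \<Longrightarrow> E i \<in> borel_measurable M"
    and W: "W \<in> e_processes z M E" and P: "P \<in> null_hyp z M E" and n: "1 \<le> n"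
  shows "(\<integral>\<^sup>+ \<omega>. ennreal (W n \<omega>) \<partial>P) \<le> 1"
proof -
  have P': "prob_space P" "sets P = sets M" using P unfolding null_hyp_def iid_dist_def by blast+
  have "\<forall>P\<in>null_hyp z M E. \<exists>X. test_supermartingale M E P X \<and> (AE \<omega> in P. \<forall>n\<ge>1. W n \<omega> \<le> X n \<omega>)"
    using W unfolding e_processes_def by (elim CollectE conjE)
  from bspec[OF this P] obtain X where
    X: "test_supermartingale M E P X" "AE \<omega> in P. \<forall>n\<ge>1. W n \<omega> \<le> X n \<omega>"
    by (elim exE conjE)
  have "(\<integral>\<^sup>+ \<omega>. ennreal (W n \<omega>) \<partial>P) \<le> (\<integral>\<^sup>+ \<omega>. ennreal (X n \<omega>) \<partial>P)"
  proof (rule nn_integral_mono_AE)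
    show "AE \<omega> in P. ennreal (W n \<omega>) \<le> ennreal (X n \<omega>)"
      using X(2) by eventually_elim (use n in \<open>simp add: ennreal_leI\<close>)
  qed
  also have "\<dots> \<le> 1" by (rule test_supermartingale_expectation_le[OF E P' X(1) n])
  finally show ?thesis .
qed

text \<open>
  The law \<open>\<mu>\<close> in the proof reweights the law of \<open>E\<^sub>1\<close> by \<open>1 / l\<^sup>T x\<close> and is completed by a point
  mass at the distinguished vertex: that vertex lies in the range of the vectors and adds nothing
  to the constrained coordinates. Only the expectation at one fixed time is bounded here; this
  suffices for a union bound over time.
\<close>

lemma e_process_wealth_ratio_le:
  fixes E :: "nat \<Rightarrow> 'w \<Rightarrow> real ^ 'j::finite"
  assumes space: "evidence_space z M E" and Q: "iid_dist M E Q" and opt: "log_optimal E Q l"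
    and W: "W \<in> e_processes z M E" and n: "1 \<le> n"
  shows "(\<integral>\<^sup>+ \<omega>. ennreal (W n \<omega>) * (\<Prod>i=1..n. ennreal (1 / (l \<bullet> E i \<omega>))) \<partial>Q) \<le> 1"
proof -
  have E: "E i \<in> borel_measurable M" "\<And>\<omega>. \<omega> \<in> space M \<Longrightarrow> E i \<omega> \<in> evectors z" if "1 \<le> i" for i
    using space that by (auto simp: evidence_space_def)
  have pQ: "prob_space Q" and sQ: "sets Q = sets M" using Q unfolding iid_dist_def by blast+
  have spQ: "space Q = space M" by (rule sets_eq_imp_space_eq[OF sQ])
  interpret Q: prob_space Q by (rule pQ)
  have EQ: "E i \<in> borel_measurable Q" if "1 \<le> i" for i
    using E(1)[OF that] by (simp add: measurable_cong_sets[OF sQ refl])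
  have E1[measurable]: "E 1 \<in> borel_measurable Q" by (simp add: EQ)
  have ev: "E 1 \<omega> \<in> evectors z" if "\<omega> \<in> space Q" for \<omega> using E(2)[of 1] that by (simp add: spQ)
  define \<nu> where "\<nu> = distr Q borel (E 1)"
  interpret \<nu>: prob_space \<nu> unfolding \<nu>_def by (rule Q.prob_space_distr) simp
  define w where "w x = ennreal (1 / (l \<bullet> x))" for x
  have w[measurable]: "w \<in> borel_measurable borel" unfolding w_def by measurable
  have int\<nu>: "(\<integral>\<^sup>+ x. f x \<partial>\<nu>) = (\<integral>\<^sup>+ \<omega>. f (E 1 \<omega>) \<partial>Q)" if "f \<in> borel_measurable borel" for f
    unfolding \<nu>_def using that by (intro nn_integral_distr E1) simp
  \<comment> \<open>The numeraire property at the vertices bounds the reweighted coordinate means and, at \<open>z\<close>, the mass.\<close>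
  have numeraire: "(\<integral>\<^sup>+ \<omega>. ennreal (E 1 \<omega> $ j) * w (E 1 \<omega>) \<partial>Q) \<le> 1" for j
  proof -
    have "(\<integral>\<^sup>+ \<omega>. ennreal (E 1 \<omega> $ j) * w (E 1 \<omega>) \<partial>Q)
        = (\<integral>\<^sup>+ \<omega>. ennreal ((axis j 1 \<bullet> E 1 \<omega>) / (l \<bullet> E 1 \<omega>)) \<partial>Q)"
    proof (rule nn_integral_cong)
      fix \<omega> assume "\<omega> \<in> space Q"
      then have "0 \<le> E 1 \<omega> $ j" using ev by (simp add: evectors_def)
      then show "ennreal (E 1 \<omega> $ j) * w (E 1 \<omega>) = ennreal ((axis j 1 \<bullet> E 1 \<omega>) / (l \<bullet> E 1 \<omega>))"
        by (simp add: w_def ennreal_mult'[symmetric] inner_axis')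
    qed
    also have "\<dots> \<le> 1" by (rule log_optimal_numeraire[OF pQ E1 ev opt axis_weights])
    finally show ?thesis .
  qed
  have "(\<integral>\<^sup>+ \<omega>. w (E 1 \<omega>) \<partial>Q) = (\<integral>\<^sup>+ \<omega>. ennreal (E 1 \<omega> $ z) * w (E 1 \<omega>) \<partial>Q)"
    using ev by (intro nn_integral_cong) (simp add: evectors_def)
  then have w1: "(\<integral>\<^sup>+ x. w x \<partial>\<nu>) \<le> 1" using numeraire[of z] by (simp add: int\<nu>)
  have w\<nu>: "w \<in> borel_measurable \<nu>" by (simp add: \<nu>_def)
  have a\<nu>: "axis z 1 \<in> space \<nu>" by (simp add: \<nu>_def)
  obtain \<mu> where \<mu>: "prob_space \<mu>" "sets \<mu> = sets \<nu>"
    and int\<mu>: "\<And>g. g \<in> borel_measurable \<nu> \<Longrightarrow>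
      (\<integral>\<^sup>+ x. g x \<partial>\<mu>) = (\<integral>\<^sup>+ x. g x * w x \<partial>\<nu>) + g (axis z 1) * (1 - (\<integral>\<^sup>+ x. w x \<partial>\<nu>))"
  proof (rule completed_density_distribution[OF \<nu>.prob_space_axioms w\<nu> w1 a\<nu>])
    fix \<mu> assume "prob_space \<mu>" "sets \<mu> = sets \<nu>"
      and "\<And>g. g \<in> borel_measurable \<nu> \<Longrightarrow>
        (\<integral>\<^sup>+ x. g x \<partial>\<mu>) = (\<integral>\<^sup>+ x. g x * w x \<partial>\<nu>) + g (axis z 1) * (1 - (\<integral>\<^sup>+ x. w x \<partial>\<nu>))"
    then show thesis by (rule that)
  qed
  have s\<mu>: "sets \<mu> = sets borel" using \<mu>(2) by (simp add: \<nu>_def)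
  have bor: "g \<in> borel_measurable \<nu> \<longleftrightarrow> g \<in> borel_measurable borel" for g :: "real ^ 'j \<Rightarrow> ennreal"
    by (simp add: \<nu>_def)
  have ev_\<mu>: "AE x in \<mu>. x \<in> evectors z"
  proof (rule AE_I[where N="- evectors z"])
    have m: "(\<lambda>x. indicator (- evectors z) x :: ennreal) \<in> borel_measurable borel"
      using evectors_borel[of z] by simp
    have "axis z 1 \<in> evectors z" by (auto simp: evectors_def axis_def)
    moreover have "(\<integral>\<^sup>+ x. indicator (- evectors z) x * w x \<partial>\<nu>) = 0"
    proof -
      have "(\<integral>\<^sup>+ x. indicator (- evectors z) x * w x \<partial>\<nu>)
          = (\<integral>\<^sup>+ \<omega>. indicator (- evectors z) (E 1 \<omega>) * w (E 1 \<omega>) \<partial>Q)"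
        by (rule int\<nu>[OF borel_measurable_times_ennreal[OF m w]])
      also have "\<dots> = (\<integral>\<^sup>+ \<omega>. 0 \<partial>Q)"
        by (rule nn_integral_cong) (simp add: ev)
      finally show ?thesis by simp
    qed
    ultimately have "(\<integral>\<^sup>+ x. indicator (- evectors z) x \<partial>\<mu>) = 0"
      using int\<mu>[of "indicator (- evectors z)"] m by (simp add: bor)
    then show "emeasure \<mu> (- evectors z) = 0"
      using evectors_borel[of z] s\<mu> by (subst (asm) nn_integral_indicator) simp_all
  next
    show "- evectors z \<in> sets \<mu>" using evectors_borel[of z] s\<mu> by simp
  qed blast
  have "\<forall>\<mu>. prob_space \<mu> \<and> sets \<mu> = sets borel \<and> (AE x in \<mu>. x \<in> evectors z) \<longrightarrow>
      (\<exists>P. iid_dist M E P \<and> distr P borel (E 1) = \<mu>)"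
    using space unfolding evidence_space_def by (rule conjunct2)
  from mp[OF spec[OF this, of \<mu>] conjI[OF \<mu>(1) conjI[OF s\<mu> ev_\<mu>]]]
  obtain P where P: "iid_dist M E P" "distr P borel (E 1) = \<mu>" by (elim exE conjE)
  have sP: "sets P = sets M" using P(1) unfolding iid_dist_def by blast
  have E1P: "E 1 \<in> borel_measurable P"
    using E(1)[of 1] by (simp add: measurable_cong_sets[OF sP refl])
  have null: "P \<in> null_hyp z M E"
    unfolding null_hyp_def
  proof (intro CollectI conjI P(1) allI impI)
    fix j assume j: "j \<noteq> z"
    have m: "(\<lambda>x :: real ^ 'j. ennreal (x $ j)) \<in> borel_measurable borel" by measurable
    have "(\<integral>\<^sup>+ \<omega>. ennreal (E 1 \<omega> $ j) \<partial>P) = (\<integral>\<^sup>+ x. ennreal (x $ j) \<partial>\<mu>)"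
      unfolding P(2)[symmetric] using m by (intro nn_integral_distr[symmetric] E1P) simp
    also have "\<dots> = (\<integral>\<^sup>+ x. ennreal (x $ j) * w x \<partial>\<nu>)"
      using int\<mu>[of "\<lambda>x. ennreal (x $ j)"] m j by (simp add: bor axis_def)
    also have "\<dots> = (\<integral>\<^sup>+ \<omega>. ennreal (E 1 \<omega> $ j) * w (E 1 \<omega>) \<partial>Q)" by (rule int\<nu>) measurable
    also note numeraire
    finally show "(\<integral>\<^sup>+ \<omega>. ennreal (E 1 \<omega> $ j) \<partial>P) \<le> 1" .
  qed
  let ?Z = "\<lambda>\<omega>. \<lambda>i\<in>{1..n}. E i \<omega>"
  have Wm: "(\<lambda>\<omega>. ennreal (W n \<omega>)) \<in> borel_measurable (nat_filt M E n)"
    using W n by (auto simp: e_processes_def nonneg_adapted_def)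
  obtain g where g: "g \<in> borel_measurable (PiM {1..n} (\<lambda>_. borel))"
    "\<And>\<omega>. \<omega> \<in> space M \<Longrightarrow> ennreal (W n \<omega>) = g (?Z \<omega>)"
  proof (rule bexE[OF nat_filt_measurable_factor[OF Wm]])
    fix g assume "g \<in> borel_measurable (PiM {1..n} (\<lambda>_. borel))" "\<forall>\<omega>\<in>Sigma_Algebra.space M. ennreal (W n \<omega>) = g (?Z \<omega>)"
    then show thesis by (intro that) simp_all
  qed
  have wm: "(\<lambda>x. \<Prod>i\<in>{1..n}. w (x i)) \<in> borel_measurable (PiM {1..n} (\<lambda>_. borel))"
    by (intro borel_measurable_prod_ennreal measurable_compose[OF measurable_component_singleton[of _ "{1..n}" "\<lambda>_. borel"] w])
  have "(\<integral>\<^sup>+ \<omega>. ennreal (W n \<omega>) * (\<Prod>i=1..n. ennreal (1 / (l \<bullet> E i \<omega>))) \<partial>Q)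
      = (\<integral>\<^sup>+ \<omega>. g (?Z \<omega>) * (\<Prod>i\<in>{1..n}. w (?Z \<omega> i)) \<partial>Q)"
  proof (rule nn_integral_cong)
    fix \<omega> assume "\<omega> \<in> space Q"
    moreover have "(\<Prod>i=1..n. ennreal (1 / (l \<bullet> E i \<omega>))) = (\<Prod>i\<in>{1..n}. w (?Z \<omega> i))"
      by (rule prod.cong) (auto simp: w_def)
    ultimately show "ennreal (W n \<omega>) * (\<Prod>i=1..n. ennreal (1 / (l \<bullet> E i \<omega>)))
        = g (?Z \<omega>) * (\<Prod>i\<in>{1..n}. w (?Z \<omega> i))" by (simp only: g(2) spQ)
  qed
  also have "\<dots> = (\<integral>\<^sup>+ x. g x * (\<Prod>i\<in>{1..n}. w (x i)) \<partial>PiM {1..n} (\<lambda>_. \<nu>))"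
    unfolding \<nu>_def by (rule iid_nn_integral[OF Q n borel_measurable_times_ennreal[OF g(1) wm]])
  also have "\<dots> \<le> (\<integral>\<^sup>+ x. g x \<partial>PiM {1..n} (\<lambda>_. \<mu>))"
  proof (rule nn_integral_PiM_weighted_le[where N=borel])
    show "sigma_finite_measure \<mu>" "sigma_finite_measure \<nu>"
      by (rule prob_space_imp_sigma_finite[OF \<mu>(1)], rule \<nu>.sigma_finite_measure_axioms)
    show "(\<integral>\<^sup>+ x. g x * w x \<partial>\<nu>) \<le> (\<integral>\<^sup>+ x. g x \<partial>\<mu>)" if "g \<in> borel_measurable borel" for g
      using int\<mu>[of g] that by (simp add: bor)
    show "sets \<nu> = sets borel" by (simp add: \<nu>_def)
  qed (fact s\<mu>, fact w, simp, fact g(1))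
  also have "\<dots> = (\<integral>\<^sup>+ \<omega>. g (?Z \<omega>) \<partial>P)"
    unfolding P(2)[symmetric] by (rule iid_nn_integral[OF P(1) n g(1), symmetric])
  also have "\<dots> = (\<integral>\<^sup>+ \<omega>. ennreal (W n \<omega>) \<partial>P)"
    using sets_eq_imp_space_eq[OF sP] by (intro nn_integral_cong) (simp add: g(2))
  also have "\<dots> \<le> 1" by (rule e_process_null_expectation_le[OF E(1) W null n])
  finally show ?thesis .
qed

lemma iid_log_optimal_positive:
  assumes Q: "iid_dist M E Q" and opt: "log_optimal E Q l"
  shows "AE \<omega> in Q. \<forall>i\<ge>1. 0 < l \<bullet> E i \<omega>"
proof -
  interpret prob_space Q using Q unfolding iid_dist_def by blast
  have indep: "indep_vars (\<lambda>_. borel) E {1..}" using Q unfolding iid_dist_def by blast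
  have rv: "E i \<in> borel_measurable Q" if "1 \<le> i" for i
    using indep that by (auto simp: indep_vars_def)
  have "AE \<omega> in Q. 1 \<le> i \<longrightarrow> 0 < l \<bullet> E i \<omega>" for i
  proof (cases "1 \<le> i")
    case True
    have m: "{x \<in> Sigma_Algebra.space borel. 0 < l \<bullet> x} \<in> sets borel" by measurable
    have one: "1 \<le> (1::nat)" by simp
    have "AE x in distr Q borel (E 1). 0 < l \<bullet> x"
      unfolding AE_distr_iff[OF rv[OF one] m] by (rule log_optimal_growth(2)[OF rv[OF one] opt])
    moreover have "distr Q borel (E i) = distr Q borel (E 1)"
      using Q True unfolding iid_dist_def by blast
    ultimately have "AE x in distr Q borel (E i). 0 < l \<bullet> x" by (simp only:)
    then show ?thesis unfolding AE_distr_iff[OF rv[OF True] m] by (auto elim: eventually_mono)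
  qed simp
  then have "AE \<omega> in Q. \<forall>i. 1 \<le> i \<longrightarrow> 0 < l \<bullet> E i \<omega>" by (simp add: AE_all_countable)
  then show ?thesis .
qed

text \<open>
  Markov's inequality for the wealth ratio at each time, summed over the times from \<open>m0\<close> on. The time \<open>m0\<close> is
  determined by \<open>a\<close> and \<open>\<delta>\<close>, hence valid for every alternative.
\<close>

lemma e_process_uniform_tail:
  fixes E :: "nat \<Rightarrow> 'w \<Rightarrow> real ^ 'j::finite"
  assumes space: "evidence_space z M E" and W: "W \<in> e_processes z M E"
    and a: "summable (\<lambda>k. exp (- a k))" and \<delta>: "0 < \<delta>"
  shows "\<exists>m0\<ge>1. \<forall>Q l. iid_dist M E Q \<longrightarrow> log_optimal E Q l \<longrightarrow>
    (\<exists>A\<in>sets Q. emeasure Q A \<le> ennreal \<delta> \<and>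
      (AE \<omega> in Q. \<omega> \<notin> A \<longrightarrow> (\<forall>k\<ge>m0. W k \<omega> \<le> exp (a k) * wealth E l k \<omega>)))"
proof -
  obtain N where N: "\<And>n. N \<le> n \<Longrightarrow> norm (\<Sum>i. exp (- a (i + n))) < \<delta>"
    using suminf_exist_split[OF \<delta> a] by blast
  define m0 where "m0 = max 1 N"
  have "\<exists>A\<in>sets Q. emeasure Q A \<le> ennreal \<delta> \<and>
      (AE \<omega> in Q. \<omega> \<notin> A \<longrightarrow> (\<forall>k\<ge>m0. W k \<omega> \<le> exp (a k) * wealth E l k \<omega>))"
    if Q: "iid_dist M E Q" and opt: "log_optimal E Q l" for Q l
  proof -
    have sQ: "sets Q = sets M" using Q unfolding iid_dist_def by blast
    have EM: "E i \<in> borel_measurable M" if "1 \<le> i" for i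
      using space that by (simp add: evidence_space_def)
    have EQ: "E i \<in> borel_measurable Q" if "1 \<le> i" for i
      using EM[OF that] by (simp add: measurable_cong_sets[OF sQ refl])
    have WQ: "W n \<in> borel_measurable Q" if "1 \<le> n" for n
      using W that measurable_from_subalg[OF subalgebra_nat_filt[of E M Q n, OF EM sQ]]
      by (auto simp: e_processes_def nonneg_adapted_def)
    define u where "u n \<omega> = ennreal (W n \<omega>) * (\<Prod>i=1..n. ennreal (1 / (l \<bullet> E i \<omega>)))" for n \<omega>
    have um: "u n \<in> borel_measurable Q" if "1 \<le> n" for n
      unfolding u_def using WQ[OF that] EQ
      by (intro borel_measurable_times_ennreal borel_measurable_prod_ennreal measurable_compose[OF _ measurable_ennreal]
          borel_measurable_divide borel_measurable_inner borel_measurable_const) auto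
    define B where "B n = {\<omega>\<in>space Q. 1 \<le> ennreal (exp (- a n)) * u n \<omega>}" for n
    have B: "B n \<in> sets Q" if "1 \<le> n" for n
      using um[OF that] unfolding B_def by measurable
    have Bn: "emeasure Q (B n) \<le> ennreal (exp (- a n))" if n: "1 \<le> n" for n
    proof -
      have m: "(\<lambda>\<omega>. u n \<omega> * indicator (space Q) \<omega>) \<in> borel_measurable Q" using um[OF n] by measurable
      have "emeasure Q (B n) \<le> ennreal (exp (- a n)) * (\<integral>\<^sup>+ \<omega>. u n \<omega> * indicator (space Q) \<omega> \<partial>Q)"
        unfolding B_def by (rule nn_integral_Markov_inequality[OF m]) simp
      also have "(\<integral>\<^sup>+ \<omega>. u n \<omega> * indicator (space Q) \<omega> \<partial>Q) = (\<integral>\<^sup>+ \<omega>. u n \<omega> \<partial>Q)"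
        by (intro nn_integral_cong) simp
      also have "ennreal (exp (- a n)) * \<dots> \<le> ennreal (exp (- a n)) * 1"
        unfolding u_def by (intro mult_left_mono e_process_wealth_ratio_le[OF space Q opt W n] zero_le)
      finally show ?thesis by simp
    qed
    define A where "A = (\<Union>i. B (i + m0))"
    have m01: "1 \<le> i + m0" for i by (simp add: m0_def)
    have AQ: "A \<in> sets Q" unfolding A_def by (intro sets.countable_UN) (use B m01 in auto)
    have "emeasure Q A \<le> (\<Sum>i. emeasure Q (B (i + m0)))"
      unfolding A_def by (rule emeasure_subadditive_countably) (use B m01 in auto)
    also have "\<dots> \<le> (\<Sum>i. ennreal (exp (- a (i + m0))))"
      by (intro suminf_le Bn m01) auto
    also have "\<dots> = ennreal (\<Sum>i. exp (- a (i + m0)))"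
      using summable_ignore_initial_segment[OF a, of m0] by (intro suminf_ennreal2) auto
    also have "\<dots> \<le> ennreal \<delta>"
      using N[of m0] by (intro ennreal_leI) (simp add: m0_def)
    finally have A\<delta>: "emeasure Q A \<le> ennreal \<delta>" .
    have "AE \<omega> in Q. \<omega> \<notin> A \<longrightarrow> (\<forall>k\<ge>m0. W k \<omega> \<le> exp (a k) * wealth E l k \<omega>)"
      using iid_log_optimal_positive[OF Q opt] AE_space
    proof eventually_elim
      case (elim \<omega>)
      show ?case
      proof (intro impI allI)
        fix k assume \<omega>: "\<omega> \<notin> A" and k: "m0 \<le> k"
        have k1: "1 \<le> k" using k by (simp add: m0_def)
        have pos: "0 < wealth E l k \<omega>"
          unfolding wealth_def using elim(1) by (intro prod_pos) auto
        have "(\<Prod>i=1..k. ennreal (1 / (l \<bullet> E i \<omega>))) = ennreal (\<Prod>i=1..k. 1 / (l \<bullet> E i \<omega>))"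
          using elim(1) by (intro prod_ennreal) (auto intro: less_imp_le)
        also have "(\<Prod>i=1..k. 1 / (l \<bullet> E i \<omega>)) = 1 / wealth E l k \<omega>"
          unfolding wealth_def by (simp only: prod_dividef prod.neutral_const)
        finally have u: "u k \<omega> = ennreal (W k \<omega>) * ennreal (1 / wealth E l k \<omega>)" by (simp add: u_def)
        have "\<omega> \<notin> B k"
        proof
          assume "\<omega> \<in> B k"
          then have "\<omega> \<in> B (k - m0 + m0)" using k by simp
          then show False using \<omega> unfolding A_def by blast
        qed
        then have lt: "ennreal (exp (- a k)) * u k \<omega> < 1" using elim(2) by (simp add: B_def not_le)
        show "W k \<omega> \<le> exp (a k) * wealth E l k \<omega>"
        proof (cases "0 \<le> W k \<omega>")
          case True
          have "ennreal (exp (- a k) * (W k \<omega> * (1 / wealth E l k \<omega>))) = ennreal (exp (- a k)) * ennreal (W k \<omega> * (1 / wealth E l k \<omega>))"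
            by (rule ennreal_mult') simp
          also have "ennreal (W k \<omega> * (1 / wealth E l k \<omega>)) = ennreal (W k \<omega>) * ennreal (1 / wealth E l k \<omega>)"
            by (rule ennreal_mult'[OF True])
          also note u[symmetric]
          also note lt
          finally have "exp (- a k) * (W k \<omega> * (1 / wealth E l k \<omega>)) < 1" by (simp only: ennreal_less_one_iff)
          then have "exp (- a k) * W k \<omega> < wealth E l k \<omega>" using pos by (simp add: pos_divide_less_eq)
          then have "exp (a k) * (exp (- a k) * W k \<omega>) \<le> exp (a k) * wealth E l k \<omega>"
            by (intro mult_left_mono) auto
          moreover have "exp (a k) * (exp (- a k) * W k \<omega>) = W k \<omega>"
            by (simp only: mult.assoc[symmetric] exp_add[symmetric]) simp
          ultimately show ?thesis by (simp only:)
        next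
          case False
          moreover have "0 \<le> exp (a k) * wealth E l k \<omega>" using pos by simp
          ultimately show ?thesis by linarith
        qed
      qed
    qed
    with AQ A\<delta> show ?thesis by blast
  qed
  moreover have "1 \<le> m0" by (simp add: m0_def)
  ultimately show ?thesis by blast
qed

section \<open>Uniform convergence along the process\<close>

text \<open>
  The exceptional event \<open>A\<close> may be chosen per measure, but \<open>m0\<close> may not. Passing through such an \<open>A\<close>
  also avoids any measurability question for the supremum over time.
\<close>

lemma unif_tail_vanishesI:
  assumes "\<And>\<epsilon> \<delta> :: real. 0 < \<epsilon> \<Longrightarrow> 0 < \<delta> \<Longrightarrow> \<exists>m0. \<forall>Q\<in>QQ. \<exists>A\<in>sets Q. emeasure Q A \<le> ennreal \<delta> \<and>
      (AE \<omega> in Q. \<omega> \<notin> A \<longrightarrow> (\<forall>k\<ge>m0. Y Q k \<omega> \<le> ereal \<epsilon>))"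
  shows "unif_tail_vanishes QQ Y"
  unfolding unif_tail_vanishes_def
proof (intro allI impI order_tendstoI)
  fix \<epsilon> :: real and a :: ennreal assume \<epsilon>: "0 < \<epsilon>" and a: "0 < a"
  let ?f = "\<lambda>m::nat. SUP Q\<in>QQ. emeasure Q {\<omega>\<in>space Q. (SUP k\<in>{m..}. Y Q k \<omega>) \<ge> ereal \<epsilon>}"
  obtain \<delta> :: real where \<delta>: "0 < \<delta>" "ennreal \<delta> < a"
  proof (cases a)
    case (real r)
    with a have "0 < r" by simp
    with real show ?thesis by (intro that[of "r / 2"]) (auto simp: ennreal_less_iff)
  next
    case top
    then show ?thesis by (intro that[of 1]) auto
  qed
  have \<epsilon>2: "0 < \<epsilon> / 2" using \<epsilon> by simp
  from assms[OF \<epsilon>2 \<delta>(1)] obtain m0 where m0: "\<And>Q. Q \<in> QQ \<Longrightarrow> \<exists>A\<in>sets Q. emeasure Q A \<le> ennreal \<delta> \<and>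
      (AE \<omega> in Q. \<omega> \<notin> A \<longrightarrow> (\<forall>k\<ge>m0. Y Q k \<omega> \<le> ereal (\<epsilon> / 2)))" by blast
  have "?f m < a" if m: "m0 \<le> m" for m
  proof (rule le_less_trans[OF _ \<delta>(2)], rule SUP_least)
    fix Q assume "Q \<in> QQ"
    from m0[OF this] obtain A where A: "A \<in> sets Q" "emeasure Q A \<le> ennreal \<delta>"
      "AE \<omega> in Q. \<omega> \<notin> A \<longrightarrow> (\<forall>k\<ge>m0. Y Q k \<omega> \<le> ereal (\<epsilon> / 2))" by blast
    have "emeasure Q {\<omega>\<in>space Q. (SUP k\<in>{m..}. Y Q k \<omega>) \<ge> ereal \<epsilon>} \<le> emeasure Q A"
    proof (rule emeasure_mono_AE[OF _ A(1)])
      show "AE \<omega> in Q. \<omega> \<in> {\<omega>\<in>space Q. (SUP k\<in>{m..}. Y Q k \<omega>) \<ge> ereal \<epsilon>} \<longrightarrow> \<omega> \<in> A"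
        using A(3)
      proof eventually_elim
        case (elim \<omega>)
        show ?case
        proof (rule impI, rule ccontr)
          assume \<omega>: "\<omega> \<in> {\<omega>\<in>space Q. (SUP k\<in>{m..}. Y Q k \<omega>) \<ge> ereal \<epsilon>}" "\<omega> \<notin> A"
          have "(SUP k\<in>{m..}. Y Q k \<omega>) \<le> ereal (\<epsilon> / 2)"
            using elim \<omega>(2) m by (intro SUP_least) auto
          moreover have "ereal \<epsilon> \<le> (SUP k\<in>{m..}. Y Q k \<omega>)" using \<omega>(1) by simp
          ultimately have "ereal \<epsilon> \<le> ereal (\<epsilon> / 2)" by (rule order_trans[rotated])
          then show False using \<epsilon> by simp
        qed
      qed
    qed
    with A(2) show "emeasure Q {\<omega>\<in>space Q. (SUP k\<in>{m..}. Y Q k \<omega>) \<ge> ereal \<epsilon>} \<le> ennreal \<delta>"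
      by (rule order_trans[rotated])
  qed
  then show "eventually (\<lambda>m. ?f m < a) sequentially"
    unfolding eventually_sequentially by blast
qed simp

text \<open>
  The bound on the regret is finite, so \<open>W\<close> cannot vanish where the portfolio has positive wealth;
  from then on it is an inequality between real logarithms.
\<close>

lemma portfolio_regret_wealth:
  fixes E :: "nat \<Rightarrow> 'w \<Rightarrow> real ^ 'j::finite"
  assumes regret: "portfolio_regret_bound M E W r" and n: "1 \<le> n" and \<omega>: "\<omega> \<in> space M"
    and l: "l \<in> weights" and pos: "\<And>i. 1 \<le> i \<Longrightarrow> 0 < l \<bullet> E i \<omega>"
  shows "0 < W n \<omega>" "0 < wealth E l n \<omega>" "ln (wealth E l n \<omega>) \<le> ln (W n \<omega>) + r n"
    "ln (wealth E l n \<omega>) = (\<Sum>i=1..n. ln (l \<bullet> E i \<omega>))"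
proof -
  show "0 < wealth E l n \<omega>" unfolding wealth_def using pos by (intro prod_pos) auto
  show ln: "ln (wealth E l n \<omega>) = (\<Sum>i=1..n. ln (l \<bullet> E i \<omega>))"
    unfolding wealth_def
  proof (rule ln_prod)
    show "l \<bullet> E i \<omega> \<noteq> 0" if "i \<in> {1..n}" for i using pos[of i] that by auto
  qed simp
  let ?S = "SUP l\<in>weights. \<Sum>i=1..n. elog (l \<bullet> E i \<omega>)"
  have "(\<Sum>i=1..n. elog (l \<bullet> E i \<omega>)) = (\<Sum>i=1..n. ereal (ln (l \<bullet> E i \<omega>)))"
  proof (rule sum.cong[OF refl])
    fix i assume "i \<in> {1..n}"
    then have "0 < l \<bullet> E i \<omega>" by (intro pos) simp
    then show "elog (l \<bullet> E i \<omega>) = ereal (ln (l \<bullet> E i \<omega>))" by (simp add: elog_def)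
  qed
  also have "\<dots> = ereal (ln (wealth E l n \<omega>))" unfolding ln by (rule sum_ereal)
  finally have "ereal (ln (wealth E l n \<omega>)) \<le> ?S" using SUP_upper[OF l, of "\<lambda>l. \<Sum>i=1..n. elog (l \<bullet> E i \<omega>)"] by simp
  then have "ereal (ln (wealth E l n \<omega>)) - elog (W n \<omega>) \<le> ?S - elog (W n \<omega>)"
    by (rule ereal_minus_mono) simp
  also have "\<dots> \<le> ereal (r n)"
    using regret n \<omega> unfolding portfolio_regret_bound_def by blast
  finally have *: "ereal (ln (wealth E l n \<omega>)) - elog (W n \<omega>) \<le> ereal (r n)" .
  show W: "0 < W n \<omega>"
  proof (rule ccontr)
    assume "\<not> 0 < W n \<omega>"
    then have "elog (W n \<omega>) = - \<infinity>" by (simp add: elog_def)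
    with * show False by simp
  qed
  show "ln (wealth E l n \<omega>) \<le> ln (W n \<omega>) + r n"
    using * W by (simp add: elog_def)
qed

lemma elog_le: "0 < y \<Longrightarrow> x \<le> y \<Longrightarrow> elog x \<le> ereal (ln y)"
  by (auto simp: elog_def)

lemma summable_exp_minus_powr:
  fixes q c :: real
  assumes "0 < q" "0 < c"
  shows "summable (\<lambda>k. exp (- (real k powr q * c)))"
proof (rule summable_comparison_test_bigo)
  show "summable (\<lambda>k. norm (1 / real k ^ 2))"
    using inverse_power_summable[of 2, where 'a=real] by (simp add: inverse_eq_divide)
  show "(\<lambda>k. exp (- (real k powr q * c))) \<in> O(\<lambda>k. 1 / real k ^ 2)"
    using assms by real_asymp
qed

text \<open>
  Both directions at once: the regret bound gives the lower estimate of \<open>ln W\<close> on every outcome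
  on which the portfolio stays positive, and the e-process property of \<open>W\<close> itself gives the upper one.
\<close>

lemma e_process_log_wealth_close:
  fixes E :: "nat \<Rightarrow> 'w \<Rightarrow> real ^ 'j::finite"
  assumes space: "evidence_space z M E" and W: "W \<in> e_processes z M E"
    and regret: "portfolio_regret_bound M E W r"
    and a: "summable (\<lambda>k. exp (- (a k * \<epsilon>)))" "eventually (\<lambda>k. r k \<le> a k * \<epsilon>) sequentially"
    and \<delta>: "0 < \<delta>"
  shows "\<exists>m0\<ge>1. \<forall>Q l. iid_dist M E Q \<longrightarrow> log_optimal E Q l \<longrightarrow>
    (\<exists>A\<in>sets Q. emeasure Q A \<le> ennreal \<delta> \<and>
      (AE \<omega> in Q. \<omega> \<notin> A \<longrightarrow> (\<forall>k\<ge>m0. 0 < W k \<omega> \<and> 0 < wealth E l k \<omega> \<and>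
        ln (wealth E l k \<omega>) = (\<Sum>i=1..k. ln (l \<bullet> E i \<omega>)) \<and>
        \<bar>ln (W k \<omega>) - ln (wealth E l k \<omega>)\<bar> \<le> a k * \<epsilon>)))"
proof -
  obtain m1 where m1: "1 \<le> m1" and tail: "\<And>Q l. iid_dist M E Q \<Longrightarrow> log_optimal E Q l \<Longrightarrow>
    \<exists>A\<in>sets Q. emeasure Q A \<le> ennreal \<delta> \<and>
      (AE \<omega> in Q. \<omega> \<notin> A \<longrightarrow> (\<forall>k\<ge>m1. W k \<omega> \<le> exp (a k * \<epsilon>) * wealth E l k \<omega>))"
    using e_process_uniform_tail[OF space W a(1) \<delta>] by blast
  obtain N where N: "\<And>k. N \<le> k \<Longrightarrow> r k \<le> a k * \<epsilon>"
    using a(2) unfolding eventually_sequentially by blast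
  define m0 where "m0 = max m1 N"
  have m0: "1 \<le> m0" "m1 \<le> m0" "N \<le> m0" using m1 by (auto simp: m0_def)
  show ?thesis
  proof (intro exI[of _ m0] conjI m0(1) allI impI)
    fix Q l assume Q: "iid_dist M E Q" and opt: "log_optimal E Q l"
    have sQ: "sets Q = sets M" using Q unfolding iid_dist_def by blast
    have E1: "E 1 \<in> borel_measurable Q"
      using space unfolding measurable_cong_sets[OF sQ refl] evidence_space_def by blast
    have l: "l \<in> weights" by (rule log_optimal_growth(1)[OF E1 opt])
    from tail[OF Q opt] obtain A where A: "A \<in> sets Q" "emeasure Q A \<le> ennreal \<delta>"
      "AE \<omega> in Q. \<omega> \<notin> A \<longrightarrow> (\<forall>k\<ge>m1. W k \<omega> \<le> exp (a k * \<epsilon>) * wealth E l k \<omega>)" by blast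
    show "\<exists>A\<in>sets Q. emeasure Q A \<le> ennreal \<delta> \<and>
      (AE \<omega> in Q. \<omega> \<notin> A \<longrightarrow> (\<forall>k\<ge>m0. 0 < W k \<omega> \<and> 0 < wealth E l k \<omega> \<and>
        ln (wealth E l k \<omega>) = (\<Sum>i=1..k. ln (l \<bullet> E i \<omega>)) \<and>
        \<bar>ln (W k \<omega>) - ln (wealth E l k \<omega>)\<bar> \<le> a k * \<epsilon>))"
    proof (intro bexI[OF _ A(1)] conjI A(2))
      show "AE \<omega> in Q. \<omega> \<notin> A \<longrightarrow> (\<forall>k\<ge>m0. 0 < W k \<omega> \<and> 0 < wealth E l k \<omega> \<and>
          ln (wealth E l k \<omega>) = (\<Sum>i=1..k. ln (l \<bullet> E i \<omega>)) \<and>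
          \<bar>ln (W k \<omega>) - ln (wealth E l k \<omega>)\<bar> \<le> a k * \<epsilon>)"
        using A(3) iid_log_optimal_positive[OF Q opt] AE_space
      proof eventually_elim
        case (elim \<omega>)
        show ?case
        proof (intro impI allI)
          fix k assume \<omega>: "\<omega> \<notin> A" and k: "m0 \<le> k"
          have k1: "1 \<le> k" "m1 \<le> k" "N \<le> k" using k m0 by auto
          have \<omega>M: "\<omega> \<in> Sigma_Algebra.space M" using elim(3) sets_eq_imp_space_eq[OF sQ] by simp
          have pos: "0 < l \<bullet> E i \<omega>" if "1 \<le> i" for i using elim(2) that by simp
          note R = portfolio_regret_wealth[where W=W and E=E and l=l and n=k, OF regret k1(1) \<omega>M l pos]
          have "W k \<omega> \<le> exp (a k * \<epsilon>) * wealth E l k \<omega>" using elim(1) \<omega> k1(2) by blast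
          then have "ln (W k \<omega>) \<le> ln (exp (a k * \<epsilon>) * wealth E l k \<omega>)" using R(1) by (intro ln_mono) auto
          also have "\<dots> = a k * \<epsilon> + ln (wealth E l k \<omega>)" using R(2) by (simp add: ln_mult)
          finally have "\<bar>ln (W k \<omega>) - ln (wealth E l k \<omega>)\<bar> \<le> a k * \<epsilon>"
            using R(3) N[OF k1(3)] by linarith
          with R(1,2,4) show "0 < W k \<omega> \<and> 0 < wealth E l k \<omega> \<and>
              ln (wealth E l k \<omega>) = (\<Sum>i=1..k. ln (l \<bullet> E i \<omega>)) \<and>
              \<bar>ln (W k \<omega>) - ln (wealth E l k \<omega>)\<bar> \<le> a k * \<epsilon>" by blast
        qed
      qed
    qed
  qed
qed

text \<open>
  Half of \<open>\<epsilon>\<close> pays for the competitor exceeding the log-optimal wealth, the other half for the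
  regret of \<open>W\<close>, which is eventually below \<open>k * \<epsilon> / 2\<close> as it is sublinear.
\<close>

lemma e_process_log_optimality:
  fixes E :: "nat \<Rightarrow> 'w \<Rightarrow> real ^ 'j::finite"
  assumes space: "evidence_space z M E" and alternatives: "\<forall>Q\<in>QQ. iid_dist M E Q"
    and lam: "\<forall>Q\<in>QQ. log_optimal E Q (lam Q)"
    and regret: "portfolio_regret_bound M E W r" and sublinear: "r \<in> o(\<lambda>n. real n)"
    and W': "W' \<in> e_processes z M E"
  shows "unif_tail_vanishes QQ (\<lambda>Q k \<omega>. ereal (1 / real k) * elog (W' k \<omega> / W k \<omega>))"
proof (rule unif_tail_vanishesI)
  fix \<epsilon> \<delta> :: real assume \<epsilon>: "0 < \<epsilon>" and \<delta>: "0 < \<delta>"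
  define c where "c = \<epsilon> / 2"
  have c: "0 < c" using \<epsilon> by (simp add: c_def)
  have "summable (\<lambda>k. exp (- (real k powr 1 * c)))" by (rule summable_exp_minus_powr) (use c in auto)
  then have s: "summable (\<lambda>k. exp (- (real k * c)))" by simp
  obtain m1 where m1: "1 \<le> m1" and tail: "\<And>Q l. iid_dist M E Q \<Longrightarrow> log_optimal E Q l \<Longrightarrow>
    \<exists>A\<in>sets Q. emeasure Q A \<le> ennreal \<delta> \<and>
      (AE \<omega> in Q. \<omega> \<notin> A \<longrightarrow> (\<forall>k\<ge>m1. W' k \<omega> \<le> exp (real k * c) * wealth E l k \<omega>))"
    using e_process_uniform_tail[OF space W' s \<delta>] by blast
  obtain N where N: "\<And>k. N \<le> k \<Longrightarrow> norm (r k) \<le> c * norm (real k)"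
    using landau_o.smallD[OF sublinear c] unfolding eventually_sequentially by blast
  define m0 where "m0 = max m1 N"
  have m0: "1 \<le> m0" "m1 \<le> m0" "N \<le> m0" using m1 by (auto simp: m0_def)
  show "\<exists>m0. \<forall>Q\<in>QQ. \<exists>A\<in>sets Q. emeasure Q A \<le> ennreal \<delta> \<and>
      (AE \<omega> in Q. \<omega> \<notin> A \<longrightarrow> (\<forall>k\<ge>m0. ereal (1 / real k) * elog (W' k \<omega> / W k \<omega>) \<le> ereal \<epsilon>))"
  proof (intro exI[of _ m0] ballI)
    fix Q assume QQ: "Q \<in> QQ"
    have Q: "iid_dist M E Q" and opt: "log_optimal E Q (lam Q)" using alternatives lam QQ by auto
    have sQ: "sets Q = sets M" using Q unfolding iid_dist_def by blast
    have E1: "E 1 \<in> borel_measurable Q"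
      using space unfolding measurable_cong_sets[OF sQ refl] evidence_space_def by blast
    have l: "lam Q \<in> weights" by (rule log_optimal_growth(1)[OF E1 opt])
    from tail[OF Q opt] obtain A where A: "A \<in> sets Q" "emeasure Q A \<le> ennreal \<delta>"
      "AE \<omega> in Q. \<omega> \<notin> A \<longrightarrow> (\<forall>k\<ge>m1. W' k \<omega> \<le> exp (real k * c) * wealth E (lam Q) k \<omega>)" by blast
    show "\<exists>A\<in>sets Q. emeasure Q A \<le> ennreal \<delta> \<and>
      (AE \<omega> in Q. \<omega> \<notin> A \<longrightarrow> (\<forall>k\<ge>m0. ereal (1 / real k) * elog (W' k \<omega> / W k \<omega>) \<le> ereal \<epsilon>))"
    proof (intro bexI[OF _ A(1)] conjI A(2))
      show "AE \<omega> in Q. \<omega> \<notin> A \<longrightarrow> (\<forall>k\<ge>m0. ereal (1 / real k) * elog (W' k \<omega> / W k \<omega>) \<le> ereal \<epsilon>)"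
        using A(3) iid_log_optimal_positive[OF Q opt] AE_space
      proof eventually_elim
        case (elim \<omega>)
        show ?case
        proof (intro impI allI)
          fix k assume \<omega>: "\<omega> \<notin> A" and k: "m0 \<le> k"
          have k1: "1 \<le> k" "m1 \<le> k" "N \<le> k" using k m0 by auto
          have k0: "0 < real k" using k1(1) by simp
          have \<omega>M: "\<omega> \<in> Sigma_Algebra.space M" using elim(3) sets_eq_imp_space_eq[OF sQ] by simp
          have pos: "0 < lam Q \<bullet> E i \<omega>" if "1 \<le> i" for i using elim(2) that by simp
          note R = portfolio_regret_wealth[where W=W and E=E and l="lam Q" and n=k, OF regret k1(1) \<omega>M l pos]
          let ?y = "exp (real k * c) * wealth E (lam Q) k \<omega> / W k \<omega>"
          have y: "0 < ?y" using R(1,2) by simp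
          have "W' k \<omega> \<le> exp (real k * c) * wealth E (lam Q) k \<omega>" using elim(1) \<omega> k1(2) by blast
          then have "W' k \<omega> / W k \<omega> \<le> ?y" using R(1) by (intro divide_right_mono) auto
          then have "elog (W' k \<omega> / W k \<omega>) \<le> ereal (ln ?y)" by (rule elog_le[OF y])
          also have "ln ?y = real k * c + ln (wealth E (lam Q) k \<omega>) - ln (W k \<omega>)"
            using R(1,2) by (simp add: ln_mult ln_div)
          also have "\<dots> \<le> real k * \<epsilon>"
            using R(3) N[OF k1(3)] by (simp add: c_def mult.commute)
          finally have le: "elog (W' k \<omega> / W k \<omega>) \<le> ereal (real k * \<epsilon>)" by simp
          have "ereal (1 / real k) * elog (W' k \<omega> / W k \<omega>) \<le> ereal (1 / real k) * ereal (real k * \<epsilon>)"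
            by (rule ereal_mult_left_mono[OF le]) simp
          also have "\<dots> = ereal \<epsilon>" using k0 by simp
          finally show "ereal (1 / real k) * elog (W' k \<omega> / W k \<omega>) \<le> ereal \<epsilon>" .
        qed
      qed
    qed
  qed
qed

lemma e_process_asymptotic_equivalence:
  fixes E :: "nat \<Rightarrow> 'w \<Rightarrow> real ^ 'j::finite" and a :: "nat \<Rightarrow> real"
  assumes space: "evidence_space z M E" and alternatives: "\<forall>Q\<in>QQ. iid_dist M E Q"
    and lam: "\<forall>Q\<in>QQ. log_optimal E Q (lam Q)"
    and W: "W \<in> e_processes z M E" and regret: "portfolio_regret_bound M E W r"
    and a: "filterlim a at_top sequentially" "\<And>\<epsilon>. 0 < \<epsilon> \<Longrightarrow> summable (\<lambda>k. exp (- (a k * \<epsilon> / 2)))"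
    and ra: "(\<lambda>n. inverse (a n) * r n) \<longlonglongrightarrow> 0"
  shows "unif_tail_vanishes QQ (\<lambda>Q k \<omega>. ereal (inverse (a k)) * \<bar>elog (W k \<omega>) - elog (wealth E (lam Q) k \<omega>)\<bar>)"
proof (rule unif_tail_vanishesI)
  fix \<epsilon> \<delta> :: real assume \<epsilon>: "0 < \<epsilon>" and \<delta>: "0 < \<delta>"
  have a_pos: "eventually (\<lambda>k. 0 < a k) sequentially"
    using a(1) unfolding filterlim_at_top_dense by blast
  have s: "summable (\<lambda>k. exp (- (a k * \<epsilon>)))" using a(2)[of "2 * \<epsilon>"] \<epsilon> by simp
  have r: "eventually (\<lambda>k. r k \<le> a k * \<epsilon>) sequentially"
    using order_tendstoD(2)[OF ra \<epsilon>] a_pos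
  proof eventually_elim
    case (elim k)
    then show ?case by (simp add: field_simps)
  qed
  obtain m1 where m1: "1 \<le> m1" and tail: "\<And>Q l. iid_dist M E Q \<Longrightarrow> log_optimal E Q l \<Longrightarrow>
    (\<exists>A\<in>sets Q. emeasure Q A \<le> ennreal \<delta> \<and>
      (AE \<omega> in Q. \<omega> \<notin> A \<longrightarrow> (\<forall>k\<ge>m1. 0 < W k \<omega> \<and> 0 < wealth E l k \<omega> \<and>
        ln (wealth E l k \<omega>) = (\<Sum>i=1..k. ln (l \<bullet> E i \<omega>)) \<and>
        \<bar>ln (W k \<omega>) - ln (wealth E l k \<omega>)\<bar> \<le> a k * \<epsilon>)))"
    using e_process_log_wealth_close[OF space W regret s r \<delta>] by blast
  obtain N where N: "\<And>k. N \<le> k \<Longrightarrow> 0 < a k"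
    using a_pos unfolding eventually_sequentially by blast
  define m0 where "m0 = max m1 N"
  have m0: "m1 \<le> m0" "N \<le> m0" by (auto simp: m0_def)
  show "\<exists>m0. \<forall>Q\<in>QQ. \<exists>A\<in>sets Q. emeasure Q A \<le> ennreal \<delta> \<and>
      (AE \<omega> in Q. \<omega> \<notin> A \<longrightarrow> (\<forall>k\<ge>m0. ereal (inverse (a k)) * \<bar>elog (W k \<omega>) - elog (wealth E (lam Q) k \<omega>)\<bar> \<le> ereal \<epsilon>))"
  proof (intro exI[of _ m0] ballI)
    fix Q assume QQ: "Q \<in> QQ"
    have Q: "iid_dist M E Q" and opt: "log_optimal E Q (lam Q)" using alternatives lam QQ by auto
    from tail[OF Q opt] obtain A where A: "A \<in> sets Q" "emeasure Q A \<le> ennreal \<delta>"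
      "AE \<omega> in Q. \<omega> \<notin> A \<longrightarrow> (\<forall>k\<ge>m1. 0 < W k \<omega> \<and> 0 < wealth E (lam Q) k \<omega> \<and>
        ln (wealth E (lam Q) k \<omega>) = (\<Sum>i=1..k. ln (lam Q \<bullet> E i \<omega>)) \<and>
        \<bar>ln (W k \<omega>) - ln (wealth E (lam Q) k \<omega>)\<bar> \<le> a k * \<epsilon>)" by blast
    show "\<exists>A\<in>sets Q. emeasure Q A \<le> ennreal \<delta> \<and>
      (AE \<omega> in Q. \<omega> \<notin> A \<longrightarrow> (\<forall>k\<ge>m0. ereal (inverse (a k)) * \<bar>elog (W k \<omega>) - elog (wealth E (lam Q) k \<omega>)\<bar> \<le> ereal \<epsilon>))"
    proof (intro bexI[OF _ A(1)] conjI A(2))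
      show "AE \<omega> in Q. \<omega> \<notin> A \<longrightarrow> (\<forall>k\<ge>m0. ereal (inverse (a k)) * \<bar>elog (W k \<omega>) - elog (wealth E (lam Q) k \<omega>)\<bar> \<le> ereal \<epsilon>)"
        using A(3)
      proof eventually_elim
        case (elim \<omega>)
        show ?case
        proof (intro impI allI)
          fix k assume \<omega>: "\<omega> \<notin> A" and k: "m0 \<le> k"
          have k1: "m1 \<le> k" "0 < a k" using k m0 N[of k] by auto
          have R: "0 < W k \<omega>" "0 < wealth E (lam Q) k \<omega>"
            "\<bar>ln (W k \<omega>) - ln (wealth E (lam Q) k \<omega>)\<bar> \<le> a k * \<epsilon>" using elim \<omega> k1(1) by auto
          have "inverse (a k) * \<bar>ln (W k \<omega>) - ln (wealth E (lam Q) k \<omega>)\<bar> \<le> inverse (a k) * (a k * \<epsilon>)"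
            using R(3) k1(2) by (intro mult_left_mono) auto
          also have "\<dots> = \<epsilon>" using k1(2) by simp
          finally show "ereal (inverse (a k)) * \<bar>elog (W k \<omega>) - elog (wealth E (lam Q) k \<omega>)\<bar> \<le> ereal \<epsilon>"
            using R(1,2) by (simp add: elog_def)
        qed
      qed
    qed
  qed
qed

text \<open>
  At the scale \<open>a\<^sub>k = k powr (1 / p)\<close> the process \<open>W\<close> is within \<open>\<epsilon> / 2\<close> of the log-optimal wealth, whose
  logarithm is a sum of i.i.d. variables. The strong law for these sums supplies the other half.
\<close>

lemma e_process_growth_rate:
  fixes E :: "nat \<Rightarrow> 'w \<Rightarrow> real ^ 'j::finite"
  assumes space: "evidence_space z M E" and alternatives: "\<forall>Q\<in>QQ. iid_dist M E Q"
    and lam: "\<forall>Q\<in>QQ. log_optimal E Q (lam Q)"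
    and W: "W \<in> e_processes z M E" and regret: "portfolio_regret_bound M E W r"
    and p: "1 \<le> p" "p < 2" and r: "r \<in> o(\<lambda>n. real n powr (1 / p))"
    and ui: "(\<lambda>m::nat. SUP Q\<in>QQ. \<integral>\<^sup>+ \<omega>. ennreal (centred_moment E Q (lam Q) p \<omega>) *
             indicator {\<omega>. centred_moment E Q (lam Q) p \<omega> \<ge> real m} \<omega> \<partial>Q) \<longlonglongrightarrow> 0"
  shows "unif_tail_vanishes QQ (\<lambda>Q k \<omega>. ereal (real k powr (1 - 1 / p)) *
             \<bar>ereal (1 / real k) * elog (W k \<omega>) - growth E Q (lam Q)\<bar>)"
proof (rule unif_tail_vanishesI)
  fix \<epsilon> \<delta> :: real assume \<epsilon>: "0 < \<epsilon>" and \<delta>: "0 < \<delta>"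
  define c where "c = \<epsilon> / 2"
  have c: "0 < c" using \<epsilon> by (simp add: c_def)
  have \<delta>2: "0 < \<delta> / 2" using \<delta> by simp
  have s: "summable (\<lambda>k. exp (- (real k powr (1 / p) * c)))"
    by (rule summable_exp_minus_powr) (use c p in auto)
  have r': "eventually (\<lambda>k. r k \<le> real k powr (1 / p) * c) sequentially"
    using landau_o.smallD[OF r c] by eventually_elim (simp add: mult.commute)
  obtain m1 where m1: "1 \<le> m1" and tail: "\<And>Q l. iid_dist M E Q \<Longrightarrow> log_optimal E Q l \<Longrightarrow>
    (\<exists>A\<in>sets Q. emeasure Q A \<le> ennreal (\<delta> / 2) \<and>
      (AE \<omega> in Q. \<omega> \<notin> A \<longrightarrow> (\<forall>k\<ge>m1. 0 < W k \<omega> \<and> 0 < wealth E l k \<omega> \<and>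
        ln (wealth E l k \<omega>) = (\<Sum>i=1..k. ln (l \<bullet> E i \<omega>)) \<and>
        \<bar>ln (W k \<omega>) - ln (wealth E l k \<omega>)\<bar> \<le> real k powr (1 / p) * c)))"
    using e_process_log_wealth_close[OF space W regret s r' \<delta>2] by blast
  from marcinkiewicz_zygmund_uniform[OF p c \<delta>2, where 'a='w]
  obtain \<eta> where \<eta>: "0 < \<eta>" and MZ:
    "\<forall>B\<ge>0. \<exists>m0\<ge>1. \<forall>(Q :: 'w measure) (X :: nat \<Rightarrow> 'w \<Rightarrow> real). prob_space Q \<longrightarrow> prob_space.indep_vars Q (\<lambda>_. borel) X {1..} \<longrightarrow>
      (\<forall>i\<ge>1. distr Q borel (X i) = distr Q borel (X 1)) \<longrightarrow> integrable Q (\<lambda>\<omega>. \<bar>X 1 \<omega>\<bar> powr p) \<longrightarrow>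
      (\<integral>\<omega>. \<bar>X 1 \<omega>\<bar> powr p * of_bool (B \<le> \<bar>X 1 \<omega>\<bar> powr p) \<partial>Q) \<le> \<eta> \<longrightarrow>
      measure Q {\<omega>\<in>Sigma_Algebra.space Q. \<exists>k\<ge>m0. c * real k powr (1 / p) \<le> \<bar>\<Sum>i=1..k. X i \<omega> - (\<integral>\<omega>. X 1 \<omega> \<partial>Q)\<bar>} \<le> \<delta> / 2"
    by (elim exE conjE)
  let ?I = "\<lambda>m::nat. \<lambda>Q. \<integral>\<^sup>+ \<omega>. ennreal (centred_moment E Q (lam Q) p \<omega>) *
             indicator {\<omega>. centred_moment E Q (lam Q) p \<omega> \<ge> real m} \<omega> \<partial>Q"
  have "eventually (\<lambda>m. (SUP Q\<in>QQ. ?I m Q) < ennreal \<eta>) sequentially"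
    by (rule order_tendstoD(2)[OF ui]) (use \<eta> in simp)
  then obtain B where B: "(SUP Q\<in>QQ. ?I B Q) < ennreal \<eta>"
    unfolding eventually_sequentially by blast
  have tail_moment: "?I B Q \<le> ennreal \<eta>" if "Q \<in> QQ" for Q
    by (rule order_trans[OF SUP_upper[OF that, of "?I B"] less_imp_le[OF B]])
  from MZ[THEN spec, THEN mp, OF of_nat_0_le_iff[of B]]
  obtain m2 where MZ_B: "\<forall>(Q :: 'w measure) (X :: nat \<Rightarrow> 'w \<Rightarrow> real). prob_space Q \<longrightarrow> prob_space.indep_vars Q (\<lambda>_. borel) X {1..} \<longrightarrow>
      (\<forall>i\<ge>1. distr Q borel (X i) = distr Q borel (X 1)) \<longrightarrow> integrable Q (\<lambda>\<omega>. \<bar>X 1 \<omega>\<bar> powr p) \<longrightarrow>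
      (\<integral>\<omega>. \<bar>X 1 \<omega>\<bar> powr p * of_bool (real B \<le> \<bar>X 1 \<omega>\<bar> powr p) \<partial>Q) \<le> \<eta> \<longrightarrow>
      measure Q {\<omega>\<in>Sigma_Algebra.space Q. \<exists>k\<ge>m2. c * real k powr (1 / p) \<le> \<bar>\<Sum>i=1..k. X i \<omega> - (\<integral>\<omega>. X 1 \<omega> \<partial>Q)\<bar>} \<le> \<delta> / 2"
    by (elim exE conjE)
  define m0 where "m0 = max m1 m2"
  have m0: "m1 \<le> m0" "m2 \<le> m0" "1 \<le> m0" using m1 by (auto simp: m0_def)
  show "\<exists>m0. \<forall>Q\<in>QQ. \<exists>A\<in>sets Q. emeasure Q A \<le> ennreal \<delta> \<and>
      (AE \<omega> in Q. \<omega> \<notin> A \<longrightarrow> (\<forall>k\<ge>m0. ereal (real k powr (1 - 1 / p)) *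
             \<bar>ereal (1 / real k) * elog (W k \<omega>) - growth E Q (lam Q)\<bar> \<le> ereal \<epsilon>))"
  proof (intro exI[of _ m0] ballI)
    fix Q assume QQ: "Q \<in> QQ"
    have Q: "iid_dist M E Q" and opt: "log_optimal E Q (lam Q)" using alternatives lam QQ by auto
    have pQ: "prob_space Q" using Q unfolding iid_dist_def by blast
    interpret Q: prob_space Q by (rule pQ)
    have indepE: "Q.indep_vars (\<lambda>_. borel) E {1..}" using Q unfolding iid_dist_def by blast
    have EQ: "E i \<in> borel_measurable Q" if "1 \<le> i" for i
      using indepE that by (auto simp: Q.indep_vars_def)
    have one: "(1::nat) \<le> 1" by simp
    note g = log_optimal_growth[OF EQ[OF one] opt]
    define \<gamma> where "\<gamma> = (\<integral>\<omega>. ln (lam Q \<bullet> E 1 \<omega>) \<partial>Q)"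
    have growth: "growth E Q (lam Q) = ereal \<gamma>" using g(4) by (simp add: \<gamma>_def)
    define X where "X i \<omega> = ln (lam Q \<bullet> E i \<omega>) - \<gamma>" for i \<omega>
    have hm: "(\<lambda>x. ln (lam Q \<bullet> x) - \<gamma>) \<in> borel_measurable borel" by measurable
    have Xm: "X i \<in> borel_measurable Q" if "1 \<le> i" for i
      unfolding X_def by (rule measurable_compose[OF EQ[OF that] hm])
    have indepX: "Q.indep_vars (\<lambda>_. borel) X {1..}"
      unfolding X_def by (rule Q.indep_vars_compose2[OF indepE, where Y="\<lambda>i x. ln (lam Q \<bullet> x) - \<gamma>"]) (rule hm)
    have idX: "\<forall>i\<ge>1. distr Q borel (X i) = distr Q borel (X 1)"
    proof (intro allI impI)
      fix i :: nat assume i: "1 \<le> i"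
      have "distr Q borel (E i) = distr Q borel (E 1)" using Q i unfolding iid_dist_def by blast
      then have "distr (distr Q borel (E i)) borel (\<lambda>x. ln (lam Q \<bullet> x) - \<gamma>)
          = distr (distr Q borel (E 1)) borel (\<lambda>x. ln (lam Q \<bullet> x) - \<gamma>)" by (simp only:)
      then show "distr Q borel (X i) = distr Q borel (X 1)"
        unfolding distr_distr[OF hm EQ[OF i]] distr_distr[OF hm EQ[OF one]] comp_def X_def .
    qed
    have meanX: "(\<integral>\<omega>. X 1 \<omega> \<partial>Q) = 0"
      unfolding X_def using g(3) by (simp add: \<gamma>_def Q.prob_space)
    define Z where "Z \<omega> = \<bar>X 1 \<omega>\<bar> powr p" for \<omega>
    have Zm: "Z \<in> borel_measurable Q" unfolding Z_def using Xm[OF one] by measurable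
    have cm: "centred_moment E Q (lam Q) p \<omega> = Z \<omega>" for \<omega>
      by (simp add: centred_moment_def growth Z_def X_def)
    define Z' where "Z' \<omega> = Z \<omega> * of_bool (real B \<le> Z \<omega>)" for \<omega>
    have Z'm: "Z' \<in> borel_measurable Q" unfolding Z'_def using Zm by measurable
    have Z0: "0 \<le> Z \<omega>" "0 \<le> Z' \<omega>" for \<omega> by (auto simp: Z_def Z'_def)
    have "(\<integral>\<^sup>+ \<omega>. ennreal (Z' \<omega>) \<partial>Q) = ?I B Q"
      unfolding cm by (intro nn_integral_cong) (auto simp: Z'_def indicator_def)
    also have "\<dots> \<le> ennreal \<eta>" by (rule tail_moment[OF QQ])
    finally have Z'\<eta>: "(\<integral>\<^sup>+ \<omega>. ennreal (Z' \<omega>) \<partial>Q) \<le> ennreal \<eta>" .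
    have Z'i: "integrable Q Z'"
      by (rule integrableI_nonneg[OF Z'm]) (use Z0 Z'\<eta> in \<open>auto intro: le_less_trans\<close>)
    have "ennreal (\<integral>\<omega>. Z' \<omega> \<partial>Q) \<le> ennreal \<eta>"
      using Z'\<eta> nn_integral_eq_integral[OF Z'i] Z0 by simp
    then have Z'le: "(\<integral>\<omega>. Z' \<omega> \<partial>Q) \<le> \<eta>" using \<eta> by (simp add: ennreal_le_iff)
    \<comment> \<open>A finite tail moment makes the whole moment finite, since \<open>Z \<le> B + Z'\<close>.\<close>
    have "integrable Q (\<lambda>\<omega>. real B + Z' \<omega>)" using Z'i by simp
    then have Zi: "integrable Q Z"
    proof (rule Bochner_Integration.integrable_bound[OF _ Zm])
      have "Z \<omega> \<le> real B + Z' \<omega>" for \<omega> by (auto simp: Z'_def)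
      then show "AE \<omega> in Q. norm (Z \<omega>) \<le> norm (real B + Z' \<omega>)" using Z0 by (auto intro: order_trans)
    qed
    define C where "C = {\<omega>\<in>Sigma_Algebra.space Q. \<exists>k\<ge>m2. c * real k powr (1 / p) \<le> \<bar>\<Sum>i=1..k. X i \<omega> - (\<integral>\<omega>. X 1 \<omega> \<partial>Q)\<bar>}"
    have "measure Q C \<le> \<delta> / 2"
      unfolding C_def
      by (rule mp[OF mp[OF mp[OF mp[OF mp[OF spec[OF spec[OF MZ_B, of Q], of X] pQ] indepX] idX]
        Zi[unfolded Z_def]] Z'le[unfolded Z'_def Z_def]])
    then have C\<delta>: "emeasure Q C \<le> ennreal (\<delta> / 2)"
      unfolding Q.emeasure_eq_measure by (rule ennreal_leI)
    have "(\<lambda>\<omega>. \<Sum>i=1..k. X i \<omega> - (\<integral>\<omega>. X 1 \<omega> \<partial>Q)) \<in> borel_measurable Q" for k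
      by (intro borel_measurable_sum borel_measurable_diff Xm borel_measurable_const) simp
    then have CQ: "C \<in> sets Q" unfolding C_def by measurable
    from tail[OF Q opt] obtain A where A: "A \<in> sets Q" "emeasure Q A \<le> ennreal (\<delta> / 2)"
      "AE \<omega> in Q. \<omega> \<notin> A \<longrightarrow> (\<forall>k\<ge>m1. 0 < W k \<omega> \<and> 0 < wealth E (lam Q) k \<omega> \<and>
        ln (wealth E (lam Q) k \<omega>) = (\<Sum>i=1..k. ln (lam Q \<bullet> E i \<omega>)) \<and>
        \<bar>ln (W k \<omega>) - ln (wealth E (lam Q) k \<omega>)\<bar> \<le> real k powr (1 / p) * c)" by blast
    have "emeasure Q (A \<union> C) \<le> emeasure Q A + emeasure Q C"
      by (rule emeasure_subadditive[OF A(1) CQ])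
    also have "\<dots> \<le> ennreal (\<delta> / 2) + ennreal (\<delta> / 2)" by (rule add_mono[OF A(2) C\<delta>])
    also have "\<dots> = ennreal \<delta>" using \<delta> by (simp add: ennreal_plus[symmetric])
    finally have AC\<delta>: "emeasure Q (A \<union> C) \<le> ennreal \<delta>" .
    have AC: "A \<union> C \<in> sets Q" using A(1) CQ by simp
    show "\<exists>A\<in>sets Q. emeasure Q A \<le> ennreal \<delta> \<and>
      (AE \<omega> in Q. \<omega> \<notin> A \<longrightarrow> (\<forall>k\<ge>m0. ereal (real k powr (1 - 1 / p)) *
             \<bar>ereal (1 / real k) * elog (W k \<omega>) - growth E Q (lam Q)\<bar> \<le> ereal \<epsilon>))"
    proof (intro bexI[OF _ AC] conjI AC\<delta>)
      show "AE \<omega> in Q. \<omega> \<notin> A \<union> C \<longrightarrow> (\<forall>k\<ge>m0. ereal (real k powr (1 - 1 / p)) *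
             \<bar>ereal (1 / real k) * elog (W k \<omega>) - growth E Q (lam Q)\<bar> \<le> ereal \<epsilon>)"
        using A(3) AE_space
      proof eventually_elim
        case (elim \<omega>)
        show ?case
        proof (intro impI allI)
          fix k assume \<omega>: "\<omega> \<notin> A \<union> C" and k: "m0 \<le> k"
          have k1: "m1 \<le> k" "m2 \<le> k" "0 < real k" using k m0 by auto
          have R: "0 < W k \<omega>" "ln (wealth E (lam Q) k \<omega>) = (\<Sum>i=1..k. ln (lam Q \<bullet> E i \<omega>))"
            "\<bar>ln (W k \<omega>) - ln (wealth E (lam Q) k \<omega>)\<bar> \<le> real k powr (1 / p) * c"
            using elim(1) \<omega> k1(1) by auto
          have "\<omega> \<in> C" if "c * real k powr (1 / p) \<le> \<bar>\<Sum>i=1..k. X i \<omega>\<bar>"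
            using that elim(2) k1(2) unfolding C_def meanX by auto
          then have "\<bar>\<Sum>i=1..k. X i \<omega>\<bar> \<le> real k powr (1 / p) * c"
            using \<omega> by (fastforce simp: mult.commute)
          moreover have "(\<Sum>i=1..k. X i \<omega>) = ln (wealth E (lam Q) k \<omega>) - real k * \<gamma>"
            unfolding R(2) X_def by (simp add: sum_subtractf)
          moreover have "real k powr (1 / p) * \<epsilon> = real k powr (1 / p) * c + real k powr (1 / p) * c"
            by (simp add: c_def)
          ultimately have main: "\<bar>ln (W k \<omega>) - real k * \<gamma>\<bar> \<le> real k powr (1 / p) * \<epsilon>"
            using R(3) by linarith
          have "real k powr (1 - 1 / p) * \<bar>1 / real k * ln (W k \<omega>) - \<gamma>\<bar>
              = real k powr (1 - 1 / p) * (\<bar>ln (W k \<omega>) - real k * \<gamma>\<bar> / real k)"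
          proof -
            have "1 / real k * ln (W k \<omega>) - \<gamma> = (ln (W k \<omega>) - real k * \<gamma>) / real k"
              using k1(3) by (simp add: diff_divide_distrib)
            then show ?thesis using k1(3) by (simp add: abs_divide)
          qed
          also have "\<dots> \<le> real k powr (1 - 1 / p) * (real k powr (1 / p) * \<epsilon> / real k)"
            using main k1(3) by (intro mult_left_mono divide_right_mono) auto
          also have "\<dots> = (real k powr (1 - 1 / p) * real k powr (1 / p)) * \<epsilon> / real k" by simp
          also have "real k powr (1 - 1 / p) * real k powr (1 / p) = real k"
            using k1(3) by (simp add: powr_add[symmetric])
          also have "real k * \<epsilon> / real k = \<epsilon>" using k1(3) by simp
          finally show "ereal (real k powr (1 - 1 / p)) *
             \<bar>ereal (1 / real k) * elog (W k \<omega>) - growth E Q (lam Q)\<bar> \<le> ereal \<epsilon>"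
            using R(1) by (simp add: elog_def growth)
        qed
      qed
    qed
  qed
qed

section \<open>Uniform and instance-wise log-optimality\<close>

theorem theorem5p2:
  fixes z :: "'j::finite"
    and M :: "'w measure"
    and E :: "nat \<Rightarrow> 'w \<Rightarrow> real ^ 'j"
    and QQ :: "'w measure set"
    and lam :: "'w measure \<Rightarrow> real ^ 'j"
    and W :: "nat \<Rightarrow> 'w \<Rightarrow> real"
    and r :: "nat \<Rightarrow> real"
  assumes space: "evidence_space z M E"
    and alternatives: "\<forall>Q\<in>QQ. iid_dist M E Q"
    and lam: "\<forall>Q\<in>QQ. log_optimal E Q (lam Q)"
    and W: "W \<in> e_processes z M E"
    and regret: "portfolio_regret_bound M E W r"
    and sublinear: "r \<in> o(\<lambda>n. real n)"
  shows
    "(\<forall>W'\<in>e_processes z M E.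
        unif_tail_vanishes QQ (\<lambda>Q k \<omega>. ereal (1 / real k) * elog (W' k \<omega> / W k \<omega>)))
   \<and> (\<forall>a :: nat \<Rightarrow> real.
        (\<forall>n\<ge>1. 0 \<le> a n) \<and> mono_on {1..} a \<and> filterlim a at_top sequentially \<and>
        (\<forall>\<epsilon>>0. summable (\<lambda>k. exp (- (a k * \<epsilon> / 2)))) \<and>
        (\<lambda>n. inverse (a n) * r n) \<longlonglongrightarrow> 0 \<longrightarrow>
        unif_tail_vanishes QQ
          (\<lambda>Q k \<omega>. ereal (inverse (a k)) * \<bar>elog (W k \<omega>) - elog (wealth E (lam Q) k \<omega>)\<bar>))
   \<and> (\<forall>QQ0 \<subseteq> QQ. \<forall>p::real. 1 \<le> p \<and> p < 2 \<and>
        (\<lambda>m::nat. SUP Q\<in>QQ0. \<integral>\<^sup>+ \<omega>. ennreal (centred_moment E Q (lam Q) p \<omega>) *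
             indicator {\<omega>. centred_moment E Q (lam Q) p \<omega> \<ge> real m} \<omega> \<partial>Q) \<longlonglongrightarrow> 0 \<and>
        r \<in> o(\<lambda>n. real n powr (1 / p)) \<longrightarrow>
        unif_tail_vanishes QQ0
          (\<lambda>Q k \<omega>. ereal (real k powr (1 - 1 / p)) *
             \<bar>ereal (1 / real k) * elog (W k \<omega>) - growth E Q (lam Q)\<bar>))"
proof (intro conjI ballI allI impI)
  fix W' assume "W' \<in> e_processes z M E"
  then show "unif_tail_vanishes QQ (\<lambda>Q k \<omega>. ereal (1 / real k) * elog (W' k \<omega> / W k \<omega>))"
    by (rule e_process_log_optimality[OF space alternatives lam regret sublinear])
next
  fix a :: "nat \<Rightarrow> real"
  assume a: "(\<forall>n\<ge>1. 0 \<le> a n) \<and> mono_on {1..} a \<and> filterlim a at_top sequentially \<and>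
        (\<forall>\<epsilon>>0. summable (\<lambda>k. exp (- (a k * \<epsilon> / 2)))) \<and>
        (\<lambda>n. inverse (a n) * r n) \<longlonglongrightarrow> 0"
  show "unif_tail_vanishes QQ
          (\<lambda>Q k \<omega>. ereal (inverse (a k)) * \<bar>elog (W k \<omega>) - elog (wealth E (lam Q) k \<omega>)\<bar>)"
    by (rule e_process_asymptotic_equivalence[OF space alternatives lam W regret]) (use a in auto)
next
  fix QQ0 :: "'w measure set" and p :: real
  assume sub: "QQ0 \<subseteq> QQ"
    and p: "1 \<le> p \<and> p < 2 \<and>
        (\<lambda>m::nat. SUP Q\<in>QQ0. \<integral>\<^sup>+ \<omega>. ennreal (centred_moment E Q (lam Q) p \<omega>) *
             indicator {\<omega>. centred_moment E Q (lam Q) p \<omega> \<ge> real m} \<omega> \<partial>Q) \<longlonglongrightarrow> 0 \<and>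
        r \<in> o(\<lambda>n. real n powr (1 / p))"
  have "\<forall>Q\<in>QQ0. iid_dist M E Q" "\<forall>Q\<in>QQ0. log_optimal E Q (lam Q)"
    using sub alternatives lam by auto
  then show "unif_tail_vanishes QQ0
          (\<lambda>Q k \<omega>. ereal (real k powr (1 - 1 / p)) *
             \<bar>ereal (1 / real k) * elog (W k \<omega>) - growth E Q (lam Q)\<bar>)"
    by (rule e_process_growth_rate[OF space _ _ W regret]) (use p in blast)+
qed

end
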